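(* Let $p\ge 0$ be an integer and let $f$ be a piecewise $W^{\alpha,2}([0,1])$ function (with finitely many jumps), where $0<\alpha<p+1$. Let $Y^n=\delta^n f+\xi^n$, $n\in\mathbb N$, and assume that there is $\beta>0$ such that for each $n$, all real $\mu_s$, $s\in S^n$, and each $c\ge0$, $$\mathbb P\Big(\Big|\sum_{s\in S^n}\mu_s\xi_s^n\Big|\ge c\Big)\le 2\exp\Big(-\frac{c^2}{\beta\sum_{s\in S^n}\mu_s^2}\Big).$$ Let $\kappa>0$ be such that, for some $M>0$, $|\mathscr R^n|\ge Mn^\kappa$ for all sufficiently large $n$ (for instance $\kappa=2$), let $D$ be an upper bound for the dimensions of the spaces $\mathscr G^n_P$, $P\in\mathscr R^n$, $n\in\mathbb N$, and let $(\gamma_n)$ be a positive sequence with $\gamma_n\to0$ and $\gamma_n>\beta D\frac{\kappa+1}{\kappa}\frac{\ln|\mathscr R^n|}{n}$ for all sufficiently large $n$. For each $n$ let $(\hat{\mathscr P}^n,\hat f^n)$ be a minimiser over $(\mathscr Q,h)\in\mathfrak S^n$ of $\gamma_n|\mathscr Q|+\|h-Y^n\|^2/n$. Then for almost all $\omega\in\Omega$, $$\|\iota^n\hat f^n(\omega)-f\|^2=O\Big(\gamma_n^{\frac{2\alpha}{2\alpha+1}}\Big)\quad (n\to\infty).$$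
   Context: $S^n=\{1,\dots,n\}$; $I_i=[(i-1)/n,i/n)$. $\delta^n:L^2([0,1))\to\mathbb R^{S^n}$, $(\delta^n g)_i=n\int_{I_i}g$, and $\iota^n z=\sum_{i}z_i\mathbf 1_{I_i}$. The norm on $\mathbb R^{S^n}$ is Euclidean, that of functions on $[0,1)$ is the $L^2$ norm. The noise variables $\xi^n=(\xi^n_s)_{s\in S^n}$ are real random variables on a common probability space $(\Omega,\mathscr F,\mathbb P)$. $\mathscr R^n=\{[i,j]:1\le i\le j\le n\}$ is the set of discrete intervals $[i,j]=\{i,\dots,j\}$ in $S^n$, so $|\mathscr R^n|=n(n+1)/2$; $\mathfrak P^n$ is the collection of all partitions of $S^n$ into discrete intervals. Let $\mathscr G$ be the space of polynomials on $[0,1)$ of degree at most $p$; for $P\subset S^n$ let $\mathscr G_P^n=\{\mathbf 1_P\cdot\delta^n q:q\in\mathscr G\}$ and for $\mathscr P\in\mathfrak P^n$ let $\mathscr G_{\mathscr P}=\mathrm{span}\{\mathscr G_P^n:P\in\mathscr P\}$. Then $\mathfrak S^n=\{(\mathscr P,h):\mathscr P\in\mathfrak P^n,h\in\mathscr G_{\mathscr P}\}$; $|\mathscr P|$ is the number of intervals in $\mathscr P$. Piecewise Sobolev functions: for real $\alpha>1/2$, $J\in\mathbb N$ and $0=x_0<x_1<\dots<x_{J+1}=1$, a function $f$ is piecewise $W^{\alpha,2}([0,1])$ with $J$ jumps relative to the partition $\{[x_i,x_{i+1}): i=0,\dots,J\}$ if $f|_{(x_i,x_{i+1})}\in W^{\alpha,2}((x_i,x_{i+1}))$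 for every $i=0,\dots,J$, where $W^{\alpha,2}$ is the (fractional) Sobolev space of order $\alpha$ based on $L^2$. *)

theory Defs
  imports "HOL-Probability.Probability" "HOL-Library.Function_Algebras"
    "HOL-Library.Landau_Symbols" "HOL-Computational_Algebra.Polynomial"
begin

definition L2_on :: "real set \<Rightarrow> (real \<Rightarrow> real) \<Rightarrow> bool" where
  "L2_on U f \<longleftrightarrow>
     f \<in> borel_measurable (lebesgue_on U) \<and> integrable (lebesgue_on U) (\<lambda>x. (f x)\<^sup>2)"

definition L2_norm :: "(real \<Rightarrow> real) \<Rightarrow> real" where
  "L2_norm f = sqrt (LINT x|lebesgue_on {0..<1}. (f x)\<^sup>2)"

definition test_function :: "real set \<Rightarrow> (real \<Rightarrow> real) \<Rightarrow> bool" where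
  "test_function U \<phi> \<longleftrightarrow>
     (\<forall>k x. ((deriv ^^ k) \<phi>) differentiable (at x)) \<and>
     (\<exists>K. compact K \<and> K \<subseteq> U \<and> (\<forall>x. x \<notin> K \<longrightarrow> \<phi> x = 0))"

definition weak_derivative ::
  "nat \<Rightarrow> real set \<Rightarrow> (real \<Rightarrow> real) \<Rightarrow> (real \<Rightarrow> real) \<Rightarrow> bool" where
  "weak_derivative k U f g \<longleftrightarrow>
     (\<forall>\<phi>. test_function U \<phi> \<longrightarrow>
        (LINT x|lebesgue_on U. f x * (deriv ^^ k) \<phi> x)
          = (-1) ^ k * (LINT x|lebesgue_on U. g x * \<phi> x))"

definition gagliardo :: "real \<Rightarrow> real set \<Rightarrow> (real \<Rightarrow> real) \<Rightarrow> ennreal" where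
  "gagliardo s U g =
     (\<integral>\<^sup>+ x. (\<integral>\<^sup>+ y. ennreal ((g x - g y)\<^sup>2 / \<bar>x - y\<bar> powr (1 + 2 * s))
        \<partial>lebesgue_on U) \<partial>lebesgue_on U)"

(* Sobolev-Slobodeckij space of order alpha >= 0 on an open set U: weak derivatives up to order
   floor alpha in L2 and, for non-integer alpha, finite Gagliardo seminorm of order frac alpha of
   the highest one. *)
definition sobolev_W2 :: "real \<Rightarrow> real set \<Rightarrow> (real \<Rightarrow> real) \<Rightarrow> bool" where
  "sobolev_W2 \<alpha> U f \<longleftrightarrow> L2_on U f \<and>
     (\<exists>g. (\<forall>k\<le>nat \<lfloor>\<alpha>\<rfloor>. L2_on U (g k) \<and> weak_derivative k U f (g k)) \<and>
          (frac \<alpha> \<noteq> 0 \<longrightarrow> gagliardo (frac \<alpha>) U (g (nat \<lfloor>\<alpha>\<rfloor>)) < \<infinity>))"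

definition piecewise_sobolev ::
  "real \<Rightarrow> nat \<Rightarrow> (nat \<Rightarrow> real) \<Rightarrow> (real \<Rightarrow> real) \<Rightarrow> bool" where
  "piecewise_sobolev \<alpha> J x f \<longleftrightarrow>
     x 0 = 0 \<and> x (J + 1) = 1 \<and> (\<forall>i\<le>J. x i < x (i + 1)) \<and>
     (\<forall>i\<le>J. sobolev_W2 \<alpha> {x i<..<x (i + 1)} f)"

definition cell :: "nat \<Rightarrow> nat \<Rightarrow> real set" where
  "cell n i = {(real i - 1) / real n..<real i / real n}"

(* A vector indexed by {1..n} is represented by a function on nat vanishing outside {1..n}. *)
definition discretise :: "nat \<Rightarrow> (real \<Rightarrow> real) \<Rightarrow> nat \<Rightarrow> real" where
  "discretise n g i = (if i \<in> {1..n} then real n * (LINT x|lebesgue_on (cell n i). g x) else 0)"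

definition step_embedding :: "nat \<Rightarrow> (nat \<Rightarrow> real) \<Rightarrow> real \<Rightarrow> real" where
  "step_embedding n z x = (\<Sum>i\<in>{1..n}. z i * indicator (cell n i) x)"

definition seq_scale :: "real \<Rightarrow> (nat \<Rightarrow> real) \<Rightarrow> nat \<Rightarrow> real" where
  "seq_scale c z = (\<lambda>i. c * z i)"

lemma vector_space_seq_scale: "vector_space seq_scale"
  by unfold_locales (auto simp: seq_scale_def fun_eq_iff algebra_simps)

definition discrete_intervals :: "nat \<Rightarrow> nat set set" where
  "discrete_intervals n = {{i..j} | i j. 1 \<le> i \<and> i \<le> j \<and> j \<le> n}"

definition interval_partitions :: "nat \<Rightarrow> nat set set set" where
  "interval_partitions n = {Q. partition_on {1..n} Q \<and> Q \<subseteq> discrete_intervals n}"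

definition piece_space :: "nat \<Rightarrow> nat \<Rightarrow> nat set \<Rightarrow> (nat \<Rightarrow> real) set" where
  "piece_space p n P = {(\<lambda>i. indicator P i * discretise n (poly q) i) | q. degree q \<le> p}"

definition partition_space :: "nat \<Rightarrow> nat \<Rightarrow> nat set set \<Rightarrow> (nat \<Rightarrow> real) set" where
  "partition_space p n Q = module.span seq_scale (\<Union>P\<in>Q. piece_space p n P)"

definition segmentations :: "nat \<Rightarrow> nat \<Rightarrow> (nat set set \<times> (nat \<Rightarrow> real)) set" where
  "segmentations p n = {(Q, h). Q \<in> interval_partitions n \<and> h \<in> partition_space p n Q}"

definition penalised_functional ::
  "nat \<Rightarrow> real \<Rightarrow> (nat \<Rightarrow> real) \<Rightarrow> nat set set \<times> (nat \<Rightarrow> real) \<Rightarrow> real" where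
  "penalised_functional n c y =
     (\<lambda>(Q, h). c * real (card Q) + (L2_set (\<lambda>s. h s - y s) {1..n})\<^sup>2 / real n)"

end

theory Submission
  imports Defs "HOL-Real_Asymp.Real_Asymp"
begin

text \<open>Fix a segmentation \<open>Q\<close> with about \<open>k = \<gamma>\<^sub>n powr (- 1 / (2\<alpha> + 1))\<close> blocks. Comparing the minimiser with the
  best piecewise polynomial on \<open>Q\<close> leaves the noise term \<open>\<langle>\<xi>, fhat - h\<rangle>\<close>, where \<open>fhat - h\<close> is a piecewise
  polynomial on the common refinement. A union bound over all sets \<open>B\<close> of breakpoints, weighted by
  \<open>n powr (- 4/3 (|B| + 1))\<close>, together with Borel-Cantelli bounds the squared noise term by
  \<open>2 \<beta> (|B| + 1) ln n\<close> times the squared norm of \<open>fhat - h\<close>, simultaneously for all \<open>B\<close>. Counting breakpoint sets instead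
  of intervals is what leaves room in the constant: since \<open>\<kappa> \<le> 2\<close> and \<open>D \<ge> 1\<close>, the penalty satisfies
  \<open>n \<gamma>\<^sub>n \<ge> 9/4 \<beta> ln n\<close> and absorbs the noise.

  For the bias, a weak derivative is shown to be an almost everywhere derivative (du Bois-Reymond).
  The highest derivative is approximated on each block by a constant (its value at a point where the
  inner Gagliardo integral is at most average) or by zero, and polynomials are then integrated up.
  This gives the squared error \<open>O(k powr (- 2\<alpha>))\<close>, which balances \<open>\<gamma>\<^sub>n k\<close>. Cells containing a jump are blocks of
  their own.\<close>

subsection \<open>Sub-Gaussian noise on piecewise polynomial spaces\<close>

text \<open>Two constraints shape the proof. First, the number of blocks of the estimator is not
  controlled beforehand, so its share of the noise must be paid by its own penalty, and only a
  fraction below one of the squared error may be spent as well. A tail rate r with threshold c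
  \<beta> k ln n, k = |B| + 1, works when r c > 1 (union bound) and c < 9/4 (penalty); here r = 2/3
  and c = 2, and a wasteful net over the unit sphere would miss this window. Second, for \<alpha>
  \<le> 1/2 the function f may be unbounded near a jump, so a cell with a jump cannot be charged
  O(1/n). Between vectors such a cell costs nothing, since a constant reproduces its mean; the cost
  arises only on returning from vectors to functions. There the mass of f on an interval of length l
  within a piece is shown to be O(l powr \<theta>) with \<theta> = 2 \<alpha> / (2 \<alpha> + 1),
  the exponent of the claim, and eventually 1/n \<le> \<gamma>_n. Local errors are bounded through a
  finite measure of the interval instead of a fixed constant, so that over many blocks they add up
  to a bounded total.\<close>

lemma integrable_lebesgue_on_subset:
  fixes f :: "real \<Rightarrow> real"
  assumes "integrable (lebesgue_on S) f" "T \<subseteq> S" "S \<in> sets lebesgue" "T \<in> sets lebesgue"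
  shows "integrable (lebesgue_on T) f"
proof -
  have "set_integrable lebesgue S f"
    using assms by (simp add: set_integrable_def integrable_restrict_space)
  then have "set_integrable lebesgue T f"
    using assms(4,2) by (rule set_integrable_subset)
  then show ?thesis
    using assms by (simp add: set_integrable_def integrable_restrict_space)
qed

text \<open>Gram-Schmidt in which a vanishing remainder is dropped, so the family \<open>v\<close>
  may be dependent. Only the bound on the number of basis vectors and the spanning property are
  kept.\<close>

lemma orthonormal_basis_exists:
  fixes v :: "nat \<Rightarrow> 'a \<Rightarrow> real"
  assumes "finite S"
  obtains M e where "M \<le> m"
    "\<And>i j. i < M \<Longrightarrow> j < M \<Longrightarrow> (\<Sum>s\<in>S. e i s * e j s) = (if i = j then 1 else 0 :: real)"
    "\<And>i. i < m \<Longrightarrow> \<exists>c. \<forall>s\<in>S. v i s = (\<Sum>j<M. c j * e j s)"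
proof -
  have "\<exists>M\<le>m. \<exists>e :: nat \<Rightarrow> 'a \<Rightarrow> real.
      (\<forall>i<M. \<forall>j<M. (\<Sum>s\<in>S. e i s * e j s) = (if i = j then 1 else 0)) \<and>
      (\<forall>i<m. \<exists>c. \<forall>s\<in>S. v i s = (\<Sum>j<M. c j * e j s))"
  proof (induction m)
    case 0
    then show ?case by auto
  next
    case (Suc m)
    then obtain M e where M: "M \<le> m"
      and on: "\<And>i j. i < M \<Longrightarrow> j < M \<Longrightarrow> (\<Sum>s\<in>S. e i s * e j s) = (if i = j then 1 else 0)"
      and sp: "\<And>i. i < m \<Longrightarrow> \<exists>c. \<forall>s\<in>S. v i s = (\<Sum>j<M. c j * e j s)"
      by blast
    define a where "a j = (\<Sum>s\<in>S. v m s * e j s)" for j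
    define r where "r s = v m s - (\<Sum>j<M. a j * e j s)" for s
    define N where "N = (\<Sum>s\<in>S. (r s)\<^sup>2)"
    have r_orth: "(\<Sum>s\<in>S. r s * e i s) = 0" if "i < M" for i
    proof -
      have "(\<Sum>s\<in>S. r s * e i s) = a i - (\<Sum>s\<in>S. \<Sum>j<M. a j * (e j s * e i s))"
        unfolding r_def a_def
        by (simp add: left_diff_distrib sum_subtractf sum_distrib_right mult.assoc)
      also have "(\<Sum>s\<in>S. \<Sum>j<M. a j * (e j s * e i s)) = (\<Sum>j<M. a j * (\<Sum>s\<in>S. e j s * e i s))"
        by (subst sum.swap) (simp add: sum_distrib_left)
      also have "\<dots> = (\<Sum>j<M. a j * (if j = i then 1 else 0))"
        using on that by (intro sum.cong) auto
      also have "\<dots> = (\<Sum>j<M. if j = i then a j else 0)" by (intro sum.cong) auto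
      also have "\<dots> = a i" using that by simp
      finally show ?thesis by simp
    qed
    show ?case
    proof (cases "N = 0")
      case True
      then have "r s = 0" if "s \<in> S" for s
        using that assms by (simp add: N_def sum_nonneg_eq_0_iff)
      then have "\<forall>s\<in>S. v m s = (\<Sum>j<M. a j * e j s)" by (simp add: r_def)
      then have "\<forall>i<Suc m. \<exists>c. \<forall>s\<in>S. v i s = (\<Sum>j<M. c j * e j s)"
        using sp less_Suc_eq by blast
      moreover have "M \<le> Suc m" using M by simp
      ultimately show ?thesis using on by blast
    next
      case False
      then have Npos: "N > 0" using sum_nonneg[of S "\<lambda>s. (r s)\<^sup>2"] by (simp add: N_def)
      define e' where "e' = e(M := (\<lambda>s. r s / sqrt N))"
      have e'M: "e' M s = r s / sqrt N" for s by (simp add: e'_def)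
      have e'l: "e' i = e i" if "i < M" for i using that by (simp add: e'_def)
      have "(\<Sum>s\<in>S. e' M s * e' M s) = (\<Sum>s\<in>S. (r s)\<^sup>2) / N"
        using Npos by (simp add: e'M sum_divide_distrib power2_eq_square)
      then have 1: "(\<Sum>s\<in>S. e' M s * e' M s) = 1" using Npos by (simp add: N_def)
      have 2: "(\<Sum>s\<in>S. e' M s * e' i s) = 0" if "i < M" for i
        using r_orth[OF that] by (simp add: e'M e'l that sum_divide_distrib[symmetric])
      have 3: "(\<Sum>s\<in>S. e' i s * e' M s) = 0" if "i < M" for i
        using 2[OF that] by (simp add: mult.commute)
      have on': "\<forall>i<Suc M. \<forall>j<Suc M. (\<Sum>s\<in>S. e' i s * e' j s) = (if i = j then 1 else 0)"
        using 1 2 3 on e'l by (auto simp: less_Suc_eq)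
      have "\<exists>c. \<forall>s\<in>S. v i s = (\<Sum>j<Suc M. c j * e' j s)" if "i < Suc m" for i
      proof (cases "i = m")
        case True
        have "\<forall>s\<in>S. v m s = (\<Sum>j<Suc M. (a(M := sqrt N)) j * e' j s)"
          using Npos by (simp add: e'M e'l r_def)
        then show ?thesis using True by blast
      next
        case False
        then have "i < m" using that by simp
        then obtain c where "\<forall>s\<in>S. v i s = (\<Sum>j<M. c j * e j s)" using sp by blast
        then have "\<forall>s\<in>S. v i s = (\<Sum>j<Suc M. (c(M := 0)) j * e' j s)" by (simp add: e'l)
        then show ?thesis by blast
      qed
      moreover have "Suc M \<le> Suc m" using M by simp
      ultimately show ?thesis using on' by blast
    qed
  qed
  then show ?thesis using that by blast
qed

text \<open>Truncation rather than nearest-integer rounding keeps \<open>j * y\<close> above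
  \<open>j\<^sup>2\<close>: the half-space with normal \<open>j\<close> that detects
  \<open>y\<close> then has a threshold equal to the squared norm of \<open>j\<close>. The loss is
  (k + 1)^2 \<le> (1 + e) k^2 + 1 + 1/e with e = 1/5, which is the square (k - 5)^2 \<ge> 0.\<close>

lemma rounding_towards_zero:
  fixes y :: real
  obtains j :: int where "\<bar>real_of_int j\<bar> \<le> \<bar>y\<bar>" "real_of_int j * y \<ge> (real_of_int j)\<^sup>2"
    "y\<^sup>2 \<le> 6/5 * (real_of_int j)\<^sup>2 + 6"
proof -
  define k where "k = \<lfloor>\<bar>y\<bar>\<rfloor>"
  define j where "j = (if y \<ge> 0 then k else - k)"
  have k: "0 \<le> real_of_int k" "real_of_int k \<le> \<bar>y\<bar>" "\<bar>y\<bar> \<le> real_of_int k + 1"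
    unfolding k_def by (auto simp: real_of_int_floor_add_one_ge)
  have 1: "\<bar>real_of_int j\<bar> \<le> \<bar>y\<bar>" using k by (auto simp: j_def)
  have "real_of_int j * y = real_of_int k * \<bar>y\<bar>" by (auto simp: j_def)
  moreover have "real_of_int k * \<bar>y\<bar> \<ge> (real_of_int k)\<^sup>2"
    using k by (simp add: power2_eq_square mult_left_mono)
  moreover have "(real_of_int j)\<^sup>2 = (real_of_int k)\<^sup>2" by (simp add: j_def)
  ultimately have 2: "real_of_int j * y \<ge> (real_of_int j)\<^sup>2" by simp
  have "y\<^sup>2 \<le> (real_of_int k + 1)\<^sup>2" using k by (metis abs_ge_zero power2_abs power_mono)
  also have "\<dots> \<le> 6/5 * (real_of_int k)\<^sup>2 + 6"
    using zero_le_power2[of "real_of_int k - 5"] by (simp add: power2_eq_square algebra_simps)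
  finally have 3: "y\<^sup>2 \<le> 6/5 * (real_of_int j)\<^sup>2 + 6" by (simp add: j_def)
  show ?thesis by (rule that[OF 1 2 3])
qed

text \<open>The factor that each coordinate contributes to the lattice sum in the tail bound,
  uniformly in \<open>N\<close>. Since k^2 \<ge> |k|, each half of the sum is at most the geometric
  series of ratio exp (-1/5) \<le> 5/6, whose value is at most 6.\<close>

lemma theta_sum_le: "(\<Sum>k\<in>{- int N..int N}. exp (- (real_of_int k)\<^sup>2 / 5)) \<le> 12"
proof -
  define q :: real where "q = exp (-1/5)"
  have "exp (1/5::real) \<ge> 1 + 1/5" by (rule exp_ge_add_one_self)
  then have q: "0 < q" "q \<le> 5/6" unfolding q_def
    by (auto simp: exp_minus field_simps)
  have e: "exp (- (real_of_int k)\<^sup>2 / 5) \<le> q ^ nat \<bar>k\<bar>" for k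
  proof -
    have "\<bar>real_of_int k\<bar> \<le> (real_of_int k)\<^sup>2"
    proof -
      have "\<bar>k\<bar> \<le> k\<^sup>2" by (cases "k = 0") (auto simp: power2_eq_square abs_mult_self_eq
        intro: order_trans[OF _ eq_refl[OF abs_mult_self_eq]] mult_left_mono[of 1 "\<bar>k\<bar>" "\<bar>k\<bar>", simplified])
      then show ?thesis by (metis of_int_abs of_int_le_iff of_int_power)
    qed
    then have "exp (- (real_of_int k)\<^sup>2 / 5) \<le> exp (real (nat \<bar>k\<bar>) * (-1/5))"
      by simp
    also have "\<dots> = q ^ nat \<bar>k\<bar>" by (simp only: q_def exp_of_nat_mult)
    finally show ?thesis .
  qed
  have g: "(\<Sum>i\<le>N. q ^ i) \<le> 6"
  proof -
    have "(\<Sum>i\<le>N. q ^ i) \<le> (\<Sum>i. q ^ i)"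
      using q by (intro sum_le_suminf summable_geometric) auto
    also have "\<dots> = 1 / (1 - q)" using q by (intro suminf_geometric) auto
    also have "\<dots> \<le> 6" using q by (simp add: field_simps)
    finally show ?thesis .
  qed
  have img: "{- int N..int N} \<subseteq> int ` {..N} \<union> (\<lambda>i. - int i) ` {..N}"
  proof
    fix k assume "k \<in> {- int N..int N}"
    then have "(k = int (nat k) \<and> nat k \<le> N) \<or> (k = - int (nat (-k)) \<and> nat (-k) \<le> N)" by auto
    then show "k \<in> int ` {..N} \<union> (\<lambda>i. - int i) ` {..N}" by blast
  qed
  have "(\<Sum>k\<in>{- int N..int N}. exp (- (real_of_int k)\<^sup>2 / 5)) \<le> (\<Sum>k\<in>{- int N..int N}. q ^ nat \<bar>k\<bar>)"
    using e by (intro sum_mono)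
  also have "\<dots> \<le> (\<Sum>k\<in>int ` {..N} \<union> (\<lambda>i. - int i) ` {..N}. q ^ nat \<bar>k\<bar>)"
    using img q by (intro sum_mono2) auto
  also have "\<dots> \<le> (\<Sum>k\<in>int ` {..N}. q ^ nat \<bar>k\<bar>) + (\<Sum>k\<in>(\<lambda>i. - int i) ` {..N}. q ^ nat \<bar>k\<bar>)"
    using q by (subst sum_Un) (auto intro!: sum_nonneg)
  also have "\<dots> = (\<Sum>i\<le>N. q ^ i) + (\<Sum>i\<le>N. q ^ i)"
    by (subst (1 2) sum.reindex) (auto simp: inj_on_def)
  finally show ?thesis using g by linarith
qed

text \<open>Rounding the coordinates towards zero replaces the supremum over the unit sphere by a union
  over lattice points, whose weights factorise over the coordinates.\<close>

lemma (in prob_space) subgaussian_sum_squares_tail: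
  fixes Z :: "nat \<Rightarrow> 'a \<Rightarrow> real"
  assumes [measurable]: "\<And>i. i < m \<Longrightarrow> Z i \<in> borel_measurable M"
    and \<beta>: "\<beta> > 0"
    and tail: "\<And>(\<mu> :: nat \<Rightarrow> real) c. c \<ge> 0 \<Longrightarrow>
      prob {\<omega> \<in> space M. \<bar>\<Sum>i<m. \<mu> i * Z i \<omega>\<bar> \<ge> c} \<le> 2 * exp (- (c\<^sup>2 / (\<beta> * (\<Sum>i<m. (\<mu> i)\<^sup>2))))"
  shows "prob {\<omega> \<in> space M. (\<Sum>i<m. (Z i \<omega>)\<^sup>2) \<ge> T} \<le> 2 * (12 * exp 4) ^ m * exp (- (2/3 * T / \<beta>))"
proof -
  define r where "r = sqrt \<beta>"
  have r: "r > 0" "r * r = \<beta>" "r\<^sup>2 = \<beta>" using \<beta> by (auto simp: r_def)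
  \<comment> \<open>The cut-off at \<open>r * real N\<close> leaves finitely many lattice points, so
    a finite union bound applies. The bound does not depend on \<open>N\<close>, and continuity from
    below removes the cut-off at the end.\<close>
  define A where "A N = {\<omega> \<in> space M. (\<Sum>i<m. (Z i \<omega>)\<^sup>2) \<ge> T \<and> (\<forall>i<m. \<bar>Z i \<omega>\<bar> \<le> r * real N)}" for N
  define L where "L N = PiE {..<m} (\<lambda>_. {- int N..int N})" for N
  define q where "q j = (\<Sum>i<m. (real_of_int (j i))\<^sup>2)" for j :: "nat \<Rightarrow> int"
  \<comment> \<open>The least value of \<open>q j\<close> compatible with a sum of squares of at
    least \<open>T\<close>: rounding gives T \<le> \<beta> (6/5 q + 6 m).\<close>
  define R where "R = 5/6 * (T / \<beta> - 6 * real m)"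
  \<comment> \<open>With coefficients sqrt \<beta> times \<open>j\<close> and threshold
    \<open>\<beta> * q j\<close>, the assumed tail becomes 2 exp (- q j).\<close>
  define E where "E j = {\<omega> \<in> space M. \<bar>\<Sum>i<m. (r * real_of_int (j i)) * Z i \<omega>\<bar> \<ge> \<beta> * q j}" for j
  have finL: "finite (L N)" for N by (auto simp: L_def intro: finite_PiE)
  have q0: "q j \<ge> 0" for j by (auto simp: q_def intro: sum_nonneg)
  have E_sets [measurable]: "E j \<in> events" for j unfolding E_def by measurable
  have A_sets [measurable]: "A N \<in> events" for N
  proof -
    have "{\<omega> \<in> space M. \<forall>i\<in>{..<m}. \<bar>Z i \<omega>\<bar> \<le> r * real N} \<in> events"
      by (intro sets.sets_Collect_finite_All) (auto simp: )
    moreover have "{\<omega> \<in> space M. (\<Sum>i<m. (Z i \<omega>)\<^sup>2) \<ge> T} \<in> events" by measurable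
    ultimately have "{\<omega> \<in> space M. \<forall>i\<in>{..<m}. \<bar>Z i \<omega>\<bar> \<le> r * real N} \<inter> {\<omega> \<in> space M. (\<Sum>i<m. (Z i \<omega>)\<^sup>2) \<ge> T} \<in> events"
      by (rule sets.Int)
    then show ?thesis by (rule back_subst[of "\<lambda>S. S \<in> events"]) (auto simp: A_def)
  qed
  have PE: "prob (E j) \<le> 2 * exp (- q j)" for j
  proof -
    have "prob (E j) \<le> 2 * exp (- ((\<beta> * q j)\<^sup>2 / (\<beta> * (\<Sum>i<m. (r * real_of_int (j i))\<^sup>2))))"
      unfolding E_def using \<beta> q0 by (intro tail) simp
    also have "(\<Sum>i<m. (r * real_of_int (j i))\<^sup>2) = \<beta> * q j"
      by (simp add: power_mult_distrib r q_def sum_distrib_left)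
    also have "(\<beta> * q j)\<^sup>2 / (\<beta> * (\<beta> * q j)) = q j"
      using \<beta> by (auto simp: power2_eq_square)
    finally show ?thesis .
  qed
  have sub: "A N \<subseteq> (\<Union>j\<in>{j\<in>L N. q j \<ge> R}. E j)" for N
  proof
    fix \<omega> assume w: "\<omega> \<in> A N"
    have "\<forall>i. \<exists>j :: int. \<bar>real_of_int j\<bar> \<le> \<bar>Z i \<omega> / r\<bar> \<and> real_of_int j * (Z i \<omega> / r) \<ge> (real_of_int j)\<^sup>2
      \<and> (Z i \<omega> / r)\<^sup>2 \<le> 6/5 * (real_of_int j)\<^sup>2 + 6"
      using rounding_towards_zero by metis
    then obtain j :: "nat \<Rightarrow> int" where j: "\<And>i. \<bar>real_of_int (j i)\<bar> \<le> \<bar>Z i \<omega> / r\<bar>"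
      "\<And>i. real_of_int (j i) * (Z i \<omega> / r) \<ge> (real_of_int (j i))\<^sup>2"
      "\<And>i. (Z i \<omega> / r)\<^sup>2 \<le> 6/5 * (real_of_int (j i))\<^sup>2 + 6" by metis
    define j' where "j' = restrict j {..<m}"
    have j'L: "j' \<in> L N"
    proof -
      have "j i \<in> {- int N..int N}" if "i < m" for i
      proof -
        have "\<bar>Z i \<omega>\<bar> \<le> r * real N" using w that by (auto simp: A_def)
        then have "\<bar>Z i \<omega> / r\<bar> \<le> real N" using r by (simp add: field_simps)
        then have "\<bar>real_of_int (j i)\<bar> \<le> real N" using j(1)[of i] by linarith
        then show ?thesis by auto
      qed
      then show ?thesis by (auto simp: L_def j'_def)
    qed
    have qj: "q j' = q j" by (simp add: q_def j'_def)
    have "T \<le> (\<Sum>i<m. (Z i \<omega>)\<^sup>2)" using w by (simp add: A_def)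
    also have "\<dots> \<le> (\<Sum>i<m. \<beta> * (6/5 * (real_of_int (j i))\<^sup>2 + 6))"
    proof (intro sum_mono)
      fix i
      have "(Z i \<omega>)\<^sup>2 = \<beta> * (Z i \<omega> / r)\<^sup>2" using r \<beta> by (simp add: power_divide)
      then show "(Z i \<omega>)\<^sup>2 \<le> \<beta> * (6/5 * (real_of_int (j i))\<^sup>2 + 6)" using j(3)[of i] \<beta> by simp
    qed
    also have "\<dots> = \<beta> * (6/5 * q j + 6 * real m)"
      by (simp add: q_def sum_distrib_left sum.distrib algebra_simps)
    finally have "R \<le> q j'" using \<beta> unfolding R_def qj by (simp add: field_simps)
    moreover have "\<omega> \<in> E j'"
    proof -
      have "\<beta> * q j \<le> (\<Sum>i<m. (r * real_of_int (j i)) * Z i \<omega>)"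
        unfolding q_def sum_distrib_left
      proof (intro sum_mono)
        fix i
        have "\<beta> * (real_of_int (j i))\<^sup>2 \<le> \<beta> * (real_of_int (j i) * (Z i \<omega> / r))"
          using j(2)[of i] \<beta> by (intro mult_left_mono) auto
        also have "\<dots> = r * real_of_int (j i) * Z i \<omega>"
          using r by (simp add: r(2)[symmetric])
        finally show "\<beta> * (real_of_int (j i))\<^sup>2 \<le> r * real_of_int (j i) * Z i \<omega>" .
      qed
      also have "\<dots> = (\<Sum>i<m. (r * real_of_int (j' i)) * Z i \<omega>)" by (simp add: j'_def)
      finally show ?thesis using w by (simp add: E_def A_def qj)
    qed
    ultimately show "\<omega> \<in> (\<Union>j\<in>{j\<in>L N. q j \<ge> R}. E j)" using j'L by auto
  qed
  define bd where "bd = 2 * (12 * exp 4) ^ m * exp (- (2/3 * T / \<beta>))"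
  have PA: "prob (A N) \<le> bd" for N
  proof -
    have "prob (A N) \<le> prob (\<Union>j\<in>{j\<in>L N. q j \<ge> R}. E j)"
      using sub finL by (intro finite_measure_mono) auto
    also have "\<dots> \<le> (\<Sum>j\<in>{j\<in>L N. q j \<ge> R}. prob (E j))"
      using finL by (intro finite_measure_subadditive_finite) auto
    \<comment> \<open>Four fifths of the exponent pay for the threshold and one fifth keeps the
      lattice sum bounded. The rate 2/3 is 4/5 times the 5/6 in \<open>R\<close>; the term 6 m in
      \<open>R\<close> turns into exp 4 per coordinate.\<close>
    also have "\<dots> \<le> (\<Sum>j\<in>{j\<in>L N. q j \<ge> R}. 2 * exp (- (4/5 * R)) * exp (- q j / 5))"
    proof (intro sum_mono)
      fix j assume "j \<in> {j\<in>L N. q j \<ge> R}"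
      then have "exp (- q j) \<le> exp (- (4/5 * R) + - q j / 5)" by simp
      then show "prob (E j) \<le> 2 * exp (- (4/5 * R)) * exp (- q j / 5)"
        using PE[of j] unfolding exp_add by linarith
    qed
    also have "\<dots> \<le> (\<Sum>j\<in>L N. 2 * exp (- (4/5 * R)) * exp (- q j / 5))"
      using finL by (intro sum_mono2) auto
    also have "\<dots> = 2 * exp (- (4/5 * R)) * (\<Sum>j\<in>L N. \<Prod>i<m. exp (- (real_of_int (j i))\<^sup>2 / 5))"
      by (simp add: sum_distrib_left q_def exp_sum[symmetric] sum_divide_distrib sum_negf)
    also have "(\<Sum>j\<in>L N. \<Prod>i<m. exp (- (real_of_int (j i))\<^sup>2 / 5))
        = (\<Prod>i<m. \<Sum>k\<in>{- int N..int N}. exp (- (real_of_int k)\<^sup>2 / 5))"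
      unfolding L_def by (subst prod_sum_PiE) auto
    also have "\<dots> \<le> (\<Prod>i<m. 12)" using theta_sum_le by (intro prod_mono) (auto intro: sum_nonneg)
    also have "2 * exp (- (4/5 * R)) * (\<Prod>i<m. 12) = bd"
    proof -
      have "- (4/5 * R) = real m * 4 + - (2/3 * T / \<beta>)"
        using \<beta> by (simp add: R_def field_simps)
      then have "exp (- (4/5 * R)) = exp 4 ^ m * exp (- (2/3 * T / \<beta>))"
        by (simp only: exp_add exp_of_nat_mult)
      then show ?thesis by (simp add: bd_def power_mult_distrib)
    qed
    finally show ?thesis by simp
  qed
  have inc: "incseq A"
    using r by (force simp: A_def incseq_def intro: order_trans mult_left_mono)
  have un: "(\<Union>N. A N) = {\<omega> \<in> space M. (\<Sum>i<m. (Z i \<omega>)\<^sup>2) \<ge> T}"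
  proof -
    have "\<exists>N. \<forall>i<m. \<bar>Z i \<omega>\<bar> \<le> r * real N" for \<omega>
    proof -
      obtain N where N: "(\<Sum>i<m. \<bar>Z i \<omega>\<bar>) / r \<le> real N" using real_arch_simple by blast
      have "\<bar>Z i \<omega>\<bar> \<le> r * real N" if "i < m" for i
      proof -
        have "\<bar>Z i \<omega>\<bar> \<le> (\<Sum>i<m. \<bar>Z i \<omega>\<bar>)" using that by (intro member_le_sum) auto
        then show ?thesis using N r by (simp add: field_simps)
      qed
      then show ?thesis by blast
    qed
    then show ?thesis by (auto simp: A_def)
  qed
  have "(\<lambda>N. prob (A N)) \<longlonglongrightarrow> prob (\<Union>N. A N)"
    by (rule finite_Lim_measure_incseq) (use inc in auto)
  then have "prob (\<Union>N. A N) \<le> bd" by (rule LIMSEQ_le_const2) (use PA in blast)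
  then show ?thesis by (simp add: un bd_def)
qed

section \<open>Piecewise polynomial vectors with a given set of breakpoints\<close>

definition jump_space :: "nat \<Rightarrow> nat \<Rightarrow> nat set \<Rightarrow> (nat \<Rightarrow> real) set" where
  "jump_space p n B = {h. \<exists>q. (\<forall>s\<in>{1..n}. degree (q s) \<le> p \<and> h s = discretise n (poly (q s)) s)
     \<and> (\<forall>s\<in>{2..n}. s \<notin> B \<longrightarrow> q s = q (s - 1))}"

lemma integrable_continuous_on_cell:
  assumes "continuous_on UNIV f"
  shows "integrable (lebesgue_on (cell n i)) (f :: real \<Rightarrow> real)"
proof -
  have "integrable (lebesgue_on {(real i - 1) / real n..real i / real n}) f"
    using assms by (intro continuous_imp_integrable_real) (auto intro: continuous_on_subset)
  then show ?thesis
    by (rule integrable_lebesgue_on_subset) (auto simp: cell_def)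
qed

lemma discretise_poly:
  assumes "degree q \<le> p"
  shows "discretise n (poly q) s = (\<Sum>j\<le>p. coeff q j * discretise n (\<lambda>x. x ^ j) s)"
proof (cases "s \<in> {1..n}")
  case True
  have "poly q = (\<lambda>x. \<Sum>j\<le>p. coeff q j * x ^ j)"
  proof
    fix x
    have "poly q x = (\<Sum>j\<le>degree q. coeff q j * x ^ j)" by (rule poly_altdef)
    also have "\<dots> = (\<Sum>j\<le>p. coeff q j * x ^ j)"
      using assms by (intro sum.mono_neutral_left) (auto simp: coeff_eq_0)
    finally show "poly q x = (\<Sum>j\<le>p. coeff q j * x ^ j)" .
  qed
  moreover have "integrable (lebesgue_on (cell n s)) (\<lambda>x. x ^ j)" for j :: nat
    by (intro integrable_continuous_on_cell continuous_intros)
  ultimately show ?thesis using True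
    by (simp add: discretise_def sum_distrib_left algebra_simps)
next
  case False
  then have "discretise n g s = 0" for g unfolding discretise_def by (simp only: if_False)
  then show ?thesis by simp
qed

text \<open>A vector of \<open>jump_space\<close> is determined by one polynomial for each value of
  the number of breakpoints passed so far, and this number has at most \<open>card B + 1\<close>
  values. Recording where the polynomial may change, instead of a partition, makes a common
  refinement a mere union of sets. The spanning vectors can be dependent on short blocks, hence only
  an upper bound for \<open>M\<close>.\<close>

lemma jump_space_basis:
  assumes "finite B"
  obtains M e where "M \<le> (p + 1) * (card B + 1)"
    "\<And>i j. i < M \<Longrightarrow> j < M \<Longrightarrow> (\<Sum>s\<in>{1..n}. e i s * e j s) = (if i = j then 1 else 0 :: real)"
    "\<And>h. h \<in> jump_space p n B \<Longrightarrow> \<exists>c. \<forall>s\<in>{1..n}. h s = (\<Sum>j<M. c j * e j s)"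
proof -
  \<comment> \<open>Breakpoints below 2 are skipped: nothing precedes the first cell, so no change
    is visible there.\<close>
  define rk where "rk s = card {b\<in>B. 2 \<le> b \<and> b \<le> s}" for s
  \<comment> \<open>The index \<open>i = r * (p + 1) + j\<close> encodes the monomial of degree
    \<open>j\<close> restricted to the cells of rank \<open>r\<close>.\<close>
  define v where "v i s = (if rk s = i div (p + 1) then discretise n (\<lambda>x. x ^ (i mod (p + 1))) s else 0)" for i s
  obtain M and e :: "nat \<Rightarrow> nat \<Rightarrow> real" where M: "M \<le> (p + 1) * (card B + 1)"
    and on: "\<And>i j. i < M \<Longrightarrow> j < M \<Longrightarrow> (\<Sum>s\<in>{1..n}. e i s * e j s) = (if i = j then 1 else 0)"
    and sp: "\<And>i. i < (p + 1) * (card B + 1) \<Longrightarrow> \<exists>c. \<forall>s\<in>{1..n}. v i s = (\<Sum>j<M. c j * e j s)"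
    using orthonormal_basis_exists[of "{1..n}" "(p + 1) * (card B + 1)" v] by blast
  obtain C where C: "\<And>i s. i < (p + 1) * (card B + 1) \<Longrightarrow> s \<in> {1..n} \<Longrightarrow> v i s = (\<Sum>j<M. C i j * e j s)"
    using sp by metis
  have "\<exists>c. \<forall>s\<in>{1..n}. h s = (\<Sum>j<M. c j * e j s)" if h: "h \<in> jump_space p n B" for h
  proof -
    obtain q where q': "\<forall>s\<in>{1..n}. degree (q s) \<le> p \<and> h s = discretise n (poly (q s)) s"
      "\<forall>s\<in>{2..n}. s \<notin> B \<longrightarrow> q s = q (s - 1)"
      using h unfolding jump_space_def by blast
    then have q: "\<And>s. s \<in> {1..n} \<Longrightarrow> degree (q s) \<le> p"
      "\<And>s. s \<in> {1..n} \<Longrightarrow> h s = discretise n (poly (q s)) s"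
      "\<And>s. s \<in> {2..n} \<Longrightarrow> s \<notin> B \<Longrightarrow> q s = q (s - 1)"
      by blast+
    have const: "q t = q s" if "1 \<le> s" and st: "s \<le> t" "t \<le> n" "rk s = rk t" for s t
      using st
    proof (induction t rule: dec_induct)
      case (step t)
      have sub: "{b\<in>B. 2 \<le> b \<and> b \<le> s} \<subseteq> {b\<in>B. 2 \<le> b \<and> b \<le> t}"
        "{b\<in>B. 2 \<le> b \<and> b \<le> t} \<subseteq> {b\<in>B. 2 \<le> b \<and> b \<le> Suc t}" using step by auto
      then have "rk s \<le> rk t" "rk t \<le> rk (Suc t)" unfolding rk_def
        using assms by (auto intro: card_mono)
      then have eq: "rk s = rk t" "rk t = rk (Suc t)" using step by auto
      have "{b\<in>B. 2 \<le> b \<and> b \<le> t} = {b\<in>B. 2 \<le> b \<and> b \<le> Suc t}"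
        using sub(2) eq(2) assms unfolding rk_def by (intro card_subset_eq) auto
      moreover have "2 \<le> Suc t" using step \<open>1 \<le> s\<close> by simp
      ultimately have "Suc t \<notin> B" by (auto dest!: equalityD2)
      then have "q (Suc t) = q t" using q(3)[of "Suc t"] step \<open>1 \<le> s\<close> by simp
      then show ?case using step eq by simp
    qed simp
    \<comment> \<open>A rank attained by no cell gets an arbitrary polynomial. This is harmless,
      because the vectors \<open>v\<close> for that rank vanish on {1..n}.\<close>
    define Q where "Q r = q (SOME s. s \<in> {1..n} \<and> rk s = r)" for r
    have Q: "q s = Q (rk s)" if "s \<in> {1..n}" for s
    proof -
      define t where "t = (SOME t. t \<in> {1..n} \<and> rk t = rk s)"
      have "t \<in> {1..n} \<and> rk t = rk s" unfolding t_def by (rule someI[of _ s]) (use that in simp)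
      then have "q s = q t" using const[of s t] const[of t s] that by (cases "s \<le> t") auto
      then show ?thesis by (simp add: Q_def t_def)
    qed
    have rk_le: "rk s \<le> card B" for s unfolding rk_def using assms by (intro card_mono) auto
    define c where "c l = (\<Sum>r\<le>card B. \<Sum>j\<le>p. coeff (Q r) j * C (r * (p + 1) + j) l)" for l
    have "h s = (\<Sum>l<M. c l * e l s)" if s: "s \<in> {1..n}" for s
    proof -
      have "h s = (\<Sum>j\<le>p. coeff (Q (rk s)) j * discretise n (\<lambda>x. x ^ j) s)"
        using q(1,2)[OF s] Q[OF s] discretise_poly[of "q s" p n s] by simp
      also have "\<dots> = (\<Sum>r\<le>card B. if r = rk s then (\<Sum>j\<le>p. coeff (Q r) j * discretise n (\<lambda>x. x ^ j) s) else 0)"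
        using rk_le[of s] by simp
      also have "\<dots> = (\<Sum>r\<le>card B. \<Sum>j\<le>p. coeff (Q r) j * v (r * (p + 1) + j) s)"
      proof (intro sum.cong refl)
        fix r
        have vr: "v (r * (p + 1) + j) s = (if r = rk s then discretise n (\<lambda>x. x ^ j) s else 0)" if "j \<le> p" for j
        proof -
          have dm: "(r * (p + 1) + j) div (p + 1) = r" "(r * (p + 1) + j) mod (p + 1) = j"
            using that by (simp_all add: div_nat_eqI del: mult_Suc_right add_Suc_right)
          show ?thesis unfolding v_def dm by auto
        qed
        have "(\<Sum>j\<le>p. coeff (Q r) j * v (r * (p + 1) + j) s)
            = (\<Sum>j\<le>p. coeff (Q r) j * (if r = rk s then discretise n (\<lambda>x. x ^ j) s else 0))"
          using vr by (intro sum.cong) auto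
        then show "(if r = rk s then \<Sum>j\<le>p. coeff (Q r) j * discretise n (\<lambda>x. x ^ j) s else 0)
            = (\<Sum>j\<le>p. coeff (Q r) j * v (r * (p + 1) + j) s)" by simp
      qed
      also have "\<dots> = (\<Sum>r\<le>card B. \<Sum>j\<le>p. coeff (Q r) j * (\<Sum>l<M. C (r * (p + 1) + j) l * e l s))"
      proof (intro sum.cong refl arg_cong2[of _ _ _ _ "(*)"])
        fix r j assume "r \<in> {..card B}" "j \<in> {..p}"
        then have "r * (p + 1) + j < card B * (p + 1) + (p + 1)"
          by (intro add_le_less_mono mult_right_mono) auto
        then show "v (r * (p + 1) + j) s = (\<Sum>l<M. C (r * (p + 1) + j) l * e l s)"
          using C[OF _ s] by (simp add: algebra_simps)
      qed
      also have "\<dots> = (\<Sum>r\<le>card B. \<Sum>l<M. \<Sum>j\<le>p. coeff (Q r) j * (C (r * (p + 1) + j) l * e l s))"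
          by (simp only: sum_distrib_left) (intro sum.cong refl sum.swap)
      also have "\<dots> = (\<Sum>l<M. c l * e l s)"
        by (subst sum.swap) (simp only: c_def sum_distrib_right mult.assoc)
      finally show ?thesis .
    qed
    then show ?thesis by blast
  qed
  then show ?thesis using that M on by blast
qed

text \<open>By Cauchy-Schwarz in an orthonormal basis, one event about the squared noise coordinates
  \<open>Z i\<close> controls all \<open>h\<close> of the space at once. Orthonormality
  (\<open>isometry\<close>) transfers the tail hypothesis from the \<xi> to the \<open>Z\<close>
  with the same \<beta>. The threshold \<open>T\<close> is chosen so that 2/3 T / \<beta> = 4/3 k ln
  n with k = card B + 1.\<close>

lemma (in prob_space) jump_space_noise_event:
  fixes \<xi> :: "nat \<Rightarrow> 'a \<Rightarrow> real"
  assumes meas: "\<And>s. s \<in> {1..n} \<Longrightarrow> \<xi> s \<in> borel_measurable M"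
    and \<beta>: "\<beta> > 0" and n: "n \<ge> 1"
    and tail: "\<And>(\<mu> :: nat \<Rightarrow> real) c. c \<ge> 0 \<Longrightarrow>
      prob {\<omega> \<in> space M. \<bar>\<Sum>s\<in>{1..n}. \<mu> s * \<xi> s \<omega>\<bar> \<ge> c}
        \<le> 2 * exp (- (c\<^sup>2 / (\<beta> * (\<Sum>s\<in>{1..n}. (\<mu> s)\<^sup>2))))"
    and B: "finite B"
  obtains E where "E \<in> events"
    "prob E \<le> 2 * ((12 * exp 4) ^ (p + 1) * real n powr (- (4/3))) ^ (card B + 1)"
    "\<And>\<omega> h. \<omega> \<in> space M - E \<Longrightarrow> h \<in> jump_space p n B \<Longrightarrow>
      (\<Sum>s\<in>{1..n}. h s * \<xi> s \<omega>)\<^sup>2 \<le> 2 * \<beta> * real (card B + 1) * ln (real n) * (\<Sum>s\<in>{1..n}. (h s)\<^sup>2)"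
proof -
  obtain m and e :: "nat \<Rightarrow> nat \<Rightarrow> real" where m: "m \<le> (p + 1) * (card B + 1)"
    and on: "\<And>i j. i < m \<Longrightarrow> j < m \<Longrightarrow> (\<Sum>s\<in>{1..n}. e i s * e j s) = (if i = j then 1 else 0)"
    and sp: "\<And>h. h \<in> jump_space p n B \<Longrightarrow> \<exists>c. \<forall>s\<in>{1..n}. h s = (\<Sum>j<m. c j * e j s)"
    using jump_space_basis[OF B] by blast
  have isometry: "(\<Sum>s\<in>{1..n}. (\<Sum>j<m. c j * e j s)\<^sup>2) = (\<Sum>j<m. (c j)\<^sup>2)" for c
  proof -
    have "(\<Sum>s\<in>{1..n}. (\<Sum>j<m. c j * e j s)\<^sup>2)
        = (\<Sum>s\<in>{1..n}. \<Sum>i<m. \<Sum>j<m. c i * c j * (e i s * e j s))"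
      by (intro sum.cong refl) (simp add: power2_eq_square sum_product algebra_simps)
    also have "\<dots> = (\<Sum>i<m. \<Sum>s\<in>{1..n}. \<Sum>j<m. c i * c j * (e i s * e j s))"
      by (rule sum.swap)
    also have "\<dots> = (\<Sum>i<m. \<Sum>j<m. \<Sum>s\<in>{1..n}. c i * c j * (e i s * e j s))"
      by (intro sum.cong refl sum.swap)
    also have "\<dots> = (\<Sum>i<m. \<Sum>j<m. c i * c j * (\<Sum>s\<in>{1..n}. e i s * e j s))"
      by (simp only: sum_distrib_left)
    also have "\<dots> = (\<Sum>i<m. \<Sum>j<m. if j = i then c i * c j else 0)"
      using on by (intro sum.cong refl) auto
    also have "\<dots> = (\<Sum>j<m. (c j)\<^sup>2)" by (simp add: power2_eq_square)
    finally show ?thesis .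
  qed
  define Z where "Z i \<omega> = (\<Sum>s\<in>{1..n}. e i s * \<xi> s \<omega>)" for i \<omega>
  have lin: "(\<Sum>s\<in>{1..n}. (\<Sum>j<m. c j * e j s) * \<xi> s \<omega>) = (\<Sum>j<m. c j * Z j \<omega>)" for c \<omega>
  proof -
    have "(\<Sum>s\<in>{1..n}. (\<Sum>j<m. c j * e j s) * \<xi> s \<omega>) = (\<Sum>s\<in>{1..n}. \<Sum>j<m. c j * (e j s * \<xi> s \<omega>))"
      by (simp only: sum_distrib_right mult.assoc)
    also have "\<dots> = (\<Sum>j<m. \<Sum>s\<in>{1..n}. c j * (e j s * \<xi> s \<omega>))" by (rule sum.swap)
    finally show ?thesis by (simp only: Z_def sum_distrib_left)
  qed
  define k where "k = card B + 1"
  define T where "T = 2 * \<beta> * real k * ln (real n)"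
  define E where "E = {\<omega> \<in> space M. (\<Sum>i<m. (Z i \<omega>)\<^sup>2) \<ge> T}"
  have Zm: "Z i \<in> borel_measurable M" for i unfolding Z_def using meas by auto
  have 1: "E \<in> events" using Zm unfolding E_def by measurable
  have "prob E \<le> 2 * (12 * exp 4) ^ m * exp (- (2/3 * T / \<beta>))"
    unfolding E_def
  proof (rule subgaussian_sum_squares_tail)
    fix \<mu> :: "nat \<Rightarrow> real" and c :: real assume "c \<ge> 0"
    then show "prob {\<omega> \<in> space M. \<bar>\<Sum>i<m. \<mu> i * Z i \<omega>\<bar> \<ge> c} \<le> 2 * exp (- (c\<^sup>2 / (\<beta> * (\<Sum>i<m. (\<mu> i)\<^sup>2))))"
      using tail[of c "\<lambda>s. \<Sum>j<m. \<mu> j * e j s"] by (simp only: lin isometry)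
  qed (use Zm \<beta> in auto)
  also have "exp (- (2/3 * T / \<beta>)) = (real n powr (- (4/3))) ^ k"
  proof -
    have "- (2/3 * T / \<beta>) = real k * (- (4/3) * ln (real n))" using \<beta> by (simp add: T_def)
    then show ?thesis using n by (simp only: exp_of_nat_mult powr_def) auto
  qed
  also have "2 * (12 * exp 4) ^ m * (real n powr (- (4/3))) ^ k
      \<le> 2 * (12 * exp 4) ^ ((p + 1) * k) * (real n powr (- (4/3))) ^ k"
    using m by (intro mult_right_mono mult_left_mono power_increasing) (auto simp: k_def intro: order_trans[OF _ mult_mono[of 1 12 1 "exp 4"]])
  also have "\<dots> = 2 * ((12 * exp 4) ^ (p + 1) * real n powr (- (4/3))) ^ k"
    by (simp only: power_mult power_mult_distrib mult.assoc)
  finally have 2: "prob E \<le> 2 * ((12 * exp 4) ^ (p + 1) * real n powr (- (4/3))) ^ k" .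
  have 3: "(\<Sum>s\<in>{1..n}. h s * \<xi> s \<omega>)\<^sup>2 \<le> T * (\<Sum>s\<in>{1..n}. (h s)\<^sup>2)"
    if w: "\<omega> \<in> space M - E" and h: "h \<in> jump_space p n B" for \<omega> h
  proof -
    obtain c where c: "\<And>s. s \<in> {1..n} \<Longrightarrow> h s = (\<Sum>j<m. c j * e j s)" using sp[OF h] by blast
    have "(\<Sum>s\<in>{1..n}. h s * \<xi> s \<omega>) = (\<Sum>s\<in>{1..n}. (\<Sum>j<m. c j * e j s) * \<xi> s \<omega>)"
      by (intro sum.cong refl) (simp only: c)
    then have a: "(\<Sum>s\<in>{1..n}. h s * \<xi> s \<omega>) = (\<Sum>j<m. c j * Z j \<omega>)" by (simp only: lin)
    have "(\<Sum>s\<in>{1..n}. (h s)\<^sup>2) = (\<Sum>s\<in>{1..n}. (\<Sum>j<m. c j * e j s)\<^sup>2)"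
      by (intro sum.cong refl) (simp only: c)
    then have b: "(\<Sum>s\<in>{1..n}. (h s)\<^sup>2) = (\<Sum>j<m. (c j)\<^sup>2)" by (simp only: isometry)
    have "(\<Sum>j<m. c j * Z j \<omega>)\<^sup>2 \<le> (\<Sum>j<m. (c j)\<^sup>2) * (\<Sum>j<m. (Z j \<omega>)\<^sup>2)"
      by (rule Cauchy_Schwarz_ineq_sum)
    also have "\<dots> \<le> (\<Sum>j<m. (c j)\<^sup>2) * T"
      using w by (intro mult_left_mono) (auto simp: E_def intro: sum_nonneg)
    finally show ?thesis unfolding a b by (simp add: mult.commute)
  qed
  show ?thesis by (rule that[OF 1 2[unfolded k_def] 3[unfolded T_def k_def]])
qed

section \<open>Simultaneous noise bound over all breakpoint sets\<close>

lemma sum_power_card_Pow: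
  "finite S \<Longrightarrow> (\<Sum>B\<in>Pow S. w ^ card B) = (1 + w :: real) ^ card S"
  using prod_add[of S "\<lambda>_. w" "\<lambda>_. 1"] by (simp add: add.commute)

text \<open>Summing w^(|B| + 1) over all 2^n sets gives w (1 + w)^n \<le> w exp (n w). With w = C n
  powr (-4/3) the exponential is at most exp C, and the remaining factor w is summable in n. Both
  facts use only that the exponent exceeds 1 in absolute value.\<close>

lemma (in prob_space) AE_jump_space_noise:
  fixes \<xi> :: "nat \<Rightarrow> nat \<Rightarrow> 'a \<Rightarrow> real"
  assumes meas: "\<And>n s. n \<ge> 1 \<Longrightarrow> s \<in> {1..n} \<Longrightarrow> \<xi> n s \<in> borel_measurable M"
    and \<beta>: "\<beta> > 0"
    and tail: "\<And>n (\<mu> :: nat \<Rightarrow> real) c. n \<ge> 1 \<Longrightarrow> c \<ge> 0 \<Longrightarrow>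
      prob {\<omega> \<in> space M. \<bar>\<Sum>s\<in>{1..n}. \<mu> s * \<xi> n s \<omega>\<bar> \<ge> c}
        \<le> 2 * exp (- (c\<^sup>2 / (\<beta> * (\<Sum>s\<in>{1..n}. (\<mu> s)\<^sup>2))))"
  shows "AE \<omega> in M. \<forall>\<^sub>F n in sequentially. \<forall>B h. B \<subseteq> {1..n} \<longrightarrow> h \<in> jump_space p n B \<longrightarrow>
      (\<Sum>s\<in>{1..n}. h s * \<xi> n s \<omega>)\<^sup>2 \<le> 2 * \<beta> * real (card B + 1) * ln (real n) * (\<Sum>s\<in>{1..n}. (h s)\<^sup>2)"
proof -
  define C :: real where "C = (12 * exp 4) ^ (p + 1)"
  define w where "w n = C * real n powr (- (4/3))" for n
  have C: "C > 0" by (simp add: C_def)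
  have w0: "w n \<ge> 0" for n using C by (simp add: w_def)
  define good where "good n B \<omega> \<longleftrightarrow> (\<forall>h\<in>jump_space p n B.
      (\<Sum>s\<in>{1..n}. h s * \<xi> n s \<omega>)\<^sup>2 \<le> 2 * \<beta> * real (card B + 1) * ln (real n) * (\<Sum>s\<in>{1..n}. (h s)\<^sup>2))" for n B \<omega>
  have "\<exists>E. E \<in> events \<and> (n \<ge> 1 \<longrightarrow> finite B \<longrightarrow> prob E \<le> 2 * w n ^ (card B + 1) \<and> (\<forall>\<omega>\<in>space M - E. good n B \<omega>))" for n B
  proof (cases "n \<ge> 1 \<and> finite B")
    case True
    then obtain E where "E \<in> events"
      "prob E \<le> 2 * ((12 * exp 4) ^ (p + 1) * real n powr (- (4/3))) ^ (card B + 1)"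
      "\<And>\<omega> h. \<omega> \<in> space M - E \<Longrightarrow> h \<in> jump_space p n B \<Longrightarrow>
        (\<Sum>s\<in>{1..n}. h s * \<xi> n s \<omega>)\<^sup>2 \<le> 2 * \<beta> * real (card B + 1) * ln (real n) * (\<Sum>s\<in>{1..n}. (h s)\<^sup>2)"
      using jump_space_noise_event[of n "\<xi> n" \<beta> B p] meas[of n] tail[of n] \<beta> by blast
    then show ?thesis unfolding w_def C_def good_def by blast
  qed auto
  then obtain E where E: "\<And>n B. E n B \<in> events"
    "\<And>n B. n \<ge> 1 \<Longrightarrow> finite B \<Longrightarrow> prob (E n B) \<le> 2 * w n ^ (card B + 1)"
    "\<And>n B \<omega>. n \<ge> 1 \<Longrightarrow> finite B \<Longrightarrow> \<omega> \<in> space M - E n B \<Longrightarrow> good n B \<omega>"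
    by metis
  define F where "F n = (\<Union>B\<in>Pow {1..n}. E n B)" for n
  have Fm: "F n \<in> events" for n unfolding F_def using E(1) by auto
  have PF: "prob (F n) \<le> 2 * exp C * w n" if "n \<ge> 1" for n
  proof -
    have "prob (F n) \<le> (\<Sum>B\<in>Pow {1..n}. prob (E n B))"
      unfolding F_def using E(1) by (intro finite_measure_subadditive_finite) auto
    also have "\<dots> \<le> (\<Sum>B\<in>Pow {1..n}. 2 * w n * w n ^ card B)"
      using E(2)[OF that] by (intro sum_mono) (auto intro: finite_subset simp: mult.assoc)
    also have "\<dots> = 2 * w n * (1 + w n) ^ n"
      by (simp add: sum_distrib_left[symmetric] sum_power_card_Pow)
    also have "(1 + w n) ^ n \<le> exp (w n) ^ n"
      using w0[of n] by (intro power_mono) (auto simp: exp_ge_add_one_self)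
    also have "exp (w n) ^ n = exp (real n * w n)" by (simp only: exp_of_nat_mult)
    also have "\<dots> \<le> exp C"
    proof -
      have "real n * w n = C * (real n powr 1 * real n powr (- (4/3)))" using that by (simp add: w_def)
      also have "\<dots> = C * real n powr (- (1/3))" by (simp only: powr_add[symmetric]) simp
      also have "real n powr (- (1/3)) \<le> 1"
      proof -
        have "real n powr (- (1/3)) \<le> real n powr 0" using that by (intro powr_mono) auto
        then show ?thesis using that by simp
      qed
      finally show ?thesis using C by simp
    qed
    finally have "prob (F n) \<le> 2 * w n * exp C"
      using w0[of n] by (simp add: mult_left_mono)
    then show ?thesis by (simp add: mult_ac)
  qed
  have "summable (\<lambda>n. prob (F n))"
  proof (rule summable_comparison_test_ev)
    show "\<forall>\<^sub>F n in sequentially. norm (prob (F n)) \<le> 2 * exp C * C * real n powr (- (4/3))"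
    proof (rule eventually_sequentiallyI)
      fix n :: nat assume "1 \<le> n"
      from PF[OF this] show "norm (prob (F n)) \<le> 2 * exp C * C * real n powr (- (4/3))"
        by (simp add: w_def mult.assoc)
    qed
    show "summable (\<lambda>n. 2 * exp C * C * real n powr (- (4/3)))"
      by (intro summable_mult) (simp add: summable_real_powr_iff)
  qed
  then have "AE \<omega> in M. \<forall>\<^sub>F n in sequentially. \<omega> \<in> space M - F n"
    using Fm by (intro borel_cantelli_AE1) (auto simp: emeasure_eq_measure)
  then show ?thesis
  proof eventually_elim
    case (elim \<omega>)
    then show ?case using eventually_ge_at_top[of "1::nat"]
    proof eventually_elim
      case (elim n)
      show ?case
      proof (intro allI impI)
        fix B h assume B: "B \<subseteq> {1..n}" and h: "h \<in> jump_space p n B"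
        have "good n B \<omega>" using elim B by (intro E(3)) (auto simp: F_def intro: finite_subset)
        then show "(\<Sum>s\<in>{1..n}. h s * \<xi> n s \<omega>)\<^sup>2 \<le> 2 * \<beta> * real (card B + 1) * ln (real n) * (\<Sum>s\<in>{1..n}. (h s)\<^sup>2)"
          using h unfolding good_def by blast
      qed
    qed
  qed
qed

subsection \<open>Test functions\<close>

text \<open>Smoothness of finite order, so that closure under sums, products and affine substitution
  follows by induction on the order; a test function satisfies it for every order. Since the
  induction must treat f' as a function of order one less, the recursion \<open>C_upto_Suc\<close>
  peels off the first derivative rather than the last.\<close>

definition C_upto :: "nat \<Rightarrow> (real \<Rightarrow> real) \<Rightarrow> bool" where
  "C_upto n f \<longleftrightarrow> (\<forall>k\<le>n. \<forall>x. ((deriv ^^ k) f) differentiable (at x))"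

lemma C_upto_0: "C_upto 0 f \<longleftrightarrow> (\<forall>x. f differentiable (at x))"
  by (simp add: C_upto_def)

lemma C_upto_Suc: "C_upto (Suc n) f \<longleftrightarrow> (\<forall>x. f differentiable (at x)) \<and> C_upto n (deriv f)"
proof -
  have "(\<forall>k\<le>Suc n. P k) \<longleftrightarrow> P 0 \<and> (\<forall>k\<le>n. P (Suc k))" for P
    by (metis Suc_le_mono le0 not0_implies_Suc)
  then show ?thesis unfolding C_upto_def by (simp add: funpow_Suc_right del: funpow.simps(2))
qed

lemma C_upto_SucD: "C_upto (Suc n) f \<Longrightarrow> C_upto n f"
  by (auto simp: C_upto_def)

lemma C_upto_differentiable: "C_upto n f \<Longrightarrow> f differentiable (at x)"
  by (cases n) (auto simp: C_upto_0 C_upto_Suc)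

lemma C_upto_has_derivative: "C_upto n f \<Longrightarrow> (f has_real_derivative deriv f x) (at x)"
  using C_upto_differentiable real_differentiable_def DERIV_deriv_iff_real_differentiable by blast

lemma C_upto_SucI:
  assumes "\<And>x. (f has_real_derivative f' x) (at x)" "C_upto n f'"
  shows "C_upto (Suc n) f"
proof -
  have "deriv f = f'" using assms(1) DERIV_imp_deriv by blast
  then show ?thesis using assms real_differentiable_def by (auto simp: C_upto_Suc)
qed

lemma C_upto_0I: "(\<And>x. (f has_real_derivative f' x) (at x)) \<Longrightarrow> C_upto 0 f"
  using real_differentiable_def by (auto simp: C_upto_0)

lemma C_upto_const: "C_upto n (\<lambda>x. c)"
proof (induction n arbitrary: c)
  case 0 show ?case by (simp add: C_upto_0)
next
  case (Suc n) show ?case by (rule C_upto_SucI[of _ "\<lambda>_. 0"]) (use Suc in auto)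
qed

lemma C_upto_add:
  "C_upto n f \<Longrightarrow> C_upto n g \<Longrightarrow> C_upto n (\<lambda>x. f x + g x)"
proof (induction n arbitrary: f g)
  case 0
  show ?case by (rule C_upto_0I[of _ "\<lambda>x. deriv f x + deriv g x"])
    (intro DERIV_add C_upto_has_derivative[OF 0(1)] C_upto_has_derivative[OF 0(2)])
next
  case (Suc n)
  show ?case
  proof (rule C_upto_SucI[of _ "\<lambda>x. deriv f x + deriv g x"])
    show "((\<lambda>x. f x + g x) has_real_derivative deriv f x + deriv g x) (at x)" for x
      by (intro DERIV_add C_upto_has_derivative[OF Suc(2)] C_upto_has_derivative[OF Suc(3)])
  qed (use Suc C_upto_Suc in blast)
qed

lemma C_upto_mult:
  "C_upto n f \<Longrightarrow> C_upto n g \<Longrightarrow> C_upto n (\<lambda>x. f x * g x)"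
proof (induction n arbitrary: f g)
  case 0
  show ?case by (rule C_upto_0I[of _ "\<lambda>x. deriv f x * g x + deriv g x * f x"])
    (intro DERIV_mult C_upto_has_derivative[OF 0(1)] C_upto_has_derivative[OF 0(2)])
next
  case (Suc n)
  show ?case
  proof (rule C_upto_SucI[of _ "\<lambda>x. deriv f x * g x + deriv g x * f x"])
    show "((\<lambda>x. f x * g x) has_real_derivative deriv f x * g x + deriv g x * f x) (at x)" for x
      by (intro DERIV_mult C_upto_has_derivative[OF Suc(2)] C_upto_has_derivative[OF Suc(3)])
    show "C_upto n (\<lambda>x. deriv f x * g x + deriv g x * f x)"
      using Suc C_upto_Suc C_upto_SucD by (intro C_upto_add) blast+
  qed
qed

lemma C_upto_affine:
  "C_upto n f \<Longrightarrow> C_upto n (\<lambda>x. f (a * x + b))"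
proof (induction n arbitrary: f)
  case 0
  have "((\<lambda>x. f (a * x + b)) has_real_derivative deriv f (a * x + b) * a) (at x)" for x
    by (rule DERIV_chain2[OF C_upto_has_derivative[OF 0]]) (auto intro!: derivative_eq_intros)
  then show ?case by (rule C_upto_0I)
next
  case (Suc n)
  have "((\<lambda>x. f (a * x + b)) has_real_derivative deriv f (a * x + b) * a) (at x)" for x
    by (rule DERIV_chain2[OF C_upto_has_derivative[OF Suc(2)]]) (auto intro!: derivative_eq_intros)
  then show ?case
    by (rule C_upto_SucI) (use Suc C_upto_Suc in \<open>intro C_upto_mult C_upto_const, blast\<close>)
qed

section \<open>Smooth cut-off functions\<close>

lemma poly_div_exp_tendsto_0: "((\<lambda>x :: real. poly q x / exp x) \<longlongrightarrow> 0) at_top"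
proof -
  have "((\<lambda>x :: real. \<Sum>i\<le>degree q. coeff q i * (x ^ i / exp x)) \<longlongrightarrow> (\<Sum>i\<le>degree q. coeff q i * 0)) at_top"
    by (intro tendsto_sum tendsto_mult tendsto_const tendsto_power_div_exp_0)
  then show ?thesis by (simp add: poly_altdef sum_divide_distrib)
qed

text \<open>The classical function exp (-1/x) with a polynomial factor in 1/x. The factor makes the
  family closed under differentiation: the derivative has the polynomial t^2 (q - q') in t = 1/x,
  where t^2 is the \<open>monom 1 2\<close> below. Smoothness is then an immediate induction over
  all \<open>q\<close>.\<close>

definition flat_exp :: "real poly \<Rightarrow> real \<Rightarrow> real" where
  "flat_exp q x = (if x > 0 then poly q (1 / x) * exp (- (1 / x)) else 0)"

lemma flat_exp_has_derivative:
  "(flat_exp q has_real_derivative flat_exp (monom 1 2 * (q - pderiv q)) x) (at x)"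
proof -
  consider "x > 0" | "x < 0" | "x = 0" by linarith
  then show ?thesis
  proof cases
    case 1
    have "((\<lambda>x. poly q (1 / x) * exp (- (1 / x))) has_real_derivative
        flat_exp (monom 1 2 * (q - pderiv q)) x) (at x)"
      using 1 by (auto intro!: derivative_eq_intros
        simp: flat_exp_def poly_monom power2_eq_square field_simps)
    then show ?thesis
      by (rule has_field_derivative_transform_within_open[of _ _ _ "{0<..}"])
        (use 1 in \<open>auto simp: flat_exp_def\<close>)
  next
    case 2
    have "((\<lambda>x. 0) has_real_derivative flat_exp (monom 1 2 * (q - pderiv q)) x) (at x)"
      using 2 by (simp add: flat_exp_def)
    then show ?thesis
      by (rule has_field_derivative_transform_within_open[of _ _ _ "{..<0}"])
        (use 2 in \<open>auto simp: flat_exp_def\<close>)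
  next
    case 3
    have L: "((\<lambda>y. flat_exp q y / y) \<longlongrightarrow> 0) (at_left 0)"
      by (rule tendsto_eventually) (auto simp: eventually_at_filter flat_exp_def)
    \<comment> \<open>In t = 1/y the right-hand difference quotient at 0 is t q(t) / exp t, and
      \<open>pCons 0 q\<close> is the polynomial t q(t).\<close>
    have "((\<lambda>y. poly (pCons 0 q) (inverse y) / exp (inverse y)) \<longlongrightarrow> 0) (at_right 0)"
      by (rule filterlim_compose[OF poly_div_exp_tendsto_0 filterlim_inverse_at_top_right])
    then have R: "((\<lambda>y. flat_exp q y / y) \<longlongrightarrow> 0) (at_right 0)"
      by (rule Lim_transform_eventually)
        (auto simp: eventually_at_filter flat_exp_def exp_minus field_simps)
    have "((\<lambda>y. flat_exp q y / y) \<longlongrightarrow> 0) (at 0)"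
      by (rule filterlim_split_at[OF L R])
    then show ?thesis
      using 3 by (simp add: has_field_derivative_iff flat_exp_def)
  qed
qed

lemma C_upto_flat_exp: "C_upto n (flat_exp q)"
proof (induction n arbitrary: q)
  case 0 show ?case by (rule C_upto_0I[OF flat_exp_has_derivative])
next
  case (Suc n) then show ?case by (rule C_upto_SucI[OF flat_exp_has_derivative])
qed

text \<open>Rescaling the flat exponential gives smooth functions increasing to the indicator of
  \<open>(s, t)\<close> while keeping their supports compactly inside \<open>(s, t)\<close>.\<close>

definition bump :: "real \<Rightarrow> real \<Rightarrow> nat \<Rightarrow> real \<Rightarrow> real" where
  "bump s t j x = flat_exp 1 (real j * x + (- real j * s - 1)) * flat_exp 1 (- real j * x + (real j * t - 1))"

lemma C_upto_bump: "C_upto n (bump s t j)"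
  unfolding bump_def by (intro C_upto_mult C_upto_affine C_upto_flat_exp)

lemma flat_exp_1: "flat_exp 1 x \<ge> 0" "flat_exp 1 x \<le> 1"
  by (auto simp: flat_exp_def)

lemma bump_bounds: "0 \<le> bump s t j x" "bump s t j x \<le> 1"
  unfolding bump_def by (auto intro: mult_nonneg_nonneg mult_le_one flat_exp_1)

lemma bump_eq_0:
  assumes "x \<notin> {s + 1 / real j..t - 1 / real j}" "j > 0"
  shows "bump s t j x = 0"
  using assms by (auto simp: bump_def flat_exp_def field_simps)

lemma bump_tendsto: "(\<lambda>j. bump s t j x) \<longlonglongrightarrow> indicator {s<..<t} x"
proof (cases "x \<in> {s<..<t}")
  case True
  have *: "(\<lambda>j. flat_exp 1 (real j * d - 1)) \<longlonglongrightarrow> 1" if "d > 0" for d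
  proof -
    have lim: "filterlim (\<lambda>j. real j * d - 1) at_top sequentially"
      using that by real_asymp
    then have "((\<lambda>j. exp (- (inverse (real j * d - 1)))) \<longlonglongrightarrow> exp (- 0))"
      by (intro tendsto_exp tendsto_minus tendsto_inverse_0_at_top)
    moreover have "\<forall>\<^sub>F j in sequentially. exp (- (inverse (real j * d - 1))) = flat_exp 1 (real j * d - 1)"
      using lim[THEN filterlim_at_top_dense[THEN iffD1], rule_format, of 0]
      by (auto elim!: eventually_mono simp: flat_exp_def inverse_eq_divide)
    ultimately have "(\<lambda>j. flat_exp 1 (real j * d - 1)) \<longlonglongrightarrow> exp (- 0)"
      by (rule Lim_transform_eventually)
    then show ?thesis by simp
  qed
  have "(\<lambda>j. flat_exp 1 (real j * (x - s) - 1) * flat_exp 1 (real j * (t - x) - 1)) \<longlonglongrightarrow> 1 * 1"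
    using True by (intro tendsto_mult *) auto
  then show ?thesis using True by (simp add: bump_def algebra_simps)
next
  case False
  have "\<forall>\<^sub>F j in sequentially. bump s t j x = 0"
    using eventually_gt_at_top[of 0]
  proof eventually_elim
    case (elim j)
    define e where "e = 1 / real j"
    have "e > 0" using elim by (simp add: e_def)
    then have "x \<notin> {s + 1 / real j..t - 1 / real j}" using False unfolding e_def[symmetric] by auto
    then show ?case using elim by (rule bump_eq_0)
  qed
  then show ?thesis using False by (simp add: tendsto_eventually)
qed

lemma bump_pos:
  assumes "s < t" obtains j x where "j > 0" "bump s t j x > 0"
proof -
  have "(\<lambda>j. bump s t j ((s + t) / 2)) \<longlonglongrightarrow> 1"
    using bump_tendsto[of s t "(s + t) / 2"] assms by (simp add: field_simps)
  then have "\<forall>\<^sub>F j in sequentially. bump s t j ((s + t) / 2) > 0"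
    by (rule order_tendstoD) simp
  then have "\<forall>\<^sub>F j in sequentially. bump s t j ((s + t) / 2) > 0 \<and> j > 0"
    using eventually_gt_at_top[of 0] by (rule eventually_conj)
  then show ?thesis using that by (auto simp: eventually_sequentially)
qed

lemma test_functionI:
  assumes "\<And>n. C_upto n \<phi>" "compact K" "K \<subseteq> U" "\<And>x. x \<notin> K \<Longrightarrow> \<phi> x = 0"
  shows "test_function U \<phi>"
  using assms unfolding test_function_def C_upto_def by blast

lemma test_function_C_upto: "test_function U \<phi> \<Longrightarrow> C_upto n \<phi>"
  by (auto simp: test_function_def C_upto_def)

lemma test_function_deriv:
  assumes "test_function U \<phi>"
  shows "test_function U (deriv \<phi>)"
proof -
  obtain K where K: "compact K" "K \<subseteq> U" "\<And>x. x \<notin> K \<Longrightarrow> \<phi> x = 0"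
    using assms by (auto simp: test_function_def)
  have "C_upto n (deriv \<phi>)" for n
    using test_function_C_upto[OF assms, of "Suc n"] by (simp add: C_upto_Suc)
  moreover have "deriv \<phi> x = 0" if "x \<notin> K" for x
  proof -
    have "((\<lambda>x. 0) has_real_derivative 0) (at x)" by simp
    then have "(\<phi> has_real_derivative 0) (at x)"
      by (rule has_field_derivative_transform_within_open[of _ _ _ "- K"])
        (use K that compact_imp_closed in \<open>auto simp: open_Compl\<close>)
    then show ?thesis by (rule DERIV_imp_deriv)
  qed
  ultimately show ?thesis using K(1,2) by (intro test_functionI)
qed

lemma test_function_add:
  assumes "test_function U \<phi>" "test_function U \<psi>"
  shows "test_function U (\<lambda>x. \<phi> x + c * \<psi> x)"
proof -
  obtain K L where "compact K" "K \<subseteq> U" "\<And>x. x \<notin> K \<Longrightarrow> \<phi> x = 0"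
    "compact L" "L \<subseteq> U" "\<And>x. x \<notin> L \<Longrightarrow> \<psi> x = 0"
    using assms by (auto simp: test_function_def)
  then show ?thesis
    by (intro test_functionI[of _ "K \<union> L"] C_upto_add C_upto_mult C_upto_const
      test_function_C_upto[OF assms(1)] test_function_C_upto[OF assms(2)]) auto
qed

lemma test_function_bump:
  assumes "a \<le> s" "t \<le> b" "j > 0"
  shows "test_function {a<..<b} (bump s t j)"
proof (rule test_functionI[where K = "{s + 1 / real j..t - 1 / real j}"])
  define e where "e = 1 / real j"
  have "e > 0" using assms by (simp add: e_def)
  then show "{s + 1 / real j..t - 1 / real j} \<subseteq> {a<..<b}"
    using assms(1,2) unfolding e_def[symmetric] by auto
qed (use C_upto_bump bump_eq_0 assms in auto)

lemma continuous_on_C_upto: "C_upto n f \<Longrightarrow> continuous_on S f"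
  using C_upto_differentiable differentiable_imp_continuous_within
  by (metis continuous_at_imp_continuous_on)

lemma integrable_lebesgue_on_interval:
  fixes f :: "real \<Rightarrow> real"
  assumes "continuous_on UNIV f"
  shows "integrable (lebesgue_on {s<..<t}) f"
proof -
  have "integrable (lebesgue_on {s..t}) f"
    using assms by (intro continuous_imp_integrable_real) (auto intro: continuous_on_subset)
  then show ?thesis by (rule integrable_lebesgue_on_subset) auto
qed

lemma integral_lebesgue_on_FTC:
  fixes f F :: "real \<Rightarrow> real"
  assumes "s \<le> t" "\<And>x. (F has_real_derivative f x) (at x)" "continuous_on UNIV f"
  shows "integral\<^sup>L (lebesgue_on {s<..<t}) f = F t - F s"
proof -
  have "integral\<^sup>L (lebesgue_on {s<..<t}) f = integral {s<..<t} f"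
    by (rule lebesgue_integral_eq_integral[OF integrable_lebesgue_on_interval[OF assms(3)]]) auto
  also have "\<dots> = integral {s..t} f" by (rule integral_open_interval_real[symmetric])
  also have "\<dots> = F t - F s"
    using assms by (intro integral_unique fundamental_theorem_of_calculus)
      (auto simp: has_real_derivative_iff_has_vector_derivative intro: has_vector_derivative_at_within)
  finally show ?thesis .
qed

text \<open>The primitive is constant on either side of the support of \<psi>. The normalisation at
  \<open>a\<close> makes it zero on the left, and the vanishing mean carries this over to the
  right.\<close>

lemma test_function_primitive:
  assumes ab: "a < b" and \<psi>: "test_function {a<..<b} \<psi>"
    and mean: "integral\<^sup>L (lebesgue_on {a<..<b}) \<psi> = 0"
  obtains \<phi> where "test_function {a<..<b} \<phi>" "deriv \<phi> = \<psi>"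
proof -
  obtain K where K: "compact K" "K \<subseteq> {a<..<b}" "\<And>x. x \<notin> K \<Longrightarrow> \<psi> x = 0"
    using \<psi> by (auto simp: test_function_def)
  have cont: "continuous_on UNIV \<psi>" by (rule continuous_on_C_upto[OF test_function_C_upto[OF \<psi>, of 0]])
  have "\<exists>F. \<forall>x. -\<infinity> < ereal x \<longrightarrow> ereal x < \<infinity> \<longrightarrow> (F has_vector_derivative \<psi> x) (at x)"
    using cont by (intro einterval_antiderivative) (auto simp: continuous_on_eq_continuous_at)
  then obtain F where F: "\<And>x. (F has_real_derivative \<psi> x) (at x)"
    by (auto simp: has_real_derivative_iff_has_vector_derivative)
  have Fab: "F b = F a" using integral_lebesgue_on_FTC[of a b F \<psi>] ab F cont mean by simp
  \<comment> \<open>The primitive need not vanish in the gaps of \<open>K\<close>, so the compact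
    set is enlarged to an interval. For empty \<open>K\<close> the midpoint serves.\<close>
  obtain c d where cd: "a < c" "c \<le> d" "d < b" "K \<subseteq> {c..d}"
  proof (cases "K = {}")
    case True
    then show ?thesis using that[of "(a+b)/2" "(a+b)/2"] ab by (auto simp: field_simps)
  next
    case False
    then obtain c d where "c \<in> K" "d \<in> K" "\<And>x. x \<in> K \<Longrightarrow> c \<le> x" "\<And>x. x \<in> K \<Longrightarrow> x \<le> d"
      using compact_attains_inf[OF K(1)] compact_attains_sup[OF K(1)] by metis
    then show ?thesis using that[of c d] K(2) by (auto simp: subset_iff)
  qed
  have z: "\<psi> x = 0" if "x < c \<or> d < x" for x
    using that cd K(3) by force
  define \<phi> where "\<phi> x = F x + (- F a)" for x
  have der: "(\<phi> has_real_derivative \<psi> x) (at x)" for x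
    unfolding \<phi>_def using F[of x] by (auto intro!: derivative_eq_intros)
  have const: "F x = F y" if "x \<le> y" "y \<le> c \<or> d \<le> x" for x y
  proof -
    have "F y - F x = integral\<^sup>L (lebesgue_on {x<..<y}) \<psi>"
      using that(1) F cont by (rule integral_lebesgue_on_FTC[symmetric])
    also have "\<dots> = integral\<^sup>L (lebesgue_on {x<..<y}) (\<lambda>_. 0)"
      by (rule Bochner_Integration.integral_cong) (use that(2) z in auto)
    finally show ?thesis by simp
  qed
  have out: "\<phi> x = 0" if "x \<notin> {c..d}" for x
  proof (cases "x < c")
    case True
    then show ?thesis using const[of x c] const[of a c] cd by (simp add: \<phi>_def)
  next
    case False
    then have "d < x" using that by auto
    then show ?thesis using const[of d x] const[of d b] cd Fab by (simp add: \<phi>_def)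
  qed
  have sm: "C_upto n \<phi>" for n
    by (rule C_upto_SucD[OF C_upto_SucI[OF der test_function_C_upto[OF \<psi>]]])
  show ?thesis
  proof (rule that)
    show "test_function {a<..<b} \<phi>"
      by (rule test_functionI[OF sm, of "{c..d}"]) (use cd out in auto)
    show "deriv \<phi> = \<psi>" using der DERIV_imp_deriv by blast
  qed
qed

subsection \<open>Weak derivatives in one dimension\<close>

text \<open>After passing to a Borel representative, the positive and the negative part are
  densities of two finite measures that agree on all half-lines, hence coincide. A function whose
  two parts agree almost everywhere is zero there, since at every point one of them
  vanishes.\<close>

lemma AE_zero_if_interval_integrals_zero:
  fixes W :: "real \<Rightarrow> real"
  assumes W: "integrable (lebesgue_on {a<..<b}) W"
    and zero: "\<And>s t. a \<le> s \<Longrightarrow> s < t \<Longrightarrow> t \<le> b \<Longrightarrow> integral\<^sup>L (lebesgue_on {s<..<t}) W = 0"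
  shows "AE x in lebesgue_on {a<..<b}. W x = 0"
proof -
  define G where "G x = (if x \<in> {a<..<b} then W x else 0)" for x
  have G: "integrable lebesgue G"
    unfolding G_def using W Lebesgue_Measure.integrable_restrict_UNIV[of "{a<..<b}" W] by simp
  then obtain G' where G' [measurable]: "G' \<in> borel_measurable lborel" and eq: "AE x in lborel. G x = G' x"
    using completion_ex_borel_measurable_real[of G lborel] by auto
  have eq': "AE x in lebesgue. G x = G' x" using eq by (rule AE_completion)
  have G'm: "G' \<in> borel_measurable lebesgue" using G' by (rule measurable_completion)
  have "integrable lebesgue G'"
    using G eq' G'm by (subst integrable_cong_AE[symmetric]) auto
  then have G'i: "integrable lborel G'" using G' by (simp add: integrable_completion)
  have int0: "(LINT y|lborel. G' y * indicator {x<..} y) = 0" for x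
  proof -
    have "(LINT y|lborel. G' y * indicator {x<..} y) = (LINT y|lebesgue. G' y * indicator {x<..} y)"
      by (intro integral_completion[symmetric]) measurable
    also have "\<dots> = (LINT y|lebesgue. G y * indicator {x<..} y)"
    proof (rule integral_cong_AE)
      have [measurable]: "(indicator {x<..} :: real \<Rightarrow> real) \<in> borel_measurable lebesgue"
        by (rule measurable_completion) simp
      show "(\<lambda>y. G' y * indicator {x<..} y) \<in> borel_measurable lebesgue"
        "(\<lambda>y. G y * indicator {x<..} y) \<in> borel_measurable lebesgue"
        using G G'm by measurable
    qed (use eq' in auto)
    also have "\<dots> = (LINT y|lebesgue. (if y \<in> {max a x<..<b} then W y else 0))"
      by (intro Bochner_Integration.integral_cong) (auto simp: G_def)
    also have "\<dots> = integral\<^sup>L (lebesgue_on {max a x<..<b}) W"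
      by (rule Lebesgue_Measure.integral_restrict_UNIV) auto
    also have "\<dots> = 0"
    proof (cases "max a x < b")
      case True
      then show ?thesis using zero[of "max a x" b] by simp
    next
      case False
      then have "{max a x<..<b} = {}" by (simp only: greaterThanLessThan_empty_iff not_less)
      then show ?thesis by (simp add: integral_restrict_space)
    qed
    finally show ?thesis .
  qed
  \<comment> \<open>\<open>ennreal\<close> truncates negative numbers to 0, so these densities are
    the positive and the negative part of \<open>G'\<close>.\<close>
  define M1 where "M1 = density lborel (\<lambda>x. ennreal (G' x))"
  define M2 where "M2 = density lborel (\<lambda>x. ennreal (- G' x))"
  have "M1 = M2"
  proof (rule measure_eqI_lessThan)
    show "sets M1 = sets borel" "sets M2 = sets borel" by (auto simp: M1_def M2_def)
    fix x
    define H where "H y = G' y * indicator {x<..} y" for y :: real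
    have Hi: "integrable lborel H" unfolding H_def
      using G'i by (intro integrable_real_mult_indicator) auto
    have e1: "emeasure M1 {x<..} = (\<integral>\<^sup>+ y. ennreal (H y) \<partial>lborel)"
      unfolding M1_def H_def by (subst emeasure_density) (auto intro!: nn_integral_cong simp: indicator_def)
    have e2: "emeasure M2 {x<..} = (\<integral>\<^sup>+ y. ennreal (- H y) \<partial>lborel)"
      unfolding M2_def H_def by (subst emeasure_density) (auto intro!: nn_integral_cong simp: indicator_def)
    have f1: "(\<integral>\<^sup>+ y. ennreal (H y) \<partial>lborel) < \<infinity>" and f2: "(\<integral>\<^sup>+ y. ennreal (- H y) \<partial>lborel) < \<infinity>"
      using Hi unfolding real_integrable_def by (auto simp: less_top)
    have "integral\<^sup>L lborel H = 0" unfolding H_def by (rule int0)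
    then have "enn2real (\<integral>\<^sup>+ y. ennreal (H y) \<partial>lborel) = enn2real (\<integral>\<^sup>+ y. ennreal (- H y) \<partial>lborel)"
      using real_lebesgue_integral_def[OF Hi] by simp
    then have "(\<integral>\<^sup>+ y. ennreal (H y) \<partial>lborel) = (\<integral>\<^sup>+ y. ennreal (- H y) \<partial>lborel)"
      using f1 f2 by (metis ennreal_enn2real infinity_ennreal_def)
    then show "emeasure M1 {x<..} < \<infinity>" "emeasure M1 {x<..} = emeasure M2 {x<..}"
      using e1 e2 f1 by auto
  qed
  then have "AE x in lborel. ennreal (G' x) = ennreal (- G' x)"
    unfolding M1_def M2_def by (subst (asm) sigma_finite_measure.density_unique_iff[OF sigma_finite_lborel]) auto
  then have "AE x in lborel. G' x = 0"
    by eventually_elim (metis add.inverse_inverse ennreal_eq_0_iff linorder_le_cases neg_0_le_iff_le order_antisym)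
  then have "AE x in lebesgue. G' x = 0" by (rule AE_completion)
  then have "AE x in lebesgue. x \<in> {a<..<b} \<longrightarrow> W x = 0"
    using eq' by eventually_elim (auto simp: G_def)
  then show ?thesis by (subst AE_restrict_space_iff) auto
qed

lemma integrable_mult_bounded_lebesgue_on:
  fixes u g :: "real \<Rightarrow> real"
  assumes u: "integrable (lebesgue_on S) u" and S: "S \<in> sets lebesgue"
    and g: "g \<in> borel_measurable borel" and bd: "\<And>x. x \<in> S \<Longrightarrow> \<bar>g x\<bar> \<le> B"
  shows "integrable (lebesgue_on S) (\<lambda>x. u x * g x)"
proof (rule Bochner_Integration.integrable_bound[where f = "\<lambda>x. B * u x"])
  have gm: "g \<in> borel_measurable (lebesgue_on S)"
    using g by (intro measurable_restrict_space1 measurable_completion) simp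
  show "(\<lambda>x. u x * g x) \<in> borel_measurable (lebesgue_on S)"
    using u gm by measurable
  show "AE x in lebesgue_on S. norm (u x * g x) \<le> norm (B * u x)"
  proof (rule AE_I2)
    fix x assume "x \<in> space (lebesgue_on S)"
    then have "\<bar>g x\<bar> \<le> B" using bd by simp
    then have "\<bar>u x\<bar> * \<bar>g x\<bar> \<le> \<bar>u x\<bar> * B" "0 \<le> B" by (auto intro: mult_left_mono)
    then show "norm (u x * g x) \<le> norm (B * u x)" by (simp add: abs_mult mult.commute)
  qed
qed (use u in simp)

lemma test_function_bounded:
  assumes "test_function U \<phi>"
  obtains B where "\<And>x. \<bar>\<phi> x\<bar> \<le> B"
proof -
  obtain K where K: "compact K" "\<And>x. x \<notin> K \<Longrightarrow> \<phi> x = 0"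
    using assms by (auto simp: test_function_def)
  have "continuous_on K \<phi>" by (rule continuous_on_C_upto[OF test_function_C_upto[OF assms, of 0]])
  then have "bounded (\<phi> ` K)" using K(1) by (simp add: compact_continuous_image compact_imp_bounded)
  then obtain B where B: "\<And>x. x \<in> K \<Longrightarrow> \<bar>\<phi> x\<bar> \<le> B" by (auto simp: bounded_iff)
  have "\<bar>\<phi> x\<bar> \<le> max B 0" for x using B[of x] K(2)[of x] by (cases "x \<in> K") auto
  then show ?thesis using that by blast
qed

lemma integrable_mult_test_function:
  assumes "integrable (lebesgue_on S) u" "S \<in> sets lebesgue" "test_function U \<phi>"
  shows "integrable (lebesgue_on S) (\<lambda>x. u x * \<phi> x)"
proof -
  obtain B where B: "\<And>x. \<bar>\<phi> x\<bar> \<le> B" using test_function_bounded[OF assms(3)] by blast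
  have "\<phi> \<in> borel_measurable borel"
    by (rule borel_measurable_continuous_onI[OF continuous_on_C_upto[OF test_function_C_upto[OF assms(3), of 0]]])
  then show ?thesis using assms B by (intro integrable_mult_bounded_lebesgue_on) auto
qed

text \<open>The argument of du Bois-Reymond: a test function \<psi> minus a suitable multiple of one
  fixed bump \<rho> has mean zero and is therefore the derivative of a test function. So
  \<open>u\<close> acts on every \<psi> as the constant \<open>c\<close>; bumps that fill up (s, t)
  turn this into vanishing integrals of u - c over all subintervals.\<close>

lemma AE_const_if_weak_derivative_zero:
  fixes u :: "real \<Rightarrow> real"
  assumes ab: "a < b" and u: "integrable (lebesgue_on {a<..<b}) u"
    and weak: "\<And>\<phi>. test_function {a<..<b} \<phi> \<Longrightarrow> (LINT x|lebesgue_on {a<..<b}. u x * deriv \<phi> x) = 0"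
  obtains c where "AE x in lebesgue_on {a<..<b}. u x = c"
proof -
  let ?L = "lebesgue_on {a<..<b}"
  obtain j0 x0 where j0: "j0 > 0" "bump a b j0 x0 > 0" using bump_pos[OF ab] by blast
  define \<rho> where "\<rho> = bump a b j0"
  have \<rho>: "test_function {a<..<b} \<rho>" unfolding \<rho>_def using j0 by (intro test_function_bump) auto
  have cont\<rho>: "continuous_on UNIV \<rho>" unfolding \<rho>_def by (rule continuous_on_C_upto[OF C_upto_bump])
  have i\<rho>: "integrable ?L \<rho>" by (rule integrable_lebesgue_on_interval[OF cont\<rho>])
  define m where "m = integral\<^sup>L ?L \<rho>"
  \<comment> \<open>If \<rho> had mean zero, its primitive would be a nondecreasing test function,
    hence identically zero, although \<rho> is positive at \<open>x0\<close>.\<close>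
  have "m \<noteq> 0"
  proof
    assume "m = 0"
    then obtain \<phi> where \<phi>: "test_function {a<..<b} \<phi>" "deriv \<phi> = \<rho>"
      using test_function_primitive[OF ab \<rho>] unfolding m_def by blast
    have der: "(\<phi> has_real_derivative \<rho> x) (at x)" for x
      using C_upto_has_derivative[OF test_function_C_upto[OF \<phi>(1)]] \<phi>(2) by metis
    have mono: "\<phi> x \<le> \<phi> y" if "x \<le> y" for x y
    proof (rule DERIV_nonneg_imp_nondecreasing[OF that])
      fix z show "\<exists>d. (\<phi> has_real_derivative d) (at z) \<and> 0 \<le> d"
        using der[of z] bump_bounds(1)[of a b j0 z] unfolding \<rho>_def by blast
    qed
    obtain K where K: "K \<subseteq> {a<..<b}" "\<And>x. x \<notin> K \<Longrightarrow> \<phi> x = 0"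
      using \<phi>(1) by (auto simp: test_function_def)
    have out: "\<phi> x = 0" if "x \<le> a \<or> b \<le> x" for x
      using K that by (metis greaterThanLessThan_iff linorder_not_le subsetD)
    have "\<phi> x = 0" for x
    proof (rule antisym)
      show "\<phi> x \<le> 0" using mono[of x "max x b"] out[of "max x b"] by simp
      show "0 \<le> \<phi> x" using mono[of "min x a" x] out[of "min x a"] by simp
    qed
    then have "\<phi> = (\<lambda>_. 0)" by blast
    then have "\<rho> x0 = 0" using \<phi>(2) by auto
    then show False using j0 by (simp add: \<rho>_def)
  qed
  define c where "c = (LINT x|?L. u x * \<rho> x) / m"
  have ic: "integrable ?L (\<lambda>_. c)" by (rule integrable_lebesgue_on_interval) (rule continuous_on_const)
  have key: "(LINT x|?L. u x * \<psi> x) = c * integral\<^sup>L ?L \<psi>" if \<psi>: "test_function {a<..<b} \<psi>" for \<psi>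
  proof -
    have i\<psi>: "integrable ?L \<psi>"
      by (rule integrable_lebesgue_on_interval[OF continuous_on_C_upto[OF test_function_C_upto[OF \<psi>, of 0]]])
    define k where "k = - integral\<^sup>L ?L \<psi> / m"
    have "test_function {a<..<b} (\<lambda>x. \<psi> x + k * \<rho> x)" by (rule test_function_add[OF \<psi> \<rho>])
    moreover have "integral\<^sup>L ?L (\<lambda>x. \<psi> x + k * \<rho> x) = 0"
      using i\<psi> i\<rho> \<open>m \<noteq> 0\<close> by (simp add: k_def m_def)
    ultimately obtain \<phi> where \<phi>: "test_function {a<..<b} \<phi>" "deriv \<phi> = (\<lambda>x. \<psi> x + k * \<rho> x)"
      by (rule test_function_primitive[OF ab])
    have "0 = (LINT x|?L. u x * \<psi> x + k * (u x * \<rho> x))"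
      using weak[OF \<phi>(1)] by (simp add: \<phi>(2) algebra_simps)
    also have "\<dots> = (LINT x|?L. u x * \<psi> x) + k * (LINT x|?L. u x * \<rho> x)"
      using integrable_mult_test_function[OF u _ \<psi>] integrable_mult_test_function[OF u _ \<rho>] by simp
    finally show ?thesis using \<open>m \<noteq> 0\<close> by (simp add: k_def c_def field_simps)
  qed
  have "AE x in ?L. u x - c = 0"
  proof (rule AE_zero_if_interval_integrals_zero)
    show iuc: "integrable ?L (\<lambda>x. u x - c)" using u ic by simp
    fix s t assume st: "a \<le> s" "s < t" "t \<le> b"
    let ?F = "\<lambda>j x. (u x - c) * bump s t (Suc j) x"
    have "(\<lambda>j. integral\<^sup>L ?L (?F j)) \<longlonglongrightarrow> (LINT x|?L. (u x - c) * indicator {s<..<t} x)"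
    proof (rule integral_dominated_convergence[where w = "\<lambda>x. \<bar>u x - c\<bar>"])
      have bm: "bump s t (Suc j) \<in> borel_measurable borel" for j
        by (rule borel_measurable_continuous_onI[OF continuous_on_C_upto[OF C_upto_bump]])
      have "bump s t (Suc j) \<in> borel_measurable ?L" for j
        using bm by (intro measurable_restrict_space1 measurable_completion) simp
      then show "?F j \<in> borel_measurable ?L" for j using iuc by measurable
      have "(indicator {s<..<t} :: real \<Rightarrow> real) \<in> borel_measurable ?L"
        by (intro measurable_restrict_space1 measurable_completion) simp
      then show "(\<lambda>x. (u x - c) * indicator {s<..<t} x) \<in> borel_measurable ?L" using iuc by measurable
      show "AE x in ?L. (\<lambda>j. ?F j x) \<longlonglongrightarrow> (u x - c) * indicator {s<..<t} x"
        by (intro AE_I2 tendsto_mult tendsto_const LIMSEQ_Suc bump_tendsto)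
      show "AE x in ?L. norm (?F j x) \<le> \<bar>u x - c\<bar>" for j
        using bump_bounds[of s t "Suc j"] by (intro AE_I2) (auto simp: abs_mult intro!: mult_left_le)
    qed (use iuc in auto)
    moreover have "integral\<^sup>L ?L (?F j) = 0" for j
    proof -
      have tf: "test_function {a<..<b} (bump s t (Suc j))" using st by (intro test_function_bump) auto
      have "integral\<^sup>L ?L (?F j) = (LINT x|?L. u x * bump s t (Suc j) x - c * bump s t (Suc j) x)"
        by (simp add: algebra_simps)
      also have "\<dots> = (LINT x|?L. u x * bump s t (Suc j) x) - c * integral\<^sup>L ?L (bump s t (Suc j))"
        using integrable_mult_test_function[OF u _ tf]
          integrable_lebesgue_on_interval[OF continuous_on_C_upto[OF C_upto_bump]] by simp
      finally show ?thesis using key[OF tf] by simp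
    qed
    ultimately have "(LINT x|?L. (u x - c) * indicator {s<..<t} x) = 0"
      by (simp add: LIMSEQ_const_iff)
    moreover have "(LINT x|?L. (u x - c) * indicator {s<..<t} x) = (LINT x|lebesgue_on {s<..<t}. u x - c)"
      using st by (simp add: integral_restrict_space)
        (auto intro!: Bochner_Integration.integral_cong simp: indicator_def)
    ultimately show "(LINT x|lebesgue_on {s<..<t}. u x - c) = 0" by simp
  qed
  then have "AE x in ?L. u x = c" by eventually_elim simp
  then show ?thesis by (rule that)
qed

lemma finite_measure_lebesgue_on_interval: "finite_measure (lebesgue_on {a<..<b :: real})"
  by (rule finite_measureI) (cases "a \<le> b", auto simp: emeasure_restrict_space)

lemma integral_lebesgue_on_initial_segment:
  fixes v :: "real \<Rightarrow> real"
  assumes "a \<le> s" "s \<le> x" "x \<le> b"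
  shows "(LINT t|lebesgue_on {a<..<b}. (if s < t \<and> t < x then v t else 0)) = integral\<^sup>L (lebesgue_on {s<..<x}) v"
  using assms by (simp add: integral_restrict_space)
    (auto intro!: Bochner_Integration.integral_cong simp: indicator_def)

text \<open>By Fubini the indefinite integral \<open>V\<close> of \<open>v\<close> has weak
  derivative \<open>v\<close>, so \<open>u - V\<close> has weak derivative zero and is
  constant.\<close>

lemma weak_derivative_imp_primitive:
  fixes u v :: "real \<Rightarrow> real"
  assumes ab: "a < b" and u: "integrable (lebesgue_on {a<..<b}) u" and v: "integrable (lebesgue_on {a<..<b}) v"
    and weak: "\<And>\<phi>. test_function {a<..<b} \<phi> \<Longrightarrow>
      (LINT x|lebesgue_on {a<..<b}. u x * deriv \<phi> x) = - (LINT x|lebesgue_on {a<..<b}. v x * \<phi> x)"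
  obtains c where "AE x in lebesgue_on {a<..<b}. u x = c + integral\<^sup>L (lebesgue_on {a<..<x}) v"
proof -
  let ?L = "lebesgue_on {a<..<b}"
  interpret L: finite_measure ?L by (rule finite_measure_lebesgue_on_interval)
  interpret LL: pair_sigma_finite ?L ?L ..
  have [measurable]: "u \<in> borel_measurable ?L" "v \<in> borel_measurable ?L" using u v by auto
  have id [measurable]: "(\<lambda>x. x) \<in> borel_measurable ?L"
    by (intro measurable_restrict_space1 measurable_completion) simp
  \<comment> \<open>Written with a cut-off under a fixed measure, so that measurability of
    \<open>V\<close> and Fubini's theorem on the product apply; it is turned into an integral over
    (a, x) only at the end.\<close>
  define V where "V x = (LINT t|?L. (if t < x then v t else 0))" for x
  have V_meas [measurable]: "V \<in> borel_measurable ?L"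
    unfolding V_def by measurable
  have V_bd: "\<bar>V x\<bar> \<le> (LINT t|?L. \<bar>v t\<bar>)" for x
  proof -
    have "\<bar>V x\<bar> \<le> (LINT t|?L. \<bar>if t < x then v t else 0\<bar>)" unfolding V_def by (rule integral_abs_bound)
    also have "\<dots> \<le> (LINT t|?L. \<bar>v t\<bar>)"
      using v by (intro integral_mono' ) auto
    finally show ?thesis .
  qed
  have V_int: "integrable ?L V"
    by (rule L.integrable_const_bound[of _ "LINT t|?L. \<bar>v t\<bar>"]) (use V_bd in auto)
  have Vweak: "(LINT x|?L. V x * deriv \<phi> x) = - (LINT x|?L. v x * \<phi> x)"
    if \<phi>: "test_function {a<..<b} \<phi>" for \<phi>
  proof -
    have \<psi>: "test_function {a<..<b} (deriv \<phi>)" by (rule test_function_deriv[OF \<phi>])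
    obtain B where B: "\<And>x. \<bar>deriv \<phi> x\<bar> \<le> B" using test_function_bounded[OF \<psi>] by blast
    have cont: "continuous_on UNIV (deriv \<phi>)" by (rule continuous_on_C_upto[OF test_function_C_upto[OF \<psi>, of 0]])
    have [measurable]: "deriv \<phi> \<in> borel_measurable ?L"
      using borel_measurable_continuous_onI[OF cont] by (intro measurable_restrict_space1 measurable_completion) simp
    have int: "integrable (?L \<Otimes>\<^sub>M ?L) (\<lambda>(x, t). (if t < x then v t else 0) * deriv \<phi> x)"
    proof (rule Bochner_Integration.integrable_bound[where f = "\<lambda>(x, t). B * v t"])
      show "integrable (?L \<Otimes>\<^sub>M ?L) (\<lambda>(x, t). B * v t)"
        using v by (intro LL.Fubini_integrable) auto
      have "\<bar>v t\<bar> * \<bar>deriv \<phi> x\<bar> \<le> \<bar>B\<bar> * \<bar>v t\<bar>" for t x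
        using mult_left_mono[of "\<bar>deriv \<phi> x\<bar>" "\<bar>B\<bar>" "\<bar>v t\<bar>"] B[of x] by (simp add: mult.commute)
      then show "AE x in ?L \<Otimes>\<^sub>M ?L. norm (case x of (x, t) \<Rightarrow> (if t < x then v t else 0) * deriv \<phi> x)
          \<le> norm (case x of (x, t) \<Rightarrow> B * v t)"
        by (intro AE_I2) (auto simp: abs_mult split: prod.splits)
    qed measurable
    have "(LINT x|?L. V x * deriv \<phi> x) = (LINT x|?L. LINT t|?L. (if t < x then v t else 0) * deriv \<phi> x)"
      unfolding V_def by simp
    also have "\<dots> = (LINT t|?L. LINT x|?L. (if t < x then v t else 0) * deriv \<phi> x)"
      by (rule LL.Fubini_integral[OF int, symmetric])
    also have "\<dots> = (LINT t|?L. - (v t * \<phi> t))"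
    proof (rule Bochner_Integration.integral_cong[OF refl])
      fix t assume "t \<in> space ?L"
      then have t: "a < t" "t < b" by auto
      have "(LINT x|?L. (if t < x then v t else 0) * deriv \<phi> x) = (LINT x|?L. v t * (if t < x \<and> x < b then deriv \<phi> x else 0))"
        by (intro Bochner_Integration.integral_cong) auto
      also have "\<dots> = v t * integral\<^sup>L (lebesgue_on {t<..<b}) (deriv \<phi>)"
        using integral_lebesgue_on_initial_segment[of a t b b "deriv \<phi>"] t by simp
      also have "integral\<^sup>L (lebesgue_on {t<..<b}) (deriv \<phi>) = \<phi> b - \<phi> t"
        using t C_upto_has_derivative[OF test_function_C_upto[OF \<phi>]] cont
        by (intro integral_lebesgue_on_FTC) auto
      also have "\<phi> b = 0" using \<phi> unfolding test_function_def by fastforce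
      finally show "(LINT x|?L. (if t < x then v t else 0) * deriv \<phi> x) = - (v t * \<phi> t)" by simp
    qed
    finally show ?thesis by simp
  qed
  obtain c where "AE x in ?L. u x - V x = c"
  proof (rule AE_const_if_weak_derivative_zero[OF ab])
    show "integrable ?L (\<lambda>x. u x - V x)" using u V_int by simp
    fix \<phi> assume \<phi>: "test_function {a<..<b} \<phi>"
    have \<psi>: "test_function {a<..<b} (deriv \<phi>)" by (rule test_function_deriv[OF \<phi>])
    show "(LINT x|?L. (u x - V x) * deriv \<phi> x) = 0"
      using weak[OF \<phi>] Vweak[OF \<phi>] integrable_mult_test_function[OF u _ \<psi>]
        integrable_mult_test_function[OF V_int _ \<psi>]
      by (simp add: left_diff_distrib)
  qed blast
  then have "AE x in ?L. u x = c + V x" by eventually_elim simp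
  then have "AE x in ?L. u x = c + integral\<^sup>L (lebesgue_on {a<..<x}) v"
  proof (rule AE_mp, intro AE_I2 impI)
    fix x assume x: "x \<in> space ?L" and eq: "u x = c + V x"
    have "V x = (LINT t|?L. (if a < t \<and> t < x then v t else 0))"
      unfolding V_def by (intro Bochner_Integration.integral_cong) auto
    also have "\<dots> = integral\<^sup>L (lebesgue_on {a<..<x}) v"
      using x by (intro integral_lebesgue_on_initial_segment) auto
    finally show "u x = c + integral\<^sup>L (lebesgue_on {a<..<x}) v" using eq by simp
  qed
  then show ?thesis by (rule that)
qed

subsection \<open>Local polynomial approximation in Sobolev spaces\<close>

lemma L2_on_subset:
  assumes "L2_on U f" "S \<subseteq> U" "U \<in> sets lebesgue" "S \<in> sets lebesgue"
  shows "L2_on S f"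
proof -
  have "f \<in> borel_measurable (restrict_space (lebesgue_on U) S)"
    using assms(1) unfolding L2_on_def by (rule measurable_restrict_space1[OF conjunct1])
  also have "restrict_space (lebesgue_on U) S = lebesgue_on S"
    using assms by (subst restrict_restrict_space) (auto simp: Int_absorb1)
  finally show ?thesis using assms integrable_lebesgue_on_subset unfolding L2_on_def by blast
qed

lemma L2_on_diff:
  assumes "L2_on U f" "L2_on U g"
  shows "L2_on U (\<lambda>x. f x - g x)"
proof -
  have [measurable]: "f \<in> borel_measurable (lebesgue_on U)" "g \<in> borel_measurable (lebesgue_on U)"
    using assms by (auto simp: L2_on_def)
  have "integrable (lebesgue_on U) (\<lambda>x. (f x - g x)\<^sup>2)"
  proof (rule Bochner_Integration.integrable_bound[where f = "\<lambda>x. 2 * (f x)\<^sup>2 + 2 * (g x)\<^sup>2"])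
    show "integrable (lebesgue_on U) (\<lambda>x. 2 * (f x)\<^sup>2 + 2 * (g x)\<^sup>2)"
      using assms by (auto simp: L2_on_def)
    have "(f x - g x)\<^sup>2 \<le> 2 * (f x)\<^sup>2 + 2 * (g x)\<^sup>2" for x
      using zero_le_power2[of "f x + g x"] by (simp add: power2_eq_square algebra_simps)
    then show "AE x in lebesgue_on U. norm ((f x - g x)\<^sup>2) \<le> norm (2 * (f x)\<^sup>2 + 2 * (g x)\<^sup>2)"
      by (intro AE_I2) simp
  qed measurable
  then show ?thesis by (simp add: L2_on_def)
qed

lemma L2_on_interval_continuous:
  assumes "continuous_on UNIV f"
  shows "L2_on {a<..<b} f"
  using integrable_lebesgue_on_interval[of f a b] integrable_lebesgue_on_interval[of "\<lambda>x. (f x)\<^sup>2" a b] assms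
  by (auto simp: L2_on_def intro: continuous_intros)

lemma L2_on_interval_poly: "L2_on {a<..<b} (poly q)"
  by (intro L2_on_interval_continuous continuous_intros)

lemma L2_on_integrable:
  assumes "L2_on S f" "S \<in> sets lebesgue" "emeasure lebesgue S < \<infinity>"
  shows "integrable (lebesgue_on S) f"
proof (rule Bochner_Integration.integrable_bound[where f = "\<lambda>x. 1 + (f x)\<^sup>2"])
  have "integrable (lebesgue_on S) (\<lambda>x. 1 :: real)"
    using assms by (intro finite_measure.integrable_const finite_measureI) (auto simp: emeasure_restrict_space)
  then show "integrable (lebesgue_on S) (\<lambda>x. 1 + (f x)\<^sup>2)" using assms by (auto simp: L2_on_def)
  have "\<bar>f x\<bar> \<le> 1 + (f x)\<^sup>2" for x
    using zero_le_power2[of "\<bar>f x\<bar> - 1"] by (simp add: power2_eq_square algebra_simps)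
  then show "AE x in lebesgue_on S. norm (f x) \<le> norm (1 + (f x)\<^sup>2)"
    by (intro AE_I2) simp
qed (use assms in \<open>auto simp: L2_on_def\<close>)

lemma emeasure_lebesgue_interval_finite: "emeasure lebesgue {a<..<b :: real} < \<infinity>"
  by (cases "a \<le> b") auto

lemma L2_on_interval_integrable: "L2_on {a<..<b} f \<Longrightarrow> integrable (lebesgue_on {a<..<b}) f"
  by (rule L2_on_integrable[OF _ _ emeasure_lebesgue_interval_finite]) auto

text \<open>Cauchy-Schwarz against the constant 1, from the integral of (l g - I)^2 being
  nonnegative, with l the measure of \<open>S\<close> and I the integral of g. Dividing by l fails
  on null sets, which are treated separately.\<close>

lemma integral_squared_le:
  assumes "L2_on S g" "S \<in> sets lebesgue" "emeasure lebesgue S < \<infinity>"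
  shows "(integral\<^sup>L (lebesgue_on S) g)\<^sup>2 \<le> measure lebesgue S * (LINT x|lebesgue_on S. (g x)\<^sup>2)"
proof -
  define l where "l = measure lebesgue S"
  define I where "I = integral\<^sup>L (lebesgue_on S) g"
  define Q where "Q = (LINT x|lebesgue_on S. (g x)\<^sup>2)"
  interpret finite_measure "lebesgue_on S"
    using assms by (intro finite_measureI) (auto simp: emeasure_restrict_space)
  have ig: "integrable (lebesgue_on S) g" using assms by (rule L2_on_integrable)
  have ig2: "integrable (lebesgue_on S) (\<lambda>x. (g x)\<^sup>2)" using assms by (simp add: L2_on_def)
  have m: "measure (lebesgue_on S) (space (lebesgue_on S)) = l"
    using assms by (simp add: measure_restrict_space l_def)
  have l0: "l \<ge> 0" by (simp add: l_def)
  have "0 \<le> (LINT x|lebesgue_on S. (l * g x - I)\<^sup>2)" by simp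
  also have "\<dots> = (LINT x|lebesgue_on S. l\<^sup>2 * (g x)\<^sup>2 - 2 * l * I * g x + I\<^sup>2)"
    by (intro Bochner_Integration.integral_cong) (auto simp: power2_eq_square algebra_simps)
  also have "\<dots> = l\<^sup>2 * Q - 2 * l * I * I + I\<^sup>2 * l"
    using ig ig2 m by (simp add: Q_def I_def)
  also have "\<dots> = l * (l * Q - I\<^sup>2)" by (simp add: power2_eq_square algebra_simps)
  finally have *: "0 \<le> l * (l * Q - I\<^sup>2)" .
  show ?thesis
  proof (cases "l = 0")
    case True
    then have "emeasure lebesgue S = 0" using assms(3) by (simp add: l_def emeasure_eq_ennreal_measure)
    then have "emeasure (lebesgue_on S) (space (lebesgue_on S)) = 0"
      using assms by (simp add: emeasure_restrict_space)
    then have "AE x in lebesgue_on S. g x = 0"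
      by (metis emeasure_0_AE)
    then have "I = 0" unfolding I_def using integral_eq_zero_AE by blast
    then show ?thesis by (simp add: I_def[symmetric])
  next
    case False
    then have "l > 0" using l0 by simp
    then have "0 \<le> l * Q - I\<^sup>2" using * by (simp add: zero_le_mult_iff)
    then show ?thesis by (simp add: l_def I_def Q_def)
  qed
qed

lemma integral_lebesgue_on_split:
  fixes v :: "real \<Rightarrow> real"
  assumes "integrable (lebesgue_on {a<..<x}) v" "a \<le> s" "s \<le> x"
  shows "integral\<^sup>L (lebesgue_on {a<..<x}) v = integral\<^sup>L (lebesgue_on {a<..<s}) v + integral\<^sup>L (lebesgue_on {s<..<x}) v"
proof -
  have i: "integrable lebesgue (\<lambda>y. if y \<in> {c<..<d} then v y else 0)" if "a \<le> c" "d \<le> x" for c d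
  proof -
    have "integrable (lebesgue_on {c<..<d}) v"
      by (rule integrable_lebesgue_on_subset[OF assms(1)]) (use that in auto)
    then show ?thesis using Lebesgue_Measure.integrable_restrict_UNIV[of "{c<..<d}" v] by simp
  qed
  have "AE y in lebesgue. y \<noteq> s" by (rule AE_completion[OF AE_lborel_singleton])
  then have "(LINT y|lebesgue. (if y \<in> {a<..<x} then v y else 0))
      = (LINT y|lebesgue. (if y \<in> {a<..<s} then v y else 0) + (if y \<in> {s<..<x} then v y else 0))"
    using i[of a x] i[of a s] i[of s x] assms(2,3)
    by (intro integral_cong_AE) (auto elim!: eventually_mono)
  also have "\<dots> = (LINT y|lebesgue. (if y \<in> {a<..<s} then v y else 0)) + (LINT y|lebesgue. (if y \<in> {s<..<x} then v y else 0))"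
    using i[of a s] i[of s x] assms(2,3) by (intro Bochner_Integration.integral_add) auto
  finally show ?thesis using Lebesgue_Measure.integral_restrict_UNIV[of "{a<..<s}" v] Lebesgue_Measure.integral_restrict_UNIV[of "{s<..<x}" v]
    Lebesgue_Measure.integral_restrict_UNIV[of "{a<..<x}" v] by simp
qed

text \<open>Degree bounds are stated through vanishing coefficients because \<open>degree\<close>
  cannot separate the zero polynomial from constants: d = 0 has to mean q = 0, the starting point
  for integer \<alpha>.\<close>

lemma poly_primitive_exists:
  fixes q :: "real poly"
  assumes d: "\<forall>i\<ge>d. coeff q i = 0"
  obtains P where "pderiv P = q" "\<forall>i\<ge>Suc d. coeff P i = 0"
proof -
  define P where "P = (\<Sum>i\<le>degree q. monom (coeff q i / real (Suc i)) (Suc i))"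
  have cP: "coeff P (Suc i) = coeff q i / real (Suc i)" for i
    by (auto simp: P_def coeff_sum coeff_eq_0)
  have "pderiv P = q" by (rule poly_eqI) (simp add: coeff_pderiv cP del: of_nat_Suc)
  moreover have "\<forall>i\<ge>Suc d. coeff P i = 0"
  proof (intro allI impI)
    fix i assume "Suc d \<le> i"
    then obtain j where "i = Suc j" "d \<le> j" by (cases i) auto
    then show "coeff P i = 0" using d cP by simp
  qed
  ultimately show ?thesis by (rule that)
qed

text \<open>One integration gains two factors t - s: Cauchy-Schwarz bounds the squared difference of
  the primitives pointwise by (t - s) times the error of the derivatives, and integrating this
  constant over (s, t) gives the second factor.\<close>

lemma primitive_poly_approx:
  fixes u v :: "real \<Rightarrow> real"
  assumes st: "a \<le> s" "s < t" "t \<le> b"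
    and u: "L2_on {a<..<b} u" and v: "L2_on {a<..<b} v"
    and prim: "AE x in lebesgue_on {a<..<b}. u x = c + integral\<^sup>L (lebesgue_on {a<..<x}) v"
    and q: "\<forall>i\<ge>d. coeff q i = 0"
  obtains Q where "\<forall>i\<ge>Suc d. coeff Q i = 0"
    "(LINT x|lebesgue_on {s<..<t}. (u x - poly Q x)\<^sup>2) \<le> (t - s)\<^sup>2 * (LINT x|lebesgue_on {s<..<t}. (v x - poly q x)\<^sup>2)"
proof -
  let ?L = "lebesgue_on {s<..<t}"
  obtain P where P: "pderiv P = q" and P': "\<forall>i\<ge>Suc d. coeff P i = 0"
    by (rule poly_primitive_exists[OF q])
  \<comment> \<open>The constant of integration makes \<open>Q\<close> agree at \<open>s\<close>
    with the continuous representative of \<open>u\<close>.\<close>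
  define Q where "Q = P + [:c + integral\<^sup>L (lebesgue_on {a<..<s}) v - poly P s:]"
  define E where "E = (LINT x|?L. (v x - poly q x)\<^sup>2)"
  have 1: "\<forall>i\<ge>Suc d. coeff Q i = 0" using P' by (auto simp: Q_def coeff_pCons split: nat.split)
  have L2: "L2_on {s<..<t} (\<lambda>x. v x - poly q x)"
    by (intro L2_on_diff L2_on_interval_poly L2_on_subset[OF v]) (use st in auto)
  have L2u: "L2_on {s<..<t} (\<lambda>x. u x - poly Q x)"
    by (intro L2_on_diff L2_on_interval_poly L2_on_subset[OF u]) (use st in auto)
  have vi: "integrable (lebesgue_on {c<..<d}) v" if "a \<le> c" "d \<le> b" for c d
    by (rule L2_on_interval_integrable, rule L2_on_subset[OF v]) (use that in auto)
  have pt: "(u x - poly Q x)\<^sup>2 \<le> (t - s) * E"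
    if x: "s < x" "x < t" and eq: "u x = c + integral\<^sup>L (lebesgue_on {a<..<x}) v" for x
  proof -
    have "integral\<^sup>L (lebesgue_on {a<..<x}) v
        = integral\<^sup>L (lebesgue_on {a<..<s}) v + integral\<^sup>L (lebesgue_on {s<..<x}) v"
      using x st by (intro integral_lebesgue_on_split vi) auto
    moreover have "poly P x - poly P s = integral\<^sup>L (lebesgue_on {s<..<x}) (poly q)"
    proof (rule integral_lebesgue_on_FTC[symmetric])
      show "(poly P has_real_derivative poly q y) (at y)" for y using poly_DERIV[of P y] P by simp
      show "continuous_on UNIV (poly q)" by (intro continuous_intros)
    qed (use x in simp)
    ultimately have "u x - poly Q x = integral\<^sup>L (lebesgue_on {s<..<x}) v - integral\<^sup>L (lebesgue_on {s<..<x}) (poly q)"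
      using eq by (simp add: Q_def)
    also have "\<dots> = (LINT y|lebesgue_on {s<..<x}. v y - poly q y)"
      using vi[of s x] st x L2_on_interval_integrable[OF L2_on_interval_poly] by simp
    finally have "(u x - poly Q x)\<^sup>2 = (LINT y|lebesgue_on {s<..<x}. v y - poly q y)\<^sup>2" by simp
    also have "\<dots> \<le> measure lebesgue {s<..<x} * (LINT y|lebesgue_on {s<..<x}. (v y - poly q y)\<^sup>2)"
      by (intro integral_squared_le L2_on_subset[OF L2]) (use x in auto)
    also have "\<dots> \<le> (t - s) * E"
    proof (rule mult_mono)
      show "(LINT y|lebesgue_on {s<..<x}. (v y - poly q y)\<^sup>2) \<le> E"
        unfolding E_def using L2 x
        by (intro integral_mono_lebesgue_on_AE) (auto simp: L2_on_def)
    qed (use x in auto)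
    finally show ?thesis .
  qed
  have "AE x in lebesgue_on {a<..<b}. x \<in> {s<..<t} \<longrightarrow> (u x - poly Q x)\<^sup>2 \<le> (t - s) * E"
    using prim by eventually_elim (intro impI pt; simp)
  then have "AE x in lebesgue. x \<in> {a<..<b} \<longrightarrow> x \<in> {s<..<t} \<longrightarrow> (u x - poly Q x)\<^sup>2 \<le> (t - s) * E"
    by (subst (asm) AE_restrict_space_iff) auto
  then have "AE x in ?L. (u x - poly Q x)\<^sup>2 \<le> (t - s) * E"
    using st by (subst AE_restrict_space_iff) (auto elim!: eventually_mono)
  moreover have "integrable ?L (\<lambda>x. (t - s) * E)"
    by (rule integrable_lebesgue_on_interval[OF continuous_on_const])
  ultimately have "(LINT x|?L. (u x - poly Q x)\<^sup>2) \<le> (LINT x|?L. (t - s) * E)"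
    using L2u by (intro integral_mono_AE) (auto simp: L2_on_def)
  also have "\<dots> = (t - s)\<^sup>2 * E" using st
    by (simp add: measure_restrict_space power2_eq_square)
  finally show ?thesis using that 1 unfolding E_def by blast
qed

text \<open>\<open>R\<close> has the inner Gagliardo integral as its density, so its total mass is
  the finite seminorm. On (s, t) the kernel is at least (t - s) powr (-1 - 2 \<sigma>); choosing a
  point where the density is at most average removes one of these powers. Being a measure,
  \<open>R\<close> lets the errors of disjoint blocks be summed without counting blocks.\<close>

lemma gagliardo_constant_approx:
  assumes \<sigma>: "0 < \<sigma>" and g: "L2_on {a<..<b} g" and fin: "gagliardo \<sigma> {a<..<b} g < \<infinity>"
  obtains R where "finite_measure R" "sets R = sets (lebesgue_on {a<..<b})"
    "\<And>s t. a \<le> s \<Longrightarrow> s < t \<Longrightarrow> t \<le> b \<Longrightarrow>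
      \<exists>c. (LINT x|lebesgue_on {s<..<t}. (g x - c)\<^sup>2) \<le> (t - s) powr (2 * \<sigma>) * measure R {s<..<t}"
proof -
  let ?L = "lebesgue_on {a<..<b}"
  interpret L: finite_measure ?L by (rule finite_measure_lebesgue_on_interval)
  have [measurable]: "g \<in> borel_measurable ?L" using g by (simp add: L2_on_def)
  have id [measurable]: "(\<lambda>x. x) \<in> borel_measurable ?L"
    by (intro measurable_restrict_space1 measurable_completion) simp
  define \<rho> where "\<rho> x = (\<integral>\<^sup>+ y. ennreal ((g x - g y)\<^sup>2 / \<bar>x - y\<bar> powr (1 + 2 * \<sigma>)) \<partial>?L)" for x
  have \<rho> [measurable]: "\<rho> \<in> borel_measurable ?L" unfolding \<rho>_def by measurable
  define R where "R = density ?L \<rho>"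
  have RU: "emeasure R (space R) < \<infinity>"
  proof -
    have "emeasure R (space R) = (\<integral>\<^sup>+ x. \<rho> x * indicator (space ?L) x \<partial>?L)"
      unfolding R_def by (simp add: emeasure_density del: space_lebesgue_on)
    also have "\<dots> = (\<integral>\<^sup>+ x. \<rho> x \<partial>?L)" by (intro nn_integral_cong) auto
    also have "\<dots> = gagliardo \<sigma> {a<..<b} g" by (simp add: \<rho>_def gagliardo_def)
    finally show ?thesis using fin by simp
  qed
  have 1: "finite_measure R" using RU by (intro finite_measureI) auto
  have 2: "sets R = sets ?L" by (simp add: R_def)
  have 3: "\<exists>c. (LINT x|lebesgue_on {s<..<t}. (g x - c)\<^sup>2) \<le> (t - s) powr (2 * \<sigma>) * measure R {s<..<t}"
    if st: "a \<le> s" "s < t" "t \<le> b" for s t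
  proof -
    let ?S = "lebesgue_on {s<..<t}"
    define r where "r = measure R {s<..<t}"
    have Ss: "{s<..<t} \<in> sets ?L" using st by (auto simp: sets_restrict_space_iff)
    have \<rho>S: "\<rho> \<in> borel_measurable ?S"
    proof -
      have "\<rho> \<in> borel_measurable (restrict_space ?L {s<..<t})" by (rule measurable_restrict_space1) measurable
      also have "restrict_space ?L {s<..<t} = ?S"
        using st by (subst restrict_restrict_space) (auto simp: Int_absorb1)
      finally show ?thesis .
    qed
    have mono_S: "(\<integral>\<^sup>+ x. h x \<partial>?S) = (\<integral>\<^sup>+ x. h x * indicator {s<..<t} x \<partial>?L)" for h :: "real \<Rightarrow> ennreal"
      using st by (simp add: nn_integral_restrict_space) (auto intro!: nn_integral_cong simp: indicator_def)
    have eR: "ennreal r = (\<integral>\<^sup>+ x. \<rho> x \<partial>?S)"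
    proof -
      have "ennreal r = emeasure R {s<..<t}"
        unfolding r_def using 1 by (simp add: finite_measure.emeasure_eq_measure)
      also have "\<dots> = (\<integral>\<^sup>+ x. \<rho> x * indicator {s<..<t} x \<partial>?L)"
        unfolding R_def using Ss by (simp add: emeasure_density)
      also have "\<dots> = (\<integral>\<^sup>+ x. \<rho> x \<partial>?S)" by (rule mono_S[symmetric])
      finally show ?thesis .
    qed
    have r0: "r \<ge> 0" by (simp add: r_def)
    have eS: "emeasure ?S {s<..<t} = ennreal (t - s)"
      using st by (simp add: emeasure_restrict_space)
    have "\<exists>x\<in>{s<..<t}. \<rho> x \<le> ennreal (r / (t - s))"
    proof (rule ccontr)
      assume "\<not> ?thesis"
      then have gt: "ennreal (r / (t - s)) < \<rho> x" if "x \<in> {s<..<t}" for x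
        using that by (auto simp: not_le)
      have "(\<integral>\<^sup>+ x. ennreal (r / (t - s)) \<partial>?S) < (\<integral>\<^sup>+ x. \<rho> x \<partial>?S)"
      proof (rule nn_integral_less)
        show "(\<integral>\<^sup>+ x. ennreal (r / (t - s)) \<partial>?S) \<noteq> \<infinity>"
          using eS by (simp add: ennreal_mult_eq_top_iff)
        show "AE x in ?S. ennreal (r / (t - s)) \<le> \<rho> x" using gt by (intro AE_I2) (auto intro: less_imp_le)
        show "\<not> (AE x in ?S. \<rho> x \<le> ennreal (r / (t - s)))"
        proof
          assume "AE x in ?S. \<rho> x \<le> ennreal (r / (t - s))"
          then have "AE x in ?S. False" using AE_space by eventually_elim (use gt in \<open>auto simp: not_le[symmetric]\<close>)
          then have "emeasure ?S {s<..<t} = 0"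
            by (subst (asm) AE_iff_measurable[of "{s<..<t}"]) auto
          then show False using eS st by simp
        qed
      qed (use \<rho>S in auto)
      also have "(\<integral>\<^sup>+ x. \<rho> x \<partial>?S) = ennreal r" using eR by simp
      also have "(\<integral>\<^sup>+ x. ennreal (r / (t - s)) \<partial>?S) = ennreal r"
        using eS st r0 by (simp add: ennreal_mult'[symmetric])
      finally show False by simp
    qed
    then obtain x where x: "x \<in> {s<..<t}" "\<rho> x \<le> ennreal (r / (t - s))" by blast
    have gS: "L2_on {s<..<t} (\<lambda>y. g y - g x)"
      by (intro L2_on_diff L2_on_interval_continuous[OF continuous_on_const] L2_on_subset[OF g]) (use st in auto)
    have "ennreal (LINT y|?S. (g y - g x)\<^sup>2) = (\<integral>\<^sup>+ y. ennreal ((g y - g x)\<^sup>2) \<partial>?S)"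
      using gS by (intro nn_integral_eq_integral[symmetric]) (auto simp: L2_on_def)
    also have "\<dots> = (\<integral>\<^sup>+ y. ennreal ((g y - g x)\<^sup>2) * indicator {s<..<t} y \<partial>?L)" by (rule mono_S)
    also have "\<dots> \<le> (\<integral>\<^sup>+ y. ennreal ((t - s) powr (1 + 2 * \<sigma>)) * ennreal ((g x - g y)\<^sup>2 / \<bar>x - y\<bar> powr (1 + 2 * \<sigma>)) \<partial>?L)"
    proof (rule nn_integral_mono)
      fix y
      have "(g y - g x)\<^sup>2 \<le> (t - s) powr (1 + 2 * \<sigma>) * ((g x - g y)\<^sup>2 / \<bar>x - y\<bar> powr (1 + 2 * \<sigma>))"
        if y: "y \<in> {s<..<t}"
      \<comment> \<open>On the diagonal the quotient is 0 by the convention for division, and the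
        left side is 0 as well.\<close>
      proof (cases "x = y")
        case False
        have "\<bar>x - y\<bar> powr (1 + 2 * \<sigma>) \<le> (t - s) powr (1 + 2 * \<sigma>)"
          using x y \<sigma> by (intro powr_mono2) auto
        then have "(g x - g y)\<^sup>2 * \<bar>x - y\<bar> powr (1 + 2 * \<sigma>) \<le> (g x - g y)\<^sup>2 * (t - s) powr (1 + 2 * \<sigma>)"
          by (intro mult_left_mono) auto
        then show ?thesis using False by (simp add: power2_commute[of "g y"] field_simps)
      qed simp
      then show "ennreal ((g y - g x)\<^sup>2) * indicator {s<..<t} y
          \<le> ennreal ((t - s) powr (1 + 2 * \<sigma>)) * ennreal ((g x - g y)\<^sup>2 / \<bar>x - y\<bar> powr (1 + 2 * \<sigma>))"
        by (auto simp: indicator_def ennreal_mult'[symmetric] intro!: ennreal_leI)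
    qed
    also have "\<dots> = ennreal ((t - s) powr (1 + 2 * \<sigma>)) * \<rho> x"
      unfolding \<rho>_def by (intro nn_integral_cmult) measurable
    also have "\<dots> \<le> ennreal ((t - s) powr (1 + 2 * \<sigma>)) * ennreal (r / (t - s))"
      using x by (intro mult_left_mono) auto
    also have "\<dots> = ennreal ((t - s) powr (2 * \<sigma>) * r)"
      using st r0 by (simp add: ennreal_mult'[symmetric] powr_add)
    finally have "(LINT y|?S. (g y - g x)\<^sup>2) \<le> (t - s) powr (2 * \<sigma>) * r"
      using r0 by (subst (asm) ennreal_le_iff) auto
    then show ?thesis unfolding r_def by blast
  qed
  show ?thesis by (rule that[OF 1 2 3])
qed

text \<open>Starting from the weak derivative of order m = floor \<alpha>, approximated with
  exponent 2 \<sigma>, each of m integrations adds 2 to the exponent and 1 to the number of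
  coefficients. The total is 2 m + 2 \<sigma> = 2 \<alpha>. The strict degree bound turns \<alpha> <
  p + 1 into degree at most p.\<close>

lemma sobolev_local_approx:
  assumes ab: "a < b" and \<alpha>: "\<alpha> > 0" and f: "sobolev_W2 \<alpha> {a<..<b} f"
  obtains R where "finite_measure R" "sets R = sets (lebesgue_on {a<..<b})"
    "\<And>s t. a \<le> s \<Longrightarrow> s < t \<Longrightarrow> t \<le> b \<Longrightarrow> \<exists>q. real (degree q) < \<alpha> \<and>
      (LINT x|lebesgue_on {s<..<t}. (f x - poly q x)\<^sup>2) \<le> (t - s) powr (2 * \<alpha>) * measure R {s<..<t}"
proof -
  let ?U = "{a<..<b}"
  let ?L = "lebesgue_on ?U"
  define m where "m = nat \<lfloor>\<alpha>\<rfloor>"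
  define \<sigma> where "\<sigma> = frac \<alpha>"
  have \<alpha>_eq: "\<alpha> = real m + \<sigma>" using \<alpha> by (simp add: m_def \<sigma>_def frac_def)
  have \<sigma>: "0 \<le> \<sigma>" by (simp add: \<sigma>_def)
  have fL2: "L2_on ?U f" using f by (simp add: sobolev_W2_def)
  obtain g where gL2: "\<And>k. k \<le> m \<Longrightarrow> L2_on ?U (g k)"
    and gw: "\<And>k. k \<le> m \<Longrightarrow> weak_derivative k ?U f (g k)"
    and gg: "\<sigma> \<noteq> 0 \<Longrightarrow> gagliardo \<sigma> ?U (g m) < \<infinity>"
    using f unfolding sobolev_W2_def m_def \<sigma>_def by blast
  have prim: "\<exists>c. AE x in ?L. g k x = c + integral\<^sup>L (lebesgue_on {a<..<x}) (g (Suc k))" if k: "Suc k \<le> m" for k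
  proof -
    have "(LINT x|?L. g k x * deriv \<phi> x) = - (LINT x|?L. g (Suc k) x * \<phi> x)"
      if \<phi>: "test_function ?U \<phi>" for \<phi>
    proof -
      have "(-1) ^ k * (LINT x|?L. g k x * deriv \<phi> x) = (LINT x|?L. f x * (deriv ^^ k) (deriv \<phi>) x)"
        using gw[of k] k test_function_deriv[OF \<phi>] by (simp add: weak_derivative_def)
      also have "\<dots> = (LINT x|?L. f x * (deriv ^^ Suc k) \<phi> x)"
        by (simp add: funpow_Suc_right del: funpow.simps(2))
      also have "\<dots> = (-1) ^ Suc k * (LINT x|?L. g (Suc k) x * \<phi> x)"
        using gw[of "Suc k"] k \<phi> unfolding weak_derivative_def by blast
      finally have "(-1) ^ k * (LINT x|?L. g k x * deriv \<phi> x) = (-1) ^ k * (- (LINT x|?L. g (Suc k) x * \<phi> x))"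
        by simp
      then show ?thesis by (simp only: mult_cancel_left power_eq_0_iff) simp
    qed
    then show ?thesis
      using weak_derivative_imp_primitive[OF ab L2_on_interval_integrable L2_on_interval_integrable, of "g k" "g (Suc k)"]
        gL2[of k] gL2[of "Suc k"] k by (metis Suc_leD)
  qed
  \<comment> \<open>Testing the order-0 condition only against derivatives brings it into the scope
    of the du Bois-Reymond lemma. The constant \<open>c0\<close> this leaves open is absorbed by the
    final polynomial.\<close>
  have "\<exists>c. AE x in ?L. f x - g 0 x = c"
  proof -
    have "(LINT x|?L. (f x - g 0 x) * deriv \<phi> x) = 0" if \<phi>: "test_function ?U \<phi>" for \<phi>
    proof -
      have "(LINT x|?L. f x * deriv \<phi> x) = (LINT x|?L. g 0 x * deriv \<phi> x)"
        using gw[of 0] test_function_deriv[OF \<phi>] by (simp add: weak_derivative_def)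
      then show ?thesis
        using integrable_mult_test_function[OF L2_on_interval_integrable[OF fL2] _ test_function_deriv[OF \<phi>]]
          integrable_mult_test_function[OF L2_on_interval_integrable[OF gL2[of 0]] _ test_function_deriv[OF \<phi>]]
        by (simp add: left_diff_distrib)
    qed
    moreover have "integrable ?L (\<lambda>x. f x - g 0 x)"
      using L2_on_interval_integrable[OF fL2] L2_on_interval_integrable[OF gL2[of 0]] by simp
    ultimately show ?thesis using AE_const_if_weak_derivative_zero[OF ab] by metis
  qed
  then obtain c0 where c0: "AE x in ?L. f x - g 0 x = c0" by blast
  \<comment> \<open>The number of coefficients allowed at the top: none for integer \<alpha>, where
    the squared norm of the derivative itself is the error, and one otherwise.\<close>
  define d where "d = (if \<sigma> = 0 then 0 else 1 :: nat)"
  have "\<exists>R. finite_measure R \<and> sets R = sets ?L \<and> (\<forall>s t. a \<le> s \<longrightarrow> s < t \<longrightarrow> t \<le> b \<longrightarrow>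
      (\<exists>q. (\<forall>i\<ge>d. coeff q i = 0) \<and> (LINT x|lebesgue_on {s<..<t}. (g m x - poly q x)\<^sup>2)
          \<le> (t - s) powr (2 * \<sigma>) * measure R {s<..<t}))"
  proof (cases "\<sigma> = 0")
    case True
    let ?d = "\<lambda>x. ennreal ((g m x)\<^sup>2)"
    define R where "R = density ?L ?d"
    have gm: "L2_on ?U (g m)" by (rule gL2) simp
    then have [measurable]: "g m \<in> borel_measurable ?L" by (simp add: L2_on_def)
    have dens: "emeasure R S = ennreal (LINT x|lebesgue_on S. (g m x)\<^sup>2)" if "S \<subseteq> ?U" "S \<in> sets lebesgue" for S
    proof -
      have S: "S \<in> sets ?L" using that by (simp add: sets_restrict_space_iff)
      have "emeasure R S = (\<integral>\<^sup>+ x. ?d x * indicator S x \<partial>?L)"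
        unfolding R_def using S by (subst emeasure_density) auto
      also have "\<dots> = (\<integral>\<^sup>+ x. ?d x \<partial>lebesgue_on S)"
        using that by (simp add: nn_integral_restrict_space) (auto intro!: nn_integral_cong simp: indicator_def)
      also have "\<dots> = ennreal (LINT x|lebesgue_on S. (g m x)\<^sup>2)"
        using L2_on_subset[OF gm that(1) _ that(2)] by (intro nn_integral_eq_integral) (auto simp: L2_on_def)
      finally show ?thesis .
    qed
    have "finite_measure R"
      using dens[of ?U] by (intro finite_measureI) (simp add: R_def)
    moreover have "sets R = sets ?L" by (simp add: R_def)
    moreover have "\<exists>q. (\<forall>i\<ge>d. coeff q i = 0) \<and> (LINT x|lebesgue_on {s<..<t}. (g m x - poly q x)\<^sup>2)
          \<le> (t - s) powr (2 * \<sigma>) * measure R {s<..<t}" if "a \<le> s" "s < t" "t \<le> b" for s t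
    proof -
      have "{s<..<t} \<subseteq> ?U" using that by auto
      then have e: "emeasure R {s<..<t} = ennreal (LINT x|lebesgue_on {s<..<t}. (g m x)\<^sup>2)"
        by (rule dens) simp
      have "measure R {s<..<t} = (LINT x|lebesgue_on {s<..<t}. (g m x)\<^sup>2)"
        unfolding measure_def e by simp
      then have "(LINT x|lebesgue_on {s<..<t}. (g m x - poly 0 x)\<^sup>2) \<le> (t - s) powr (2 * \<sigma>) * measure R {s<..<t}"
        using that(2) by (simp add: True)
      moreover have "\<forall>i\<ge>d. coeff (0 :: real poly) i = 0" by simp
      ultimately show ?thesis by blast
    qed
    ultimately show ?thesis by (intro exI[of _ R] conjI allI impI)
  next
    case False
    then have "0 < \<sigma>" using \<sigma> by simp
    from gagliardo_constant_approx[OF this gL2[OF order.refl] gg[OF False]]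
    obtain R where R: "finite_measure R" "sets R = sets ?L"
      "\<And>s t. a \<le> s \<Longrightarrow> s < t \<Longrightarrow> t \<le> b \<Longrightarrow>
        \<exists>c. (LINT x|lebesgue_on {s<..<t}. (g m x - c)\<^sup>2) \<le> (t - s) powr (2 * \<sigma>) * measure R {s<..<t}"
      by metis
    have "\<exists>q. (\<forall>i\<ge>d. coeff q i = 0) \<and> (LINT x|lebesgue_on {s<..<t}. (g m x - poly q x)\<^sup>2)
          \<le> (t - s) powr (2 * \<sigma>) * measure R {s<..<t}" if st: "a \<le> s" "s < t" "t \<le> b" for s t
    proof -
      obtain c where "(LINT x|lebesgue_on {s<..<t}. (g m x - c)\<^sup>2) \<le> (t - s) powr (2 * \<sigma>) * measure R {s<..<t}"
        using R(3)[OF st] by blast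
      then show ?thesis using False by (intro exI[of _ "[:c:]"]) (auto simp: d_def coeff_pCons split: nat.split)
    qed
    then show ?thesis using R(1,2) by (intro exI[of _ R] conjI allI impI)
  qed
  then obtain R where R: "finite_measure R" "sets R = sets ?L"
    and base: "\<And>s t. a \<le> s \<Longrightarrow> s < t \<Longrightarrow> t \<le> b \<Longrightarrow>
      \<exists>q. (\<forall>i\<ge>d. coeff q i = 0) \<and> (LINT x|lebesgue_on {s<..<t}. (g m x - poly q x)\<^sup>2)
          \<le> (t - s) powr (2 * \<sigma>) * measure R {s<..<t}"
    by blast
  have fin: "\<exists>q. real (degree q) < \<alpha> \<and>
      (LINT x|lebesgue_on {s<..<t}. (f x - poly q x)\<^sup>2) \<le> (t - s) powr (2 * \<alpha>) * measure R {s<..<t}"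
    if st: "a \<le> s" "s < t" "t \<le> b" for s t
  proof -
    define E where "E = (t - s) powr (2 * \<sigma>) * measure R {s<..<t}"
    have "\<exists>q. (\<forall>i\<ge>d + j. coeff q i = 0) \<and> (LINT x|lebesgue_on {s<..<t}. (g (m - j) x - poly q x)\<^sup>2) \<le> ((t - s)\<^sup>2) ^ j * E"
      if "j \<le> m" for j using that
    proof (induction j)
      case 0
      then show ?case using base[OF st] by (simp add: E_def)
    next
      case (Suc j)
      define k where "k = m - Suc j"
      have k: "m - j = Suc k" "Suc k \<le> m" using Suc.prems by (auto simp: k_def)
      obtain q where q: "\<forall>i\<ge>d + j. coeff q i = 0"
        "(LINT x|lebesgue_on {s<..<t}. (g (Suc k) x - poly q x)\<^sup>2) \<le> ((t - s)\<^sup>2) ^ j * E"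
        using Suc k by auto
      obtain c where c: "AE x in ?L. g k x = c + integral\<^sup>L (lebesgue_on {a<..<x}) (g (Suc k))"
        using prim[OF k(2)] by blast
      obtain Q where Q: "\<forall>i\<ge>Suc (d + j). coeff Q i = 0"
        "(LINT x|lebesgue_on {s<..<t}. (g k x - poly Q x)\<^sup>2) \<le> (t - s)\<^sup>2 * (LINT x|lebesgue_on {s<..<t}. (g (Suc k) x - poly q x)\<^sup>2)"
        by (rule primitive_poly_approx[OF st gL2[OF Suc_leD[OF k(2)]] gL2[OF k(2)] c q(1)])
      note Q(2)
      also have "(t - s)\<^sup>2 * (LINT x|lebesgue_on {s<..<t}. (g (Suc k) x - poly q x)\<^sup>2) \<le> (t - s)\<^sup>2 * (((t - s)\<^sup>2) ^ j * E)"
        using q(2) by (intro mult_left_mono) auto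
      also have "\<dots> = ((t - s)\<^sup>2) ^ Suc j * E" by simp
      finally show ?case using Q(1) unfolding k_def by (intro exI[of _ Q]) simp
    qed
    from this[OF order.refl] obtain q where q: "\<forall>i\<ge>d + m. coeff q i = 0"
      "(LINT x|lebesgue_on {s<..<t}. (g 0 x - poly q x)\<^sup>2) \<le> ((t - s)\<^sup>2) ^ m * E" by auto
    define Q where "Q = q + [:c0:]"
    \<comment> \<open>Adding the constant \<open>c0\<close> respects the degree bound only if
      constants are allowed, and \<alpha> > 0 ensures this.\<close>
    have dm: "0 < d + m" using \<alpha> \<alpha>_eq by (auto simp: d_def)
    then have Qc: "\<forall>i\<ge>d + m. coeff Q i = 0" using q(1) by (auto simp: Q_def coeff_pCons split: nat.split)
    have "degree Q < d + m"
    proof (rule ccontr)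
      assume "\<not> degree Q < d + m"
      then have "coeff Q (degree Q) = 0" using Qc by simp
      then have "Q = 0" by simp
      then show False using \<open>\<not> degree Q < d + m\<close> dm by simp
    qed
    then have deg: "real (degree Q) < \<alpha>" using \<alpha>_eq \<sigma> by (cases "\<sigma> = 0") (auto simp: d_def)
    have L2a: "L2_on {s<..<t} (\<lambda>x. f x - poly Q x)"
      by (intro L2_on_diff L2_on_interval_poly L2_on_subset[OF fL2]) (use st in auto)
    have L2b: "L2_on {s<..<t} (\<lambda>x. g 0 x - poly q x)"
      by (intro L2_on_diff L2_on_interval_poly L2_on_subset[OF gL2]) (use st in auto)
    have "AE x in ?L. (f x - poly Q x)\<^sup>2 = (g 0 x - poly q x)\<^sup>2"
      using c0 by eventually_elim (auto simp: Q_def algebra_simps intro!: arg_cong[where f = "\<lambda>x. x\<^sup>2"])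
    then have "AE x in lebesgue. x \<in> ?U \<longrightarrow> (f x - poly Q x)\<^sup>2 = (g 0 x - poly q x)\<^sup>2"
      by (subst (asm) AE_restrict_space_iff) auto
    then have "AE x in lebesgue_on {s<..<t}. (f x - poly Q x)\<^sup>2 = (g 0 x - poly q x)\<^sup>2"
      using st by (subst AE_restrict_space_iff) (auto elim!: eventually_mono)
    then have "(LINT x|lebesgue_on {s<..<t}. (f x - poly Q x)\<^sup>2) = (LINT x|lebesgue_on {s<..<t}. (g 0 x - poly q x)\<^sup>2)"
      using L2a L2b by (intro integral_cong_AE) (auto simp: L2_on_def)
    also have "\<dots> \<le> ((t - s)\<^sup>2) ^ m * E" by (rule q(2))
    also have "((t - s)\<^sup>2) ^ m = (t - s) powr (2 * real m)"
      using st powr_realpow[of "t - s" "2 * m"] by (simp add: power_mult)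
    also have "\<dots> * E = (t - s) powr (2 * \<alpha>) * measure R {s<..<t}"
      by (simp add: E_def \<alpha>_eq powr_add[symmetric] distrib_left)
    finally show ?thesis using deg by blast
  qed
  show ?thesis by (rule that[OF R fin])
qed

section \<open>Mass of a Sobolev function on short intervals\<close>

lemma sobolev_W2_min_1:
  assumes "sobolev_W2 \<alpha> U f"
  shows "sobolev_W2 (min \<alpha> 1) U f"
proof (cases "\<alpha> \<le> 1")
  case True
  then show ?thesis using assms by (simp add: min_absorb1)
next
  case False
  then have "1 \<le> nat \<lfloor>\<alpha>\<rfloor>" by (simp add: le_nat_iff le_floor_iff)
  obtain g where g: "\<forall>k\<le>nat \<lfloor>\<alpha>\<rfloor>. L2_on U (g k) \<and> weak_derivative k U f (g k)"
    using assms unfolding sobolev_W2_def by blast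
  have "\<forall>k\<le>1. L2_on U (g k) \<and> weak_derivative k U f (g k)"
    using g \<open>1 \<le> nat \<lfloor>\<alpha>\<rfloor>\<close> order_trans by blast
  moreover have "nat \<lfloor>1 :: real\<rfloor> = 1" "frac (1 :: real) = 0" by (simp_all add: frac_def)
  moreover have "L2_on U f" using assms by (simp add: sobolev_W2_def)
  ultimately have "sobolev_W2 1 U f"
    unfolding sobolev_W2_def by (intro conjI exI[of _ g]) simp_all
  then show ?thesis using False by (simp add: min_def)
qed

lemma sobolev_bounded:
  assumes ab: "a < b" and \<alpha>: "\<alpha> \<ge> 1" and f: "sobolev_W2 \<alpha> {a<..<b} f"
  obtains B where "AE x in lebesgue_on {a<..<b}. \<bar>f x\<bar> \<le> B"
proof -
  let ?U = "{a<..<b}"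
  let ?L = "lebesgue_on ?U"
  have "1 \<le> nat \<lfloor>\<alpha>\<rfloor>" using \<alpha> by (simp add: le_nat_iff le_floor_iff)
  then obtain g where g: "L2_on ?U g" "weak_derivative 1 ?U f g"
    using f unfolding sobolev_W2_def by blast
  have fi: "integrable ?L f" using f by (simp add: sobolev_W2_def L2_on_interval_integrable)
  have gi: "integrable ?L g" using g by (simp add: L2_on_interval_integrable)
  have weak: "(LINT x|?L. f x * deriv \<phi> x) = - (LINT x|?L. g x * \<phi> x)" if "test_function ?U \<phi>" for \<phi>
    using g(2) that by (simp add: weak_derivative_def)
  obtain c where c: "AE x in ?L. f x = c + integral\<^sup>L (lebesgue_on {a<..<x}) g"
    by (rule weak_derivative_imp_primitive[OF ab fi gi weak])
  have bd: "\<bar>integral\<^sup>L (lebesgue_on {a<..<x}) g\<bar> \<le> (LINT t|?L. \<bar>g t\<bar>)" if "x \<in> ?U" for x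
  proof -
    have "\<bar>integral\<^sup>L (lebesgue_on {a<..<x}) g\<bar> \<le> (LINT t|lebesgue_on {a<..<x}. \<bar>g t\<bar>)"
      by (rule integral_abs_bound)
    also have "\<dots> \<le> (LINT t|?L. \<bar>g t\<bar>)"
      using gi that by (intro integral_mono_lebesgue_on_AE) auto
    finally show ?thesis .
  qed
  have "AE x in ?L. \<bar>f x\<bar> \<le> \<bar>c\<bar> + (LINT t|?L. \<bar>g t\<bar>)"
    using c AE_space
  proof eventually_elim
    case (elim x)
    then show ?case using bd[of x] abs_triangle_ineq[of c "integral\<^sup>L (lebesgue_on {a<..<x}) g"] by simp
  qed
  then show ?thesis by (rule that)
qed

text \<open>For \<alpha> \<ge> 1 the function is bounded and l \<le> const * l powr \<theta>. Below
  1 it need not be: there (s, t), of length l, is enlarged to a window of length L on which f is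
  close to a constant \<open>c\<close> up to L powr (2 \<alpha>), while the total mass forces c^2 to
  be O(1/L). The mass on (s, t) is thus O(L powr (2 \<alpha>) + l / L), balanced by L of order l
  powr (1 / (2 \<alpha> + 1)).\<close>

lemma sobolev_small_interval_mass:
  assumes ab: "a < b" and \<alpha>: "\<alpha> > 0" and f: "sobolev_W2 \<alpha> {a<..<b} f"
  obtains C where "C \<ge> 0" "\<And>s t. a \<le> s \<Longrightarrow> s < t \<Longrightarrow> t \<le> b \<Longrightarrow>
    (LINT x|lebesgue_on {s<..<t}. (f x)\<^sup>2) \<le> C * (t - s) powr (2 * \<alpha> / (2 * \<alpha> + 1))"
proof -
  let ?U = "{a<..<b}"
  let ?L = "lebesgue_on ?U"
  define \<theta> where "\<theta> = 2 * \<alpha> / (2 * \<alpha> + 1)"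
  define w where "w = b - a"
  have w: "w > 0" using ab by (simp add: w_def)
  have \<theta>: "0 < \<theta>" "\<theta> < 1" using \<alpha> by (auto simp: \<theta>_def field_simps)
  have fL2: "L2_on ?U f" using f by (simp add: sobolev_W2_def)
  have fS: "L2_on {s<..<t} f" if "a \<le> s" "t \<le> b" for s t
    by (rule L2_on_subset[OF fL2]) (use that in auto)
  have cont_int: "integrable (lebesgue_on {s<..<t}) (\<lambda>_. c)" for s t c :: real
    by (rule integrable_lebesgue_on_interval[OF continuous_on_const])
  have const_int: "(LINT x|lebesgue_on {s<..<t}. c) = (t - s) * c" if "s < t" for s t c :: real
    using that by (simp add: measure_restrict_space)
  show ?thesis
  proof (cases "\<alpha> \<ge> 1")
    case True
    obtain B where B: "AE x in ?L. \<bar>f x\<bar> \<le> B" using sobolev_bounded[OF ab True f] by blast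
    show ?thesis
    proof (rule that[of "w powr (1 - \<theta>) * B\<^sup>2"])
      fix s t assume st: "a \<le> s" "s < t" "t \<le> b"
      have "AE x in lebesgue. x \<in> ?U \<longrightarrow> \<bar>f x\<bar> \<le> B"
        using B by (subst (asm) AE_restrict_space_iff) auto
      then have "AE x in lebesgue_on {s<..<t}. \<bar>f x\<bar> \<le> B"
        using st by (subst AE_restrict_space_iff) (auto elim!: eventually_mono)
      then have "AE x in lebesgue_on {s<..<t}. (f x)\<^sup>2 \<le> B\<^sup>2"
        by eventually_elim (simp add: abs_le_square_iff[symmetric])
      then have "(LINT x|lebesgue_on {s<..<t}. (f x)\<^sup>2) \<le> (LINT x|lebesgue_on {s<..<t}. B\<^sup>2)"
        using fS[of s t] st cont_int by (intro integral_mono_AE) (auto simp: L2_on_def)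
      also have "\<dots> = (t - s) powr (1 - \<theta>) * (t - s) powr \<theta> * B\<^sup>2"
        using const_int[OF st(2)] st by (simp add: powr_add[symmetric])
      also have "\<dots> \<le> w powr (1 - \<theta>) * (t - s) powr \<theta> * B\<^sup>2"
        using st \<theta> by (intro mult_right_mono powr_mono2) (auto simp: w_def)
      finally show "(LINT x|lebesgue_on {s<..<t}. (f x)\<^sup>2) \<le> w powr (1 - \<theta>) * B\<^sup>2 * (t - s) powr (2 * \<alpha> / (2 * \<alpha> + 1))"
        by (simp add: \<theta>_def mult_ac)
    qed simp
  next
    case False
    obtain R where R: "finite_measure R" "sets R = sets ?L"
      "\<And>s t. a \<le> s \<Longrightarrow> s < t \<Longrightarrow> t \<le> b \<Longrightarrow> \<exists>q. real (degree q) < \<alpha> \<and>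
        (LINT x|lebesgue_on {s<..<t}. (f x - poly q x)\<^sup>2) \<le> (t - s) powr (2 * \<alpha>) * measure R {s<..<t}"
      by (rule sobolev_local_approx[OF ab \<alpha> f]) blast
    interpret R: finite_measure R by (rule R(1))
    define K where "K = measure R (space R)"
    define N where "N = (LINT x|?L. (f x)\<^sup>2)"
    have K0: "K \<ge> 0" and N0: "N \<ge> 0" by (auto simp: K_def N_def)
    define C where "C = (2 * w powr (2 * \<alpha>) * K + 2 * (2 * N + 2 * w powr (2 * \<alpha>) * K)) * w powr (- \<theta>)"
    show ?thesis
    proof (rule that[of C])
      show "C \<ge> 0" using K0 N0 by (simp add: C_def)
      fix s t assume st: "a \<le> s" "s < t" "t \<le> b"
      define l where "l = t - s"
      have l: "0 < l" "l \<le> w" using st by (auto simp: l_def w_def)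
      \<comment> \<open>The balancing length, normalised by the length \<open>w\<close> of the whole
        interval so that l \<le> L \<le> w.\<close>
      define L where "L = w * (l / w) powr (1 / (2 * \<alpha> + 1))"
      have L1: "l \<le> L"
      proof -
        have "(l / w) powr 1 \<le> (l / w) powr (1 / (2 * \<alpha> + 1))"
          using l w \<alpha> by (intro powr_mono') auto
        then show ?thesis using l w by (simp add: L_def field_simps)
      qed
      have L2: "L \<le> w"
      proof -
        have "(l / w) powr (1 / (2 * \<alpha> + 1)) \<le> 1 powr (1 / (2 * \<alpha> + 1))"
          using l w \<alpha> by (intro powr_mono2) auto
        then show ?thesis using w by (simp add: L_def)
      qed
      \<comment> \<open>The window ends at \<open>t\<close> if it fits and is otherwise pushed right
        to start at \<open>a\<close>; L \<le> w keeps it below \<open>b\<close>.\<close>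
      define s' where "s' = max a (t - L)"
      define t' where "t' = s' + L"
      have st': "a \<le> s'" "s' < t'" "t' \<le> b" "s' \<le> s" "t \<le> t'" "t' - s' = L"
        using st l L1 L2 unfolding s'_def t'_def l_def w_def by auto
      obtain q where q: "real (degree q) < \<alpha>"
        "(LINT x|lebesgue_on {s'<..<t'}. (f x - poly q x)\<^sup>2) \<le> (t' - s') powr (2 * \<alpha>) * measure R {s'<..<t'}"
        using R(3)[OF st'(1,2,3)] by blast
      then have "degree q = 0" using False by simp
      then obtain c where "q = [:c:]" by (rule degree_eq_zeroE)
      then have c: "(LINT x|lebesgue_on {s'<..<t'}. (f x - c)\<^sup>2) \<le> L powr (2 * \<alpha>) * measure R {s'<..<t'}"
        using q(2) st'(6) by simp
      also have "\<dots> \<le> L powr (2 * \<alpha>) * K"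
        unfolding K_def by (intro mult_left_mono R.bounded_measure) auto
      finally have e: "(LINT x|lebesgue_on {s'<..<t'}. (f x - c)\<^sup>2) \<le> L powr (2 * \<alpha>) * K" .
      have L2f: "L2_on {s'<..<t'} f" by (rule fS) (use st' in auto)
      have L2fc: "L2_on {s'<..<t'} (\<lambda>x. f x - c)"
        by (intro L2_on_diff L2f L2_on_interval_continuous[OF continuous_on_const])
      have i2: "integrable (lebesgue_on {s'<..<t'}) (\<lambda>x. (f x)\<^sup>2)"
        "integrable (lebesgue_on {s'<..<t'}) (\<lambda>x. (f x - c)\<^sup>2)"
        using L2f L2fc by (auto simp: L2_on_def)
      have i3: "integrable (lebesgue_on {s<..<t}) (\<lambda>x. (f x)\<^sup>2)"
        "integrable (lebesgue_on {s<..<t}) (\<lambda>x. (f x - c)\<^sup>2)"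
        using st' by (auto intro!: integrable_lebesgue_on_subset[OF i2(1)] integrable_lebesgue_on_subset[OF i2(2)])
      have sq: "c\<^sup>2 \<le> 2 * (f x)\<^sup>2 + 2 * (f x - c)\<^sup>2" "(f x)\<^sup>2 \<le> 2 * (f x - c)\<^sup>2 + 2 * c\<^sup>2" for x
        using zero_le_power2[of "2 * f x - c"] zero_le_power2[of "f x - 2 * c"]
        by (auto simp: power2_eq_square algebra_simps)
      have "L * c\<^sup>2 = (LINT x|lebesgue_on {s'<..<t'}. c\<^sup>2)"
        by (simp only: const_int[OF st'(2)] st'(6))
      also have "\<dots> \<le> (LINT x|lebesgue_on {s'<..<t'}. 2 * (f x)\<^sup>2 + 2 * (f x - c)\<^sup>2)"
        using i2 cont_int sq by (intro integral_mono) auto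
      also have "\<dots> = 2 * (LINT x|lebesgue_on {s'<..<t'}. (f x)\<^sup>2) + 2 * (LINT x|lebesgue_on {s'<..<t'}. (f x - c)\<^sup>2)"
        using i2 by simp
      also have "\<dots> \<le> 2 * N + 2 * (w powr (2 * \<alpha>) * K)"
      proof (intro add_mono mult_left_mono)
        show "(LINT x|lebesgue_on {s'<..<t'}. (f x)\<^sup>2) \<le> N"
          unfolding N_def using fL2 st' by (intro integral_mono_lebesgue_on_AE) (auto simp: L2_on_def)
        have "L powr (2 * \<alpha>) * K \<le> w powr (2 * \<alpha>) * K"
          using L1 L2 l \<alpha> K0 by (intro mult_right_mono powr_mono2) auto
        then show "(LINT x|lebesgue_on {s'<..<t'}. (f x - c)\<^sup>2) \<le> w powr (2 * \<alpha>) * K" using e by simp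
      qed auto
      finally have Lc: "L * c\<^sup>2 \<le> 2 * N + 2 * (w powr (2 * \<alpha>) * K)" .
      have Lpos: "L > 0" using L1 l by simp
      have "(LINT x|lebesgue_on {s<..<t}. (f x)\<^sup>2) \<le> (LINT x|lebesgue_on {s<..<t}. 2 * (f x - c)\<^sup>2 + 2 * c\<^sup>2)"
        using i3 cont_int sq by (intro integral_mono) auto
      also have "\<dots> = 2 * (LINT x|lebesgue_on {s<..<t}. (f x - c)\<^sup>2) + 2 * (l * c\<^sup>2)"
        using i3 cont_int const_int[OF st(2)] by (simp add: l_def)
      also have "(LINT x|lebesgue_on {s<..<t}. (f x - c)\<^sup>2) \<le> L powr (2 * \<alpha>) * K"
      proof -
        have "(LINT x|lebesgue_on {s<..<t}. (f x - c)\<^sup>2) \<le> (LINT x|lebesgue_on {s'<..<t'}. (f x - c)\<^sup>2)"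
          using i2 st' by (intro integral_mono_lebesgue_on_AE) auto
        then show ?thesis using e by simp
      qed
      also have "l * c\<^sup>2 \<le> (l / L) * (2 * N + 2 * (w powr (2 * \<alpha>) * K))"
        using mult_left_mono[OF Lc, of "l / L"] Lpos l by simp
      also have "L powr (2 * \<alpha>) = w powr (2 * \<alpha>) * (l / w) powr \<theta>"
        using l w \<alpha> by (simp add: L_def powr_mult powr_powr \<theta>_def)
      also have "l / L = (l / w) powr \<theta>"
      proof -
        have "l / L = (l / w) powr 1 / (l / w) powr (1 / (2 * \<alpha> + 1))"
          using l w by (simp add: L_def)
        also have "\<dots> = (l / w) powr (1 - 1 / (2 * \<alpha> + 1))" by (simp only: powr_diff)
        also have "1 - 1 / (2 * \<alpha> + 1) = \<theta>" using \<alpha> by (simp add: \<theta>_def field_simps)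
        finally show ?thesis .
      qed
      also have "(l / w) powr \<theta> = l powr \<theta> * w powr (- \<theta>)"
        using l w by (simp add: powr_divide powr_minus field_simps)
      finally show "(LINT x|lebesgue_on {s<..<t}. (f x)\<^sup>2) \<le> C * (t - s) powr (2 * \<alpha> / (2 * \<alpha> + 1))"
        unfolding C_def \<theta>_def[symmetric] l_def[symmetric] by (simp add: algebra_simps)
    qed
  qed
qed

subsection \<open>Discretisation\<close>

text \<open>True for every \<open>g\<close>: the end point is a null set, and if \<open>g\<close> is
  not measurable both integrals are 0 by convention. It can therefore rewrite integrals without side
  conditions.\<close>

lemma integral_lebesgue_on_half_open:
  fixes g :: "real \<Rightarrow> real"
  shows "integral\<^sup>L (lebesgue_on {s..<t}) g = integral\<^sup>L (lebesgue_on {s<..<t}) g"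
proof -
  have ne: "AE y in lebesgue. y \<noteq> s" by (rule AE_completion[OF AE_lborel_singleton])
  show ?thesis
  proof (cases "g \<in> borel_measurable (lebesgue_on {s<..<t})")
    case True
    then have m1: "(\<lambda>y. if y \<in> {s<..<t} then g y else 0) \<in> borel_measurable lebesgue"
      by (subst borel_measurable_if) auto
    have eq: "AE y in lebesgue. (if y \<in> {s<..<t} then g y else 0) = (if y \<in> {s..<t} then g y else 0)"
      using ne by eventually_elim auto
    have m2: "(\<lambda>y. if y \<in> {s..<t} then g y else 0) \<in> borel_measurable lebesgue"
      by (rule borel_measurable_AE[OF m1 eq])
    have "(LINT y|lebesgue. (if y \<in> {s<..<t} then g y else 0)) = (LINT y|lebesgue. (if y \<in> {s..<t} then g y else 0))"
      by (rule integral_cong_AE[OF m1 m2 eq])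
    then show ?thesis
      using Lebesgue_Measure.integral_restrict_UNIV[of "{s..<t}" g]
        Lebesgue_Measure.integral_restrict_UNIV[of "{s<..<t}" g] by simp
  next
    case False
    have "g \<notin> borel_measurable (lebesgue_on {s..<t})"
    proof
      assume "g \<in> borel_measurable (lebesgue_on {s..<t})"
      then have "g \<in> borel_measurable (restrict_space (lebesgue_on {s..<t}) {s<..<t})"
        by (rule measurable_restrict_space1)
      also have "restrict_space (lebesgue_on {s..<t}) {s<..<t} = lebesgue_on {s<..<t}"
        by (subst restrict_restrict_space) (auto simp: Int_absorb1 intro!: arg_cong2[of _ _ _ _ restrict_space])
      finally show False using False by simp
    qed
    then show ?thesis using False
      by (metis borel_measurable_integrable not_integrable_integral_eq)
  qed
qed

lemma cell_subset: "1 \<le> i \<Longrightarrow> i \<le> n \<Longrightarrow> cell n i \<subseteq> {0..<1}"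
  by (auto simp: cell_def field_simps)

lemma integral_cells:
  fixes g :: "real \<Rightarrow> real"
  assumes g: "integrable (lebesgue_on {0..<1}) g" and jk: "j \<le> k" "k \<le> n"
  shows "integral\<^sup>L (lebesgue_on {real j / real n<..<real k / real n}) g = (\<Sum>i\<in>{j+1..k}. integral\<^sup>L (lebesgue_on (cell n i)) g)"
  using jk
proof (induction k rule: dec_induct)
  case base
  show ?case by (simp add: integral_restrict_space)
next
  case (step k)
  have n: "n > 0" using step by simp
  have "integral\<^sup>L (lebesgue_on {real j / real n<..<real (Suc k) / real n}) g
    = integral\<^sup>L (lebesgue_on {real j / real n<..<real k / real n}) g
    + integral\<^sup>L (lebesgue_on {real k / real n<..<real (Suc k) / real n}) g"
  proof (rule integral_lebesgue_on_split)
    show "integrable (lebesgue_on {real j / real n<..<real (Suc k) / real n}) g"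
    proof (rule integrable_lebesgue_on_subset[OF g])
      have "{u<..<v} \<subseteq> {0..<1}" if "0 \<le> u" "v \<le> 1" for u v :: real using that by auto
      moreover have "0 \<le> real j / real n" "real (Suc k) / real n \<le> 1" using n step by (auto simp: field_simps)
      ultimately show "{real j / real n<..<real (Suc k) / real n} \<subseteq> {0..<1}" by blast
    qed auto
  qed (use step in \<open>auto intro: divide_right_mono\<close>)
  also have "integral\<^sup>L (lebesgue_on {real k / real n<..<real (Suc k) / real n}) g = integral\<^sup>L (lebesgue_on (cell n (Suc k))) g"
    by (simp add: cell_def integral_lebesgue_on_half_open)
  finally show ?case using step by simp
qed

lemma measure_cell: "1 \<le> i \<Longrightarrow> i \<le> n \<Longrightarrow> measure lebesgue (cell n i) = 1 / real n"
  by (simp add: cell_def diff_divide_distrib divide_right_mono)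

lemma sets_cell: "cell n i \<in> sets lebesgue"
  by (simp add: cell_def)

lemma L2_on_cell:
  "L2_on {0..<1} g \<Longrightarrow> 1 \<le> i \<Longrightarrow> i \<le> n \<Longrightarrow> L2_on (cell n i) g"
  using L2_on_subset[of "{0..<1}" g "cell n i"] cell_subset[of i n] sets_cell[of n i] by simp

lemma L2_on_cell_integrable: "L2_on {0..<1} g \<Longrightarrow> 1 \<le> i \<Longrightarrow> i \<le> n \<Longrightarrow> integrable (lebesgue_on (cell n i)) g"
  by (rule L2_on_integrable[OF L2_on_cell]) (auto simp: cell_def divide_right_mono)

lemma L2_on_unit_continuous:
  assumes "continuous_on UNIV f"
  shows "L2_on {0..<1} f"
  by (rule L2_on_subset[OF L2_on_interval_continuous[OF assms, of "-1" 2]]) auto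

lemma discretise_diff:
  assumes "L2_on {0..<1} f" "L2_on {0..<1} g"
  shows "discretise n (\<lambda>x. f x - g x) s = discretise n f s - discretise n g s"
proof (cases "s \<in> {1..n}")
  case True
  then have "1 \<le> s" "s \<le> n" by auto
  then show ?thesis using L2_on_cell_integrable[OF assms(1)] L2_on_cell_integrable[OF assms(2)]
    by (simp add: discretise_def right_diff_distrib)
qed (auto simp: discretise_def)

lemma discretise_const: "1 \<le> s \<Longrightarrow> s \<le> n \<Longrightarrow> discretise n (\<lambda>x. c) s = c"
  by (auto simp: discretise_def measure_restrict_space measure_cell cell_def diff_divide_distrib divide_right_mono)

lemma discretise_squared_le:
  assumes "L2_on {0..<1} f" "1 \<le> s" "s \<le> n"
  shows "(discretise n f s)\<^sup>2 \<le> real n * (LINT x|lebesgue_on (cell n s). (f x)\<^sup>2)"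
proof -
  have "(integral\<^sup>L (lebesgue_on (cell n s)) f)\<^sup>2 \<le> measure lebesgue (cell n s) * (LINT x|lebesgue_on (cell n s). (f x)\<^sup>2)"
    by (rule integral_squared_le[OF L2_on_cell[OF assms]]) (use assms in \<open>auto simp: cell_def divide_right_mono\<close>)
  then have "(real n)\<^sup>2 * (integral\<^sup>L (lebesgue_on (cell n s)) f)\<^sup>2 \<le> (real n)\<^sup>2 * (1 / real n * (LINT x|lebesgue_on (cell n s). (f x)\<^sup>2))"
    using assms by (intro mult_left_mono) (auto simp: measure_cell)
  also have "\<dots> = real n * (LINT x|lebesgue_on (cell n s). (f x)\<^sup>2)"
    using assms by (simp add: power2_eq_square)
  finally show ?thesis using assms by (simp add: discretise_def power_mult_distrib)
qed

text \<open>\<open>discretise\<close> is the mean over the cell, so the cross term vanishes. This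
  allows any convenient constant \<open>c\<close> in place of the mean.\<close>

lemma cell_variance_le:
  assumes f: "L2_on {0..<1} f" and s: "1 \<le> s" "s \<le> n"
  shows "(LINT x|lebesgue_on (cell n s). (f x - discretise n f s)\<^sup>2) \<le> (LINT x|lebesgue_on (cell n s). (f x - c)\<^sup>2)"
proof -
  let ?L = "lebesgue_on (cell n s)"
  define d where "d = discretise n f s"
  have m: "measure ?L (space ?L) = 1 / real n"
    using s by (simp add: measure_restrict_space measure_cell cell_def diff_divide_distrib divide_right_mono)
  have ci: "integrable ?L (\<lambda>_. k)" for k :: real
    by (rule integrable_continuous_on_cell[OF continuous_on_const])
  have fi: "integrable ?L f" by (rule L2_on_cell_integrable[OF f s])
  have fdi: "integrable ?L (\<lambda>x. (f x - d)\<^sup>2)"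
    using L2_on_diff[OF f L2_on_unit_continuous[OF continuous_on_const]] L2_on_cell[OF _ s] by (auto simp: L2_on_def)
  have dm: "(LINT x|?L. f x - d) = 0"
    using fi ci m s by (simp add: d_def discretise_def)
  have "(LINT x|?L. (f x - c)\<^sup>2) = (LINT x|?L. (f x - d)\<^sup>2 + (2 * (d - c) * (f x - d) + (d - c)\<^sup>2))"
    by (intro Bochner_Integration.integral_cong) (auto simp: power2_eq_square algebra_simps)
  also have "\<dots> = (LINT x|?L. (f x - d)\<^sup>2) + (2 * (d - c) * (LINT x|?L. f x - d) + (LINT x|?L. (d - c)\<^sup>2))"
    using fi ci fdi by (simp del: Bochner_Integration.integral_diff lebesgue_integral_const)
  also have "\<dots> \<ge> (LINT x|?L. (f x - d)\<^sup>2)" using dm by simp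
  finally show ?thesis unfolding d_def .
qed

section \<open>Gluing the pieces between the jumps\<close>

lemma L2_on_AE_Un:
  assumes f: "L2_on S f" "L2_on T f" and sets: "S \<in> sets lebesgue" "T \<in> sets lebesgue" "U \<in> sets lebesgue"
    and disj: "S \<inter> T = {}" and U: "AE y in lebesgue. y \<in> U \<longleftrightarrow> y \<in> S \<union> T"
  shows "L2_on U f"
proof -
  let ?G = "\<lambda>A y. if y \<in> A then f y else 0"
  let ?H = "\<lambda>A y. if y \<in> A then (f y)\<^sup>2 else 0"
  have m: "?G S \<in> borel_measurable lebesgue" "?G T \<in> borel_measurable lebesgue"
    using f sets by (auto simp: L2_on_def borel_measurable_if)
  have i: "integrable lebesgue (?H S)" "integrable lebesgue (?H T)"
    using f sets by (auto simp: L2_on_def Lebesgue_Measure.integrable_restrict_UNIV)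
  have e1: "AE y in lebesgue. ?G S y + ?G T y = ?G U y"
    using U by eventually_elim (use disj in auto)
  have e2: "AE y in lebesgue. ?H S y + ?H T y = ?H U y"
    using U by eventually_elim (use disj in auto)
  have "?G U \<in> borel_measurable lebesgue"
    by (rule borel_measurable_AE[OF _ e1]) (intro borel_measurable_add m)
  then have "f \<in> borel_measurable (lebesgue_on U)" using sets by (simp add: borel_measurable_if)
  moreover have "?H U \<in> borel_measurable lebesgue"
    by (rule borel_measurable_AE[OF _ e2]) (use i in auto)
  then have "integrable lebesgue (?H U)"
    by (rule integrable_cong_AE_imp[OF Bochner_Integration.integrable_add[OF i]])
      (use e2 in \<open>auto elim!: eventually_mono\<close>)
  then have "integrable (lebesgue_on U) (\<lambda>y. (f y)\<^sup>2)"
    using sets Lebesgue_Measure.integrable_restrict_UNIV[of U "\<lambda>y. (f y)\<^sup>2"] by simp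
  ultimately show ?thesis by (simp add: L2_on_def)
qed

lemma AE_lebesgue_not_eq: "AE y in lebesgue. y \<noteq> (c :: real)"
  by (rule AE_completion[OF AE_lborel_singleton])

lemma piecewise_sobolev_L2_on:
  assumes f: "piecewise_sobolev \<alpha> J x f"
  shows "L2_on {0..<1} f"
proof -
  have x: "x 0 = 0" "x (J + 1) = 1" "\<And>i. i \<le> J \<Longrightarrow> x i < x (i + 1)"
    and fi: "\<And>i. i \<le> J \<Longrightarrow> L2_on {x i<..<x (i + 1)} f"
    using f by (auto simp: piecewise_sobolev_def sobolev_W2_def)
  have "0 < x (j + 1) \<and> L2_on {0<..<x (j + 1)} f" if "j \<le> J" for j using that
  proof (induction j)
    case 0
    then show ?case using fi[of 0] x(1) x(3)[of 0] by simp
  next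
    case (Suc j)
    then have IH: "0 < x (j + 1)" "L2_on {0<..<x (j + 1)} f" by auto
    have "L2_on {0<..<x (Suc j + 1)} f"
    proof (rule L2_on_AE_Un[OF IH(2) fi[OF Suc.prems]])
      show "AE y in lebesgue. y \<in> {0<..<x (Suc j + 1)} \<longleftrightarrow> y \<in> {0<..<x (j + 1)} \<union> {x (Suc j)<..<x (Suc j + 1)}"
        using AE_lebesgue_not_eq[of "x (Suc j)"] by eventually_elim (use IH(1) x(3)[OF Suc.prems] in auto)
    qed auto
    then show ?case using IH(1) x(3)[OF Suc.prems] by simp
  qed
  then have "L2_on {0<..<1} f" using x(2) by (metis order.refl)
  then show ?thesis
  \<comment> \<open>Gluing with the empty set only serves to add the null set consisting of the
    point 0.\<close>
  proof (rule L2_on_AE_Un[where T = "{}"])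
    show "AE y in lebesgue. y \<in> {0..<1} \<longleftrightarrow> y \<in> {0<..<1 :: real} \<union> {}"
      using AE_lebesgue_not_eq[of 0] by eventually_elim auto
  qed (auto simp: L2_on_def measurable_def space_restrict_space integrable_iff_bounded nn_integral_restrict_space)
qed

lemma piece_containing_interval:
  fixes x :: "nat \<Rightarrow> real"
  assumes x: "x 0 = 0" "x (J + 1) = 1" and uv: "0 \<le> u" "v \<le> 1"
    and free: "\<And>i. i \<in> {1..J} \<Longrightarrow> \<not> (u < x i \<and> x i < v)"
  obtains i where "i \<le> J" "x i \<le> u" "v \<le> x (i + 1)"
proof -
  define I where "I = {i. i \<le> J \<and> x i \<le> u}"
  have I: "finite I" "0 \<in> I" using x uv by (auto simp: I_def)
  define i where "i = Max I"
  have "i \<in> I" using I Max_in unfolding i_def by blast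
  then have i: "i \<le> J" "x i \<le> u" by (auto simp: I_def)
  have "v \<le> x (i + 1)"
  proof (cases "i = J")
    case True
    then show ?thesis using x uv by simp
  next
    case False
    have "i + 1 \<notin> I"
    proof
      assume "i + 1 \<in> I"
      then have "i + 1 \<le> i" unfolding i_def by (rule Max_ge[OF I(1)])
      then show False by simp
    qed
    then have "u < x (i + 1)" using i False by (auto simp: I_def)
    then show ?thesis using free[of "i + 1"] i False by auto
  qed
  then show ?thesis using that i by blast
qed

text \<open>The finitely many measures that control the local errors on the pieces are summed into one
  set function, superadditive on disjoint intervals.\<close>

lemma piecewise_sobolev_poly_approx:
  assumes f: "piecewise_sobolev \<alpha> J x f" and \<alpha>: "\<alpha> > 0"
  obtains K \<rho> where "K \<ge> 0" "\<forall>S. \<rho> S \<ge> (0 :: real)"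
    "\<forall>(I :: nat set) l r. finite I \<longrightarrow> disjoint_family_on (\<lambda>i. {l i<..<r i}) I \<longrightarrow> (\<Sum>i\<in>I. \<rho> {l i<..<r i}) \<le> K"
    "\<forall>i s t. i \<le> J \<longrightarrow> x i \<le> s \<longrightarrow> s < t \<longrightarrow> t \<le> x (i + 1) \<longrightarrow> (\<exists>q. real (degree q) < \<alpha> \<and>
      (LINT y|lebesgue_on {s<..<t}. (f y - poly q y)\<^sup>2) \<le> (t - s) powr (2 * \<alpha>) * \<rho> {s<..<t})"
proof -
  let ?U = "\<lambda>i. {x i<..<x (i + 1)}"
  define \<Phi> where "\<Phi> s t r \<longleftrightarrow> (\<exists>q. real (degree q) < \<alpha> \<and>
    (LINT y|lebesgue_on {s<..<t}. (f y - poly q y)\<^sup>2) \<le> (t - s) powr (2 * \<alpha>) * r)" for s t r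
  have mono: "\<Phi> s t r'" if "\<Phi> s t r" "r \<le> r'" for s t r r'
    using that unfolding \<Phi>_def by (meson mult_left_mono order_trans powr_ge_zero)
  have "\<forall>i. \<exists>R. i \<le> J \<longrightarrow> (finite_measure R \<and> sets R = sets (lebesgue_on (?U i)) \<and>
      (\<forall>s t. x i \<le> s \<longrightarrow> s < t \<longrightarrow> t \<le> x (i + 1) \<longrightarrow> \<Phi> s t (measure R {s<..<t})))"
  proof (intro allI)
    fix i
    show "\<exists>R. i \<le> J \<longrightarrow> (finite_measure R \<and> sets R = sets (lebesgue_on (?U i)) \<and>
      (\<forall>s t. x i \<le> s \<longrightarrow> s < t \<longrightarrow> t \<le> x (i + 1) \<longrightarrow> \<Phi> s t (measure R {s<..<t})))"
    proof (cases "i \<le> J")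
      case True
      then have "x i < x (i + 1)" "sobolev_W2 \<alpha> (?U i) f" using f by (auto simp: piecewise_sobolev_def)
      then obtain R where "finite_measure R" "sets R = sets (lebesgue_on (?U i))"
        "\<And>s t. x i \<le> s \<Longrightarrow> s < t \<Longrightarrow> t \<le> x (i + 1) \<Longrightarrow> \<Phi> s t (measure R {s<..<t})"
        unfolding \<Phi>_def by (rule sobolev_local_approx[OF _ \<alpha>]) blast
      then show ?thesis by (intro exI[of _ R] conjI allI impI)
    qed simp
  qed
  then obtain R where R: "\<And>i. i \<le> J \<Longrightarrow> finite_measure (R i)"
    "\<And>i. i \<le> J \<Longrightarrow> sets (R i) = sets (lebesgue_on (?U i))"
    "\<And>i s t. i \<le> J \<Longrightarrow> x i \<le> s \<Longrightarrow> s < t \<Longrightarrow> t \<le> x (i + 1) \<Longrightarrow> \<Phi> s t (measure (R i) {s<..<t})"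
    by metis
  define \<rho> where "\<rho> S = (\<Sum>i\<le>J. measure (R i) (S \<inter> ?U i))" for S
  define K where "K = (\<Sum>i\<le>J. measure (R i) (space (R i)))"
  have 1: "K \<ge> 0" by (auto simp: K_def intro: sum_nonneg)
  have 2: "\<rho> S \<ge> 0" for S by (auto simp: \<rho>_def intro: sum_nonneg)
  have 3: "(\<Sum>j\<in>I. \<rho> {l j<..<r j}) \<le> K" if I: "finite I" "disjoint_family_on (\<lambda>j. {l j<..<r j}) I"
    for I :: "nat set" and l r
  proof -
    have "(\<Sum>j\<in>I. \<rho> {l j<..<r j}) = (\<Sum>i\<le>J. \<Sum>j\<in>I. measure (R i) ({l j<..<r j} \<inter> ?U i))"
      unfolding \<rho>_def by (rule sum.swap)
    also have "\<dots> \<le> K" unfolding K_def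
    proof (rule sum_mono)
      fix i assume "i \<in> {..J}"
      then have i: "i \<le> J" by simp
      interpret finite_measure "R i" by (rule R(1)[OF i])
      have "(\<Sum>j\<in>I. measure (R i) ({l j<..<r j} \<inter> ?U i)) = measure (R i) (\<Union>j\<in>I. {l j<..<r j} \<inter> ?U i)"
      proof (rule finite_measure_finite_Union[symmetric])
        show "disjoint_family_on (\<lambda>j. {l j<..<r j} \<inter> ?U i) I"
          using I(2) unfolding disjoint_family_on_def by blast
        show "(\<lambda>j. {l j<..<r j} \<inter> ?U i) ` I \<subseteq> sets (R i)"
          unfolding R(2)[OF i] by (auto simp: sets_restrict_space)
      qed (rule I(1))
      also have "\<dots> \<le> measure (R i) (space (R i))" by (rule bounded_measure)
      finally show "(\<Sum>j\<in>I. measure (R i) ({l j<..<r j} \<inter> ?U i)) \<le> measure (R i) (space (R i))" .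
    qed
    finally show ?thesis .
  qed
  have 4: "\<Phi> s t (\<rho> {s<..<t})" if i: "i \<le> J" "x i \<le> s" "s < t" "t \<le> x (i + 1)" for i s t
  proof (rule mono[OF R(3)[OF i]])
    have "{s<..<t} \<inter> ?U i = {s<..<t}" using i by auto
    then have "measure (R i) {s<..<t} = measure (R i) ({s<..<t} \<inter> ?U i)" by simp
    also have "\<dots> \<le> \<rho> {s<..<t}"
      unfolding \<rho>_def using i by (intro member_le_sum) auto
    finally show "measure (R i) {s<..<t} \<le> \<rho> {s<..<t}" .
  qed
  show ?thesis by (rule that[of K \<rho>]) (use 1 2 3 4[unfolded \<Phi>_def] in blast)+
qed

lemma piecewise_sobolev_small_interval_mass:
  assumes f: "piecewise_sobolev \<alpha> J x f" and \<alpha>: "\<alpha> > 0"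
  obtains C where "C \<ge> 0" "\<And>i s t. i \<le> J \<Longrightarrow> x i \<le> s \<Longrightarrow> s < t \<Longrightarrow> t \<le> x (i + 1) \<Longrightarrow>
    (LINT y|lebesgue_on {s<..<t}. (f y)\<^sup>2) \<le> C * (t - s) powr (2 * \<alpha> / (2 * \<alpha> + 1))"
proof -
  have "\<forall>i. \<exists>C. i \<le> J \<longrightarrow> C \<ge> 0 \<and> (\<forall>s t. x i \<le> s \<longrightarrow> s < t \<longrightarrow> t \<le> x (i + 1) \<longrightarrow>
    (LINT y|lebesgue_on {s<..<t}. (f y)\<^sup>2) \<le> C * (t - s) powr (2 * \<alpha> / (2 * \<alpha> + 1)))"
  proof
    fix i show "\<exists>C. i \<le> J \<longrightarrow> C \<ge> 0 \<and> (\<forall>s t. x i \<le> s \<longrightarrow> s < t \<longrightarrow> t \<le> x (i + 1) \<longrightarrow>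
      (LINT y|lebesgue_on {s<..<t}. (f y)\<^sup>2) \<le> C * (t - s) powr (2 * \<alpha> / (2 * \<alpha> + 1)))"
    proof (cases "i \<le> J")
      case True
      then have "x i < x (i + 1)" "sobolev_W2 \<alpha> {x i<..<x (i + 1)} f" using f by (auto simp: piecewise_sobolev_def)
      then obtain C where "C \<ge> 0" "\<And>s t. x i \<le> s \<Longrightarrow> s < t \<Longrightarrow> t \<le> x (i + 1) \<Longrightarrow>
        (LINT y|lebesgue_on {s<..<t}. (f y)\<^sup>2) \<le> C * (t - s) powr (2 * \<alpha> / (2 * \<alpha> + 1))"
        by (rule sobolev_small_interval_mass[OF _ \<alpha>]) blast
      then show ?thesis by (intro exI[of _ C] conjI allI impI)
    qed simp
  qed
  then obtain C where C: "\<And>i. i \<le> J \<Longrightarrow> C i \<ge> 0" "\<And>i s t. i \<le> J \<Longrightarrow> x i \<le> s \<Longrightarrow> s < t \<Longrightarrow> t \<le> x (i + 1) \<Longrightarrow>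
    (LINT y|lebesgue_on {s<..<t}. (f y)\<^sup>2) \<le> C i * (t - s) powr (2 * \<alpha> / (2 * \<alpha> + 1))"
    by metis
  show ?thesis
  proof (rule that[of "\<Sum>i\<le>J. C i"])
    show "(\<Sum>i\<le>J. C i) \<ge> 0" using C(1) by (intro sum_nonneg) auto
    fix i s t assume i: "i \<le> J" "x i \<le> s" "s < t" "t \<le> x (i + 1)"
    have "(LINT y|lebesgue_on {s<..<t}. (f y)\<^sup>2) \<le> C i * (t - s) powr (2 * \<alpha> / (2 * \<alpha> + 1))" by (rule C(2)[OF i])
    also have "\<dots> \<le> (\<Sum>i\<le>J. C i) * (t - s) powr (2 * \<alpha> / (2 * \<alpha> + 1))"
      using i C(1) by (intro mult_right_mono member_le_sum) auto
    finally show "(LINT y|lebesgue_on {s<..<t}. (f y)\<^sup>2) \<le> (\<Sum>i\<le>J. C i) * (t - s) powr (2 * \<alpha> / (2 * \<alpha> + 1))" .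
  qed
qed

subsection \<open>Approximation by segmentations\<close>

lemma card_cells_containing_le_1:
  assumes "n \<ge> 1"
  shows "card {s \<in> {1..n}. (real s - 1) / real n < y \<and> y < real s / real n} \<le> 1"
proof -
  have "s = s'" if "(real s - 1) / real n < y" "y < real s / real n" "(real s' - 1) / real n < y" "y < real s' / real n" for s s'
  proof -
    have "real s - 1 < real s'" "real s' - 1 < real s"
      using that assms by (auto simp: field_simps intro: less_trans)
    then show ?thesis by linarith
  qed
  then show ?thesis by (intro card_le_Suc0_iff_eq[THEN iffD2, simplified One_nat_def[symmetric]]) auto
qed

text \<open>For small n a single cell can contain several jumps. Splitting at one jump after another
  leaves at most j + 1 parts, each within one piece and no longer than \<open>d\<close>.\<close>

lemma piecewise_interval_mass_le:
  assumes f: "piecewise_sobolev \<alpha> J x f"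
    and C: "\<And>i s t. i \<le> J \<Longrightarrow> x i \<le> s \<Longrightarrow> s < t \<Longrightarrow> t \<le> x (i + 1) \<Longrightarrow>
      (LINT y|lebesgue_on {s<..<t}. (f y)\<^sup>2) \<le> C * (t - s) powr \<theta>"
    and C0: "C \<ge> 0" and \<theta>: "\<theta> \<ge> 0"
  shows "j \<le> J \<Longrightarrow> 0 \<le> u \<Longrightarrow> u < v \<Longrightarrow> v - u \<le> d \<Longrightarrow> v \<le> x (j + 1) \<Longrightarrow>
    (LINT y|lebesgue_on {u<..<v}. (f y)\<^sup>2) \<le> real (j + 1) * (C * d powr \<theta>)"
proof (induction j arbitrary: u v)
  case 0
  have x0: "x 0 = 0" using f by (simp add: piecewise_sobolev_def)
  have "(LINT y|lebesgue_on {u<..<v}. (f y)\<^sup>2) \<le> C * (v - u) powr \<theta>"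
    using 0 x0 by (intro C[of 0]) auto
  also have "\<dots> \<le> C * d powr \<theta>" using 0 C0 \<theta> by (intro mult_left_mono powr_mono2) auto
  finally show ?case by simp
next
  case (Suc j)
  have d0: "0 \<le> C * d powr \<theta>" using C0 by simp
  have direct: "(LINT y|lebesgue_on {s<..<v}. (f y)\<^sup>2) \<le> C * d powr \<theta>" if "x (Suc j) \<le> s" "u \<le> s" "s < v" for s
  proof -
    have "(LINT y|lebesgue_on {s<..<v}. (f y)\<^sup>2) \<le> C * (v - s) powr \<theta>"
      using Suc.prems that by (intro C[of "Suc j"]) auto
    also have "\<dots> \<le> C * d powr \<theta>" using Suc.prems that C0 \<theta> by (intro mult_left_mono powr_mono2) auto
    finally show ?thesis .
  qed
  have inc: "C * d powr \<theta> \<le> real (Suc j + 1) * (C * d powr \<theta>)" "real (j + 1) * (C * d powr \<theta>) \<le> real (Suc j + 1) * (C * d powr \<theta>)"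
    using mult_right_mono[OF _ d0, of 1 "real (Suc j + 1)"] mult_right_mono[OF _ d0, of "real (j + 1)" "real (Suc j + 1)"]
    by auto
  consider "v \<le> x (j + 1)" | "x (j + 1) \<le> u" | "u < x (j + 1)" "x (j + 1) < v" by linarith
  then show ?case
  proof cases
    case 1
    then show ?thesis using Suc.IH[of u v] Suc.prems inc by simp
  next
    case 2
    then show ?thesis using direct[of u] Suc.prems inc by simp
  next
    case 3
    have "x (j + 1) \<le> 1" "v \<le> 1"
    proof -
      have xJ: "x (J + 1) = 1" and xi: "\<And>i. i \<le> J \<Longrightarrow> x i < x (i + 1)"
        using f by (auto simp: piecewise_sobolev_def)
      have "x i \<le> 1" if "i \<le> J + 1" for i
        using that
      proof (induction i rule: inc_induct)
        case (step i)
        then show ?case using xi[of i] by simp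
      qed (simp only: xJ)
      from this[of "j + 1"] this[of "Suc j + 1"] show "x (j + 1) \<le> 1" "v \<le> 1" using Suc.prems by auto
    qed
    have "integrable (lebesgue_on {u<..<v}) (\<lambda>y. (f y)\<^sup>2)"
    proof (rule integrable_lebesgue_on_subset)
      show "integrable (lebesgue_on {0..<1}) (\<lambda>y. (f y)\<^sup>2)"
        using piecewise_sobolev_L2_on[OF f] by (simp add: L2_on_def)
      show "{u<..<v} \<subseteq> {0..<1}" using Suc.prems(2) \<open>v \<le> 1\<close> by auto
    qed auto
    then have "(LINT y|lebesgue_on {u<..<v}. (f y)\<^sup>2) = (LINT y|lebesgue_on {u<..<x (j + 1)}. (f y)\<^sup>2) + (LINT y|lebesgue_on {x (j + 1)<..<v}. (f y)\<^sup>2)"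
      using 3 by (intro integral_lebesgue_on_split) auto
    also have "\<dots> \<le> real (j + 1) * (C * d powr \<theta>) + C * d powr \<theta>"
      using 3 Suc.prems by (intro add_mono Suc.IH direct) auto
    finally show ?thesis by (simp add: algebra_simps)
  qed
qed

lemma integral_cell_eq: "integral\<^sup>L (lebesgue_on (cell n s)) g = integral\<^sup>L (lebesgue_on {(real s - 1) / real n<..<real s / real n}) (g :: real \<Rightarrow> real)"
  by (simp add: cell_def integral_lebesgue_on_half_open)

text \<open>The price of returning from vectors to functions. A cell without a jump inside is
  compared with a constant, and the measure bound sums over all these cells. A cell with a jump is
  compared with the constant 0, so its whole mass is charged; there are at most J of them.\<close>

lemma cell_average_error:
  assumes f: "piecewise_sobolev \<alpha> J x f" and \<alpha>: "\<alpha> > 0"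
  obtains C where "C \<ge> 0" "\<And>n. n \<ge> 1 \<Longrightarrow>
    (\<Sum>s\<in>{1..n}. LINT y|lebesgue_on (cell n s). (f y - discretise n f s)\<^sup>2) \<le> C * (1 / real n) powr (2 * \<alpha> / (2 * \<alpha> + 1))"
proof -
  define \<theta> where "\<theta> = 2 * \<alpha> / (2 * \<alpha> + 1)"
  \<comment> \<open>Only constants are available on a cell, so the smoothness is capped at 1. The
    capped exponent 2 min \<alpha> 1 is still at least \<theta>, which is below both 1 and 2
    \<alpha>.\<close>
  have \<theta>: "0 \<le> \<theta>" "\<theta> \<le> 2 * min \<alpha> 1"
    using \<alpha> by (auto simp: \<theta>_def field_simps min_def)
  have x: "x 0 = 0" "x (J + 1) = 1" using f by (auto simp: piecewise_sobolev_def)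
  obtain K \<rho> where K: "K \<ge> 0" and \<rho>0: "\<forall>S. \<rho> S \<ge> (0 :: real)"
    and sup: "\<forall>(I :: nat set) l r. finite I \<longrightarrow> disjoint_family_on (\<lambda>i. {l i<..<r i}) I \<longrightarrow> (\<Sum>i\<in>I. \<rho> {l i<..<r i}) \<le> K"
    and app: "\<forall>i s t. i \<le> J \<longrightarrow> x i \<le> s \<longrightarrow> s < t \<longrightarrow> t \<le> x (i + 1) \<longrightarrow> (\<exists>q. real (degree q) < min \<alpha> 1 \<and>
      (LINT y|lebesgue_on {s<..<t}. (f y - poly q y)\<^sup>2) \<le> (t - s) powr (2 * min \<alpha> 1) * \<rho> {s<..<t})"
  proof (rule piecewise_sobolev_poly_approx)
    show "piecewise_sobolev (min \<alpha> 1) J x f"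
      using f sobolev_W2_min_1 unfolding piecewise_sobolev_def by blast
    show "0 < min \<alpha> 1" using \<alpha> by simp
  qed
  obtain C where C: "C \<ge> 0" "\<And>i s t. i \<le> J \<Longrightarrow> x i \<le> s \<Longrightarrow> s < t \<Longrightarrow> t \<le> x (i + 1) \<Longrightarrow>
    (LINT y|lebesgue_on {s<..<t}. (f y)\<^sup>2) \<le> C * (t - s) powr \<theta>"
    using piecewise_sobolev_small_interval_mass[OF f \<alpha>] unfolding \<theta>_def by blast
  note L2 = piecewise_sobolev_L2_on[OF f]
  show ?thesis
  proof (rule that[of "K + real J * (real (J + 1) * C)"])
    show "K + real J * (real (J + 1) * C) \<ge> 0" using K C(1) by simp
    fix n :: nat assume n: "n \<ge> 1"
    define l where "l s = (real s - 1) / real n" for s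
    define r where "r s = real s / real n" for s
    define bad where "bad = (\<Union>i\<in>{1..J}. {s \<in> {1..n}. l s < x i \<and> x i < r s})"
    have lr: "0 \<le> l s" "l s < r s" "r s \<le> 1" "r s - l s = 1 / real n" if "s \<in> {1..n}" for s
      using that n by (auto simp: l_def r_def field_simps)
    have cell: "integral\<^sup>L (lebesgue_on (cell n s)) g = integral\<^sup>L (lebesgue_on {l s<..<r s}) g" for s and g :: "real \<Rightarrow> real"
      unfolding l_def r_def by (rule integral_cell_eq)
    have n1: "(1 / real n) powr (2 * min \<alpha> 1) \<le> (1 / real n) powr \<theta>"
      using n \<theta> by (intro powr_mono') auto
    have err: "(LINT y|lebesgue_on (cell n s). (f y - discretise n f s)\<^sup>2)
        \<le> (1 / real n) powr \<theta> * (\<rho> {l s<..<r s} + (if s \<in> bad then real (J + 1) * C else 0))" if s: "s \<in> {1..n}" for s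
    proof (cases "s \<in> bad")
      case True
      have "(LINT y|lebesgue_on (cell n s). (f y - discretise n f s)\<^sup>2) \<le> (LINT y|lebesgue_on (cell n s). (f y - 0)\<^sup>2)"
        using s by (intro cell_variance_le L2) auto
      also have "\<dots> = (LINT y|lebesgue_on {l s<..<r s}. (f y)\<^sup>2)" by (simp add: cell)
      also have "\<dots> \<le> real (J + 1) * (C * (1 / real n) powr \<theta>)"
        using lr[OF s] x by (intro piecewise_interval_mass_le[OF f C(2) C(1) \<theta>(1)]) auto
      also have "\<dots> \<le> (1 / real n) powr \<theta> * (\<rho> {l s<..<r s} + real (J + 1) * C)"
      proof -
        have "0 \<le> (1 / real n) powr \<theta> * \<rho> {l s<..<r s}" using \<rho>0 by simp
        then show ?thesis by (simp add: algebra_simps)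
      qed
      finally show ?thesis using True by simp
    next
      case False
      have "\<not> (l s < x i \<and> x i < r s)" if "i \<in> {1..J}" for i using False that s by (auto simp: bad_def)
      then obtain i where i: "i \<le> J" "x i \<le> l s" "r s \<le> x (i + 1)"
        using piece_containing_interval[of x J "l s" "r s"] x lr[OF s] by blast
      then obtain q where q: "real (degree q) < min \<alpha> 1"
        "(LINT y|lebesgue_on {l s<..<r s}. (f y - poly q y)\<^sup>2) \<le> (r s - l s) powr (2 * min \<alpha> 1) * \<rho> {l s<..<r s}"
        using app lr[OF s] by blast
      then have "degree q = 0" by simp
      then obtain c where "q = [:c:]" by (rule degree_eq_zeroE)
      then have c: "(LINT y|lebesgue_on {l s<..<r s}. (f y - c)\<^sup>2) \<le> (r s - l s) powr (2 * min \<alpha> 1) * \<rho> {l s<..<r s}"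
        using q(2) by simp
      have "(LINT y|lebesgue_on (cell n s). (f y - discretise n f s)\<^sup>2) \<le> (LINT y|lebesgue_on (cell n s). (f y - c)\<^sup>2)"
        using s by (intro cell_variance_le L2) auto
      also have "\<dots> = (LINT y|lebesgue_on {l s<..<r s}. (f y - c)\<^sup>2)" by (simp add: cell)
      also note c
      also have "(r s - l s) powr (2 * min \<alpha> 1) * \<rho> {l s<..<r s} \<le> (1 / real n) powr \<theta> * \<rho> {l s<..<r s}"
        unfolding lr(4)[OF s] using n1 \<rho>0 by (intro mult_right_mono) auto
      finally show ?thesis using False by simp
    qed
    have "card bad \<le> (\<Sum>i\<in>{1..J}. card {s \<in> {1..n}. l s < x i \<and> x i < r s})"
      unfolding bad_def by (rule card_UN_le) simp
    also have "\<dots> \<le> (\<Sum>i\<in>{1..J}. 1)"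
      unfolding l_def r_def using n by (intro sum_mono card_cells_containing_le_1)
    finally have cb: "card bad \<le> J" by simp
    have bs: "bad \<subseteq> {1..n}" by (auto simp: bad_def)
    have "(\<Sum>s\<in>{1..n}. if s \<in> bad then real (J + 1) * C else 0) = real (card bad) * (real (J + 1) * C)"
      using bs by (simp add: sum.If_cases Int_absorb1)
    also have "\<dots> \<le> real J * (real (J + 1) * C)"
      using cb C(1) by (intro mult_right_mono) auto
    finally have sb: "(\<Sum>s\<in>{1..n}. if s \<in> bad then real (J + 1) * C else 0) \<le> real J * (real (J + 1) * C)" .
    have disj: "disjoint_family_on (\<lambda>s. {l s<..<r s}) {1..n}"
    proof -
      have "{l s<..<r s} \<inter> {l t<..<r t} = {}" if "s < t" for s t
      proof -
        have "r s \<le> l t" using that n by (auto simp: l_def r_def intro: divide_right_mono)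
        then show ?thesis by auto
      qed
      then show ?thesis unfolding disjoint_family_on_def by (metis Int_commute linorder_neqE_nat)
    qed
    have "(\<Sum>s\<in>{1..n}. LINT y|lebesgue_on (cell n s). (f y - discretise n f s)\<^sup>2)
      \<le> (\<Sum>s\<in>{1..n}. (1 / real n) powr \<theta> * (\<rho> {l s<..<r s} + (if s \<in> bad then real (J + 1) * C else 0)))"
      by (intro sum_mono err)
    also have "\<dots> = (1 / real n) powr \<theta> * ((\<Sum>s\<in>{1..n}. \<rho> {l s<..<r s}) + (\<Sum>s\<in>{1..n}. if s \<in> bad then real (J + 1) * C else 0))"
      unfolding sum_distrib_left[symmetric] sum.distrib ..
    also have "\<dots> \<le> (1 / real n) powr \<theta> * (K + real J * (real (J + 1) * C))"
      using sb sup[rule_format, OF _ disj] by (intro mult_left_mono add_mono) auto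
    finally show "(\<Sum>s\<in>{1..n}. LINT y|lebesgue_on (cell n s). (f y - discretise n f s)\<^sup>2)
      \<le> (K + real J * (real (J + 1) * C)) * (1 / real n) powr (2 * \<alpha> / (2 * \<alpha> + 1))"
      by (simp add: \<theta>_def mult.commute)
  qed
qed

lemma level_set_eq_interval:
  fixes lab :: "nat \<Rightarrow> nat"
  assumes mono: "\<And>s t. 1 \<le> s \<Longrightarrow> s \<le> t \<Longrightarrow> t \<le> n \<Longrightarrow> lab s \<le> lab t"
    and v: "v \<in> lab ` {1..n}"
  defines "P \<equiv> {s \<in> {1..n}. lab s = v}"
  shows "P = {Min P..Max P}" "1 \<le> Min P" "Min P \<le> Max P" "Max P \<le> n" "lab (Min P) = v" "lab (Max P) = v"
proof -
  have P: "finite P" "P \<noteq> {}" using v by (auto simp: P_def)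
  have m: "Min P \<in> P" "Max P \<in> P" using P Min_in Max_in by blast+
  then show "1 \<le> Min P" "Min P \<le> Max P" "Max P \<le> n" "lab (Min P) = v" "lab (Max P) = v"
    using P by (auto simp: P_def)
  have "s \<in> P" if "Min P \<le> s" "s \<le> Max P" for s
  proof -
    have b: "1 \<le> Min P" "Max P \<le> n" "lab (Min P) = v" "lab (Max P) = v" using m unfolding P_def by auto
    have "lab (Min P) \<le> lab s" "lab s \<le> lab (Max P)" using mono[of "Min P" s] mono[of s "Max P"] that b by auto
    then have "lab s = v" "1 \<le> s" "s \<le> n" using b that by linarith+
    then show ?thesis by (simp add: P_def)
  qed
  then have "{Min P..Max P} \<subseteq> P" by (meson atLeastAtMost_iff subsetI)
  moreover have "P \<subseteq> {Min P..Max P}" using Min_le[OF P(1)] Max_ge[OF P(1)] by (meson atLeastAtMost_iff subsetI)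
  ultimately show "P = {Min P..Max P}" by (rule subset_antisym[rotated])
qed

lemma sum_fun_apply: "(\<Sum>a\<in>A. f a) x = (\<Sum>a\<in>A. f a x)" for f :: "'a \<Rightarrow> 'b \<Rightarrow> 'c :: comm_monoid_add"
  by (induction A rule: infinite_finite_induct) auto

text \<open>Interval partitions are produced as level sets of a nondecreasing labelling: blocks are
  then intervals automatically, and counting blocks reduces to bounding labels.\<close>

lemma label_segmentation:
  fixes lab :: "nat \<Rightarrow> nat"
  assumes mono: "\<And>s t. 1 \<le> s \<Longrightarrow> s \<le> t \<Longrightarrow> t \<le> n \<Longrightarrow> lab s \<le> lab t"
    and q: "\<And>v. degree (q v) \<le> p"
  defines "Q \<equiv> (\<lambda>v. {s \<in> {1..n}. lab s = v}) ` lab ` {1..n}"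
  shows "Q \<in> interval_partitions n" "card Q \<le> card (lab ` {1..n})"
    "(\<lambda>s. discretise n (poly (q (lab s))) s) \<in> partition_space p n Q"
proof -
  show "card Q \<le> card (lab ` {1..n})" unfolding Q_def by (rule card_image_le) simp
  have "partition_on {1..n} Q"
    unfolding Q_def by (rule partition_onI) (auto simp: disjnt_def)
  moreover have "Q \<subseteq> discrete_intervals n"
  proof
    fix P assume "P \<in> Q"
    then obtain v where v: "v \<in> lab ` {1..n}" "P = {s \<in> {1..n}. lab s = v}" by (auto simp: Q_def)
    note lev = level_set_eq_interval[OF mono v(1), folded v(2)]
    show "P \<in> discrete_intervals n" unfolding discrete_intervals_def using lev(1-4) by blast
  qed
  ultimately show "Q \<in> interval_partitions n" by (simp add: interval_partitions_def)
  interpret vs: vector_space seq_scale by (rule vector_space_seq_scale)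
  define h where "h v = (\<lambda>s. indicator {s \<in> {1..n}. lab s = v} s * discretise n (poly (q v)) s)" for v
  have "(\<lambda>s. discretise n (poly (q (lab s))) s) = (\<Sum>v\<in>lab ` {1..n}. h v)"
  proof
    fix s
    show "discretise n (poly (q (lab s))) s = (\<Sum>v\<in>lab ` {1..n}. h v) s"
    proof (cases "s \<in> {1..n}")
      case True
      have "(\<Sum>v\<in>lab ` {1..n}. h v) s = (\<Sum>v\<in>lab ` {1..n}. if lab s = v then discretise n (poly (q v)) s else 0)"
        unfolding sum_fun_apply by (intro sum.cong) (use True in \<open>auto simp: h_def\<close>)
      also have "\<dots> = discretise n (poly (q (lab s))) s" using True by (simp add: sum.delta)
      finally show ?thesis by simp
    next
      case False
      then have "discretise n g s = 0" for g unfolding discretise_def by (simp only: if_False)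
      then show ?thesis by (simp add: sum_fun_apply h_def)
    qed
  qed
  also have "\<dots> \<in> partition_space p n Q"
    unfolding partition_space_def
  proof (intro vs.span_sum vs.span_base)
    fix v assume "v \<in> lab ` {1..n}"
    then have "{s \<in> {1..n}. lab s = v} \<in> Q" by (auto simp: Q_def)
    moreover have "h v \<in> piece_space p n {s \<in> {1..n}. lab s = v}"
      using q[of v] unfolding piece_space_def h_def by blast
    ultimately show "h v \<in> \<Union> (piece_space p n ` Q)" by blast
  qed
  finally show "(\<lambda>s. discretise n (poly (q (lab s))) s) \<in> partition_space p n Q" .
qed

text \<open>Cauchy-Schwarz on each cell, whose length is 1/n, shows that \<open>discretise\<close>
  contracts the L2 norm into the Euclidean norm divided by sqrt n.\<close>

lemma block_approx:
  assumes f: "L2_on {0..<1} f" and ij: "1 \<le> i" "i \<le> j" "j \<le> n"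
  shows "(\<Sum>s\<in>{i..j}. (discretise n (poly q) s - discretise n f s)\<^sup>2)
    \<le> real n * (LINT y|lebesgue_on {(real i - 1) / real n<..<real j / real n}. (f y - poly q y)\<^sup>2)"
proof -
  have Lq: "L2_on {0..<1} (poly q)" by (intro L2_on_unit_continuous continuous_intros)
  have Ld: "L2_on {0..<1} (\<lambda>y. f y - poly q y)" by (rule L2_on_diff[OF f Lq])
  have "(\<Sum>s\<in>{i..j}. (discretise n (poly q) s - discretise n f s)\<^sup>2)
    = (\<Sum>s\<in>{i..j}. (discretise n (\<lambda>y. f y - poly q y) s)\<^sup>2)"
    by (intro sum.cong refl) (simp add: discretise_diff[OF f Lq] power2_commute)
  also have "\<dots> \<le> (\<Sum>s\<in>{i..j}. real n * (LINT y|lebesgue_on (cell n s). (f y - poly q y)\<^sup>2))"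
    using ij by (intro sum_mono discretise_squared_le Ld) auto
  also have "\<dots> = real n * (\<Sum>s\<in>{(i - 1) + 1..j}. LINT y|lebesgue_on (cell n s). (f y - poly q y)\<^sup>2)"
    using ij by (simp add: sum_distrib_left)
  also have "(\<Sum>s\<in>{(i - 1) + 1..j}. LINT y|lebesgue_on (cell n s). (f y - poly q y)\<^sup>2)
    = (LINT y|lebesgue_on {real (i - 1) / real n<..<real j / real n}. (f y - poly q y)\<^sup>2)"
    using Ld ij by (intro integral_cells[symmetric]) (auto simp: L2_on_def)
  also have "real (i - 1) = real i - 1" using ij by simp
  finally show ?thesis .
qed

text \<open>The label of a cell is its block number plus the numbers of jumps up to its left end and
  before its right end. It is constant on a run of cells only if the run has no jump in its
  interior or is a single cell.\<close>

lemma partition_approx: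
  assumes f: "piecewise_sobolev \<alpha> J x f" and \<alpha>: "\<alpha> > 0" "\<alpha> < real p + 1"
  obtains C where "C \<ge> 0" "\<And>n k. 1 \<le> k \<Longrightarrow> k \<le> n \<Longrightarrow> \<exists>Q h. Q \<in> interval_partitions n \<and>
    h \<in> partition_space p n Q \<and> card Q \<le> k + 2 * J \<and>
    (\<Sum>s\<in>{1..n}. (h s - discretise n f s)\<^sup>2) \<le> real n * (C * real k powr (- 2 * \<alpha>))"
proof -
  have x: "x 0 = 0" "x (J + 1) = 1" using f by (auto simp: piecewise_sobolev_def)
  note L2 = piecewise_sobolev_L2_on[OF f]
  obtain K \<rho> where K: "K \<ge> 0" and \<rho>0: "\<forall>S. \<rho> S \<ge> (0 :: real)"
    and sup: "\<forall>(I :: nat set) l r. finite I \<longrightarrow> disjoint_family_on (\<lambda>i. {l i<..<r i}) I \<longrightarrow> (\<Sum>i\<in>I. \<rho> {l i<..<r i}) \<le> K"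
    and app: "\<forall>i s t. i \<le> J \<longrightarrow> x i \<le> s \<longrightarrow> s < t \<longrightarrow> t \<le> x (i + 1) \<longrightarrow> (\<exists>q. real (degree q) < \<alpha> \<and>
      (LINT y|lebesgue_on {s<..<t}. (f y - poly q y)\<^sup>2) \<le> (t - s) powr (2 * \<alpha>) * \<rho> {s<..<t})"
    by (rule piecewise_sobolev_poly_approx[OF f \<alpha>(1)])
  show ?thesis
  proof (rule that[of "2 powr (2 * \<alpha>) * K"])
    show "2 powr (2 * \<alpha>) * K \<ge> 0" using K by simp
    fix n k :: nat assume k: "1 \<le> k" "k \<le> n"
    then have n: "n \<ge> 1" by simp
    define l where "l s = (real s - 1) / real n" for s
    define r where "r s = real s / real n" for s
    define As where "As s = {i \<in> {1..J}. x i \<le> l s}" for s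
    define Bs where "Bs s = {i \<in> {1..J}. x i < r s}" for s
    \<comment> \<open>Cells with the same value differ by less than n/k in index, so a run is
      shorter than 1/k + 1/n, which is at most 2/k because k \<le> n. This is the source of the
      factor 2 powr (2 \<alpha>).\<close>
    define b where "b s = (s - 1) * k div n" for s
    define lab where "lab s = b s + card (As s) + card (Bs s)" for s
    have lr_mono: "l s \<le> l t" "r s \<le> r t" if "s \<le> t" for s t
      using that n by (auto simp: l_def r_def intro!: divide_right_mono)
    have sub: "As s \<subseteq> As t" "Bs s \<subseteq> Bs t" if "s \<le> t" for s t
      using lr_mono[OF that] by (auto simp: As_def Bs_def)
    have fin: "finite (As s)" "finite (Bs s)" for s by (auto simp: As_def Bs_def)
    have parts: "b s \<le> b t" "card (As s) \<le> card (As t)" "card (Bs s) \<le> card (Bs t)" if "s \<le> t" for s t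
      using sub[OF that] fin that by (auto simp: b_def intro!: card_mono div_le_mono mult_right_mono)
    have mono: "lab s \<le> lab t" if "1 \<le> s" "s \<le> t" "t \<le> n" for s t
      using parts[OF that(2)] by (simp add: lab_def)
    have lab_less: "lab s < k + 2 * J" if "s \<in> {1..n}" for s
    proof -
      have "(s - 1) * k < n * k" using that k by auto
      then have "b s < k" unfolding b_def using n by (simp add: less_mult_imp_div_less mult.commute)
      moreover have "As s \<subseteq> {1..J}" "Bs s \<subseteq> {1..J}" by (auto simp: As_def Bs_def)
      then have "card (As s) \<le> J" "card (Bs s) \<le> J"
        using card_mono[of "{1..J}" "As s"] card_mono[of "{1..J}" "Bs s"] by simp_all
      ultimately show ?thesis by (simp add: lab_def)
    qed
    define V where "V = lab ` {1..n}"
    have finV: "finite V" by (simp add: V_def)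
    have cardV: "card V \<le> k + 2 * J"
    proof -
      have "V \<subseteq> {..<k + 2 * J}" using lab_less by (auto simp: V_def)
      then have "card V \<le> card {..<k + 2 * J}" by (intro card_mono) auto
      then show ?thesis by simp
    qed
    define P where "P v = {s \<in> {1..n}. lab s = v}" for v
    define lo where "lo v = Min (P v)" for v
    define hi where "hi v = Max (P v)" for v
    have lev: "P v = {lo v..hi v}" "1 \<le> lo v" "lo v \<le> hi v" "hi v \<le> n" "lab (lo v) = v" "lab (hi v) = v" if "v \<in> V" for v
      using level_set_eq_interval[where lab = lab and n = n and v = v, OF mono] that
      unfolding V_def P_def lo_def hi_def by blast+
    define e where "e = real n * ((2 / real k) powr (2 * \<alpha>))"
    have e0: "e \<ge> 0" by (simp add: e_def)
    have ex: "\<exists>q. degree q \<le> p \<and> (\<Sum>s\<in>P v. (discretise n (poly q) s - discretise n f s)\<^sup>2) \<le> e * \<rho> {l (lo v)<..<r (hi v)}"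
      if v: "v \<in> V" for v
    proof (cases "lo v = hi v")
      \<comment> \<open>On a single cell the constant equal to the cell mean of f reproduces the
        target exactly, whether or not the cell contains a jump.\<close>
      case True
      have "poly [:c:] = (\<lambda>_. c)" for c :: real by (simp add: fun_eq_iff)
      then have "discretise n (poly [:discretise n f (hi v):]) (hi v) = discretise n f (hi v)"
        using lev[OF v] True discretise_const[of "hi v" n "discretise n f (hi v)"] by (simp only:)
      then have "(\<Sum>s\<in>P v. (discretise n (poly [:discretise n f (hi v):]) s - discretise n f s)\<^sup>2) = 0"
        using lev(1)[OF v] True by simp
      then show ?thesis using e0 \<rho>0 by (intro exI[of _ "[:discretise n f (hi v):]"]) simp
    next
      case False
      define s where "s = lo v"
      define t where "t = hi v"
      have st: "1 \<le> s" "s < t" "t \<le> n" "lab s = lab t"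
        using lev(2-6)[OF v] False unfolding s_def t_def by auto
      \<comment> \<open>A sum of nondecreasing terms takes equal values only if every term does, and
        nested finite sets of equal size coincide. A jump inside the run would lie before the right
        end of the first cell, hence before the left end of the last cell, hence before the left end
        of the first: impossible.\<close>
      have eq: "b s = b t" "card (As s) = card (As t)" "card (Bs s) = card (Bs t)"
        using parts[of s t] st by (auto simp: lab_def)
      have seteq: "As s = As t" "Bs s = Bs t"
        using card_subset_eq[OF fin(1) sub(1) eq(2)] card_subset_eq[OF fin(2) sub(2) eq(3)] st by simp_all
      have free: "\<not> (l s < x i \<and> x i < r t)" if "i \<in> {1..J}" for i
      proof
        assume i: "l s < x i \<and> x i < r t"
        then have "i \<in> Bs s" using seteq that by (auto simp: Bs_def)
        moreover have "r s \<le> l t" using st n by (auto simp: r_def l_def intro: divide_right_mono)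
        ultimately have "i \<in> As t" using that by (auto simp: As_def Bs_def)
        then have "i \<in> As s" using seteq by blast
        then show False using i by (simp add: As_def)
      qed
      have u: "0 \<le> l s" "r t \<le> 1" "l s < r t"
        using st n by (auto simp: l_def r_def divide_simps)
      obtain i where i: "i \<le> J" "x i \<le> l s" "r t \<le> x (i + 1)"
        using piece_containing_interval[OF x u(1,2) free] by blast
      obtain q where q: "real (degree q) < \<alpha>"
        "(LINT y|lebesgue_on {l s<..<r t}. (f y - poly q y)\<^sup>2) \<le> (r t - l s) powr (2 * \<alpha>) * \<rho> {l s<..<r t}"
        using app i u(3) by blast
      have len: "r t - l s \<le> 2 / real k"
      proof -
        have "(t - 1) * k < (b t + 1) * n" unfolding b_def using n
          by (metis Suc_eq_plus1 dividend_less_div_times less_le_trans mult.commute mult_Suc zero_less_one add.commute)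
        moreover have "b s * n \<le> (s - 1) * k" unfolding b_def by (rule div_times_less_eq_dividend)
        ultimately have "(t - 1) * k < (s - 1) * k + n" using eq(1) by (simp add: algebra_simps)
        then have "real ((t - 1) * k) < real ((s - 1) * k + n)" by (simp only: of_nat_less_iff)
        then have "(real t - 1) * real k < (real s - 1) * real k + real n"
          using st by simp
        then have "(real t - real s) * real k \<le> real n" by (simp add: algebra_simps)
        moreover have "real k \<le> real n" using k by simp
        ultimately have "(real t - real s + 1) * real k \<le> 2 * real n" by (simp add: algebra_simps)
        then have "(real t - real s + 1) / real n \<le> 2 / real k" using n k by (simp add: field_simps)
        moreover have "r t - l s = (real t - real s + 1) / real n" by (simp add: r_def l_def diff_divide_distrib add_divide_distrib)
        ultimately show ?thesis by simp
      qed
      have "(\<Sum>s\<in>P v. (discretise n (poly q) s - discretise n f s)\<^sup>2) \<le> real n * (LINT y|lebesgue_on {l s<..<r t}. (f y - poly q y)\<^sup>2)"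
        unfolding lev(1)[OF v] l_def r_def s_def t_def by (rule block_approx[OF L2 lev(2-4)[OF v]])
      also have "\<dots> \<le> real n * ((r t - l s) powr (2 * \<alpha>) * \<rho> {l s<..<r t})"
        using q(2) by (intro mult_left_mono) auto
      also have "\<dots> \<le> real n * ((2 / real k) powr (2 * \<alpha>) * \<rho> {l s<..<r t})"
        using len u \<alpha> \<rho>0 by (intro mult_left_mono mult_right_mono powr_mono2) auto
      also have "\<dots> = e * \<rho> {l (lo v)<..<r (hi v)}" by (simp add: e_def s_def t_def)
      finally show ?thesis using q(1) \<alpha> by (intro exI[of _ q]) auto
    qed
    have "\<forall>v. \<exists>q. degree q \<le> p \<and> (v \<in> V \<longrightarrow> (\<Sum>s\<in>P v. (discretise n (poly q) s - discretise n f s)\<^sup>2) \<le> e * \<rho> {l (lo v)<..<r (hi v)})"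
      using ex by (metis degree_0 le0)
    then obtain q where q: "\<And>v. degree (q v) \<le> p"
      "\<And>v. v \<in> V \<Longrightarrow> (\<Sum>s\<in>P v. (discretise n (poly (q v)) s - discretise n f s)\<^sup>2) \<le> e * \<rho> {l (lo v)<..<r (hi v)}"
      by metis
    define Q where "Q = (\<lambda>v. {s \<in> {1..n}. lab s = v}) ` lab ` {1..n}"
    define h where "h s = discretise n (poly (q (lab s))) s" for s
    have seg: "Q \<in> interval_partitions n" "card Q \<le> card V" "h \<in> partition_space p n Q"
      using label_segmentation[where lab = lab and n = n and q = q and p = p, OF mono q(1)] unfolding Q_def h_def V_def by auto
    have disj: "disjoint_family_on (\<lambda>v. {l (lo v)<..<r (hi v)}) V"
    proof -
      have "{l (lo v)<..<r (hi v)} \<inter> {l (lo w)<..<r (hi w)} = {}" if "v \<in> V" "w \<in> V" "v < w" for v w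
      proof -
        have "hi v < lo w"
        proof (rule ccontr)
          assume "\<not> hi v < lo w"
          then have "lab (lo w) \<le> lab (hi v)" using lev[OF that(1)] lev[OF that(2)] by (intro mono) auto
          then show False using lev(5,6)[OF that(1)] lev(5)[OF that(2)] that(3) by simp
        qed
        then have "r (hi v) \<le> l (lo w)" using n by (auto simp: l_def r_def intro: divide_right_mono)
        then show ?thesis by auto
      qed
      then show ?thesis unfolding disjoint_family_on_def by (metis Int_commute linorder_neqE_nat)
    qed
    have "(\<Sum>s\<in>{1..n}. (h s - discretise n f s)\<^sup>2) = (\<Sum>v\<in>V. \<Sum>s\<in>P v. (h s - discretise n f s)\<^sup>2)"
      unfolding V_def P_def by (rule sum.image_gen) simp
    also have "\<dots> = (\<Sum>v\<in>V. \<Sum>s\<in>P v. (discretise n (poly (q v)) s - discretise n f s)\<^sup>2)"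
      by (intro sum.cong refl) (auto simp: h_def P_def)
    also have "\<dots> \<le> (\<Sum>v\<in>V. e * \<rho> {l (lo v)<..<r (hi v)})" by (intro sum_mono q(2))
    also have "\<dots> = e * (\<Sum>v\<in>V. \<rho> {l (lo v)<..<r (hi v)})" by (simp only: sum_distrib_left)
    also have "\<dots> \<le> e * K" using e0 sup[rule_format, OF finV disj] by (intro mult_left_mono)
    also have "e * K = real n * (2 powr (2 * \<alpha>) * K * real k powr (- 2 * \<alpha>))"
      using k by (simp add: e_def powr_divide powr_minus field_simps)
    finally show "\<exists>Q h. Q \<in> interval_partitions n \<and> h \<in> partition_space p n Q \<and> card Q \<le> k + 2 * J \<and>
      (\<Sum>s\<in>{1..n}. (h s - discretise n f s)\<^sup>2) \<le> real n * (2 powr (2 * \<alpha>) * K * real k powr (- 2 * \<alpha>))"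
      using seg cardV by (intro exI[of _ Q] exI[of _ h]) auto
  qed
qed

section \<open>From segmentations to breakpoint sets\<close>

lemma discretise_poly_add: "discretise n (poly (a + b)) s = discretise n (poly a) s + discretise n (poly b) s"
proof -
  have "L2_on {0..<1} (poly q)" for q by (intro L2_on_unit_continuous continuous_intros)
  from discretise_diff[OF this this, of n "a + b" b s] show ?thesis by simp
qed

lemma discretise_poly_smult: "discretise n (poly (smult c a)) s = c * discretise n (poly a) s"
  by (simp add: discretise_def)

lemma jump_space_combine:
  assumes "h \<in> jump_space p n B" "h' \<in> jump_space p n B'"
  shows "(\<lambda>s. h s + c * h' s) \<in> jump_space p n (B \<union> B')"
proof -
  obtain q where q: "\<forall>s\<in>{1..n}. degree (q s) \<le> p \<and> h s = discretise n (poly (q s)) s"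
    "\<forall>s\<in>{2..n}. s \<notin> B \<longrightarrow> q s = q (s - 1)" using assms(1) unfolding jump_space_def by blast
  obtain q' where q': "\<forall>s\<in>{1..n}. degree (q' s) \<le> p \<and> h' s = discretise n (poly (q' s)) s"
    "\<forall>s\<in>{2..n}. s \<notin> B' \<longrightarrow> q' s = q' (s - 1)" using assms(2) unfolding jump_space_def by blast
  show ?thesis unfolding jump_space_def mem_Collect_eq
  proof (intro exI[of _ "\<lambda>s. q s + smult c (q' s)"] conjI ballI impI)
    fix s assume s: "s \<in> {1..n}"
    show "degree (q s + smult c (q' s)) \<le> p"
      using q(1) q'(1) s by (intro degree_add_le) (auto intro: order_trans[OF degree_smult_le])
    show "h s + c * h' s = discretise n (poly (q s + smult c (q' s))) s"
      using q(1) q'(1) s by (simp add: discretise_poly_add discretise_poly_smult del: poly_add poly_smult)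
  next
    fix s assume "s \<in> {2..n}" "s \<notin> B \<union> B'"
    then have "q s = q (s - 1)" "q' s = q' (s - 1)" using q(2) q'(2) by blast+
    then show "q s + smult c (q' s) = q (s - 1) + smult c (q' (s - 1))" by (simp only:)
  qed
qed

lemma discretise_poly_0: "discretise n (poly 0) s = 0"
  using discretise_poly_smult[of n 0 0 s] by simp

lemma zero_in_jump_space: "(\<lambda>_. 0) \<in> jump_space p n B"
  unfolding jump_space_def mem_Collect_eq by (rule exI[of _ "\<lambda>_. 0"]) (simp add: discretise_poly_0)

text \<open>In a partition into intervals, a cell that is not the least element of its block has its
  predecessor in the same block, so the polynomial can change only at block minima. There is one
  breakpoint per block, which later makes the noise proportional to the number of blocks.\<close>

lemma partition_space_subset_jump_space:
  assumes Q: "Q \<in> interval_partitions n"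
  shows "partition_space p n Q \<subseteq> jump_space p n (Min ` Q)"
proof -
  interpret vs: vector_space seq_scale by (rule vector_space_seq_scale)
  have part: "partition_on {1..n} Q" and ints: "Q \<subseteq> discrete_intervals n"
    using Q by (auto simp: interval_partitions_def)
  have start: "s \<in> Min ` Q" if P: "P \<in> Q" and s: "s \<in> P" "s - 1 \<notin> P" for P s
  proof -
    obtain i j where ij: "P = {i..j}" "1 \<le> i" "i \<le> j" using P ints by (auto simp: discrete_intervals_def)
    then have "s = i" using s by auto
    moreover have "Min P = i" using ij by (auto intro!: Min_eqI)
    ultimately show ?thesis using P by blast
  qed
  have sub: "vs.subspace (jump_space p n (Min ` Q))"
  proof (rule vs.subspaceI)
    show "0 \<in> jump_space p n (Min ` Q)" using zero_in_jump_space by (simp add: zero_fun_def)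
    show "h + h' \<in> jump_space p n (Min ` Q)" if "h \<in> jump_space p n (Min ` Q)" "h' \<in> jump_space p n (Min ` Q)" for h h'
      using jump_space_combine[OF that, of 1] by (simp add: plus_fun_def)
    show "seq_scale c h \<in> jump_space p n (Min ` Q)" if "h \<in> jump_space p n (Min ` Q)" for c h
      using jump_space_combine[OF zero_in_jump_space[of p n "{}"] that, of c] by (simp add: seq_scale_def)
  qed
  have base: "(\<Union>P\<in>Q. piece_space p n P) \<subseteq> jump_space p n (Min ` Q)"
  proof (intro UN_least subsetI)
    fix P h assume P: "P \<in> Q" and "h \<in> piece_space p n P"
    then obtain q where q: "h = (\<lambda>i. indicator P i * discretise n (poly q) i)" "degree q \<le> p"
      by (auto simp: piece_space_def)
    show "h \<in> jump_space p n (Min ` Q)" unfolding jump_space_def mem_Collect_eq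
    proof (intro exI[of _ "\<lambda>s. if s \<in> P then q else 0"] conjI ballI impI)
      fix s show "degree (if s \<in> P then q else 0) \<le> p" using q(2) by simp
      show "h s = discretise n (poly (if s \<in> P then q else 0)) s" using q(1) by (simp add: discretise_poly_0)
    next
      fix s assume s: "s \<in> {2..n}" "s \<notin> Min ` Q"
      then have "s \<in> \<Union> Q" "s - 1 \<in> \<Union> Q" using part by (auto simp: partition_on_def)
      then obtain P1 P2 where P12: "P1 \<in> Q" "s \<in> P1" "P2 \<in> Q" "s - 1 \<in> P2" by blast
      have "s - 1 \<in> P1" using start[OF P12(1,2)] s(2) by blast
      then have "P1 = P2" using P12 part by (auto simp: partition_on_def disjoint_def)
      then have "s \<in> P \<longleftrightarrow> s - 1 \<in> P" using P12 P part by (auto simp: partition_on_def disjoint_def)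
      then show "(if s \<in> P then q else 0) = (if s - 1 \<in> P then q else 0)" by simp
    qed
  qed
  show ?thesis unfolding partition_space_def by (rule vs.span_minimal[OF base sub])
qed

subsection \<open>The penalised estimator\<close>

lemma card_discrete_intervals: "2 * card (discrete_intervals n) = n * (n + 1)"
proof -
  let ?S = "SIGMA j:{1..n}. {1..j}"
  have "discrete_intervals n = (\<lambda>(j, i). {i..j}) ` ?S"
    unfolding discrete_intervals_def by force
  moreover have "inj_on (\<lambda>(j, i). {i..j}) ?S"
    by (auto simp: inj_on_def Icc_eq_Icc)
  ultimately have "card (discrete_intervals n) = card ?S" by (simp add: card_image)
  also have "\<dots> = (\<Sum>j\<in>{1..n}. j)" by simp
  finally show ?thesis using gauss_sum_from_Suc_0[where 'a = nat, of n] by simp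
qed

text \<open>There are only n (n + 1) / 2 \<le> n^2 discrete intervals. The bound on \<kappa> is what
  makes the factor (\<kappa> + 1) / \<kappa> in the penalty at least 3/2.\<close>

lemma growth_exponent_le_2:
  assumes "K > 0" "\<forall>\<^sub>F n in sequentially. real (card (discrete_intervals n)) \<ge> K * real n powr \<kappa>"
  shows "\<kappa> \<le> 2"
proof (rule ccontr)
  assume "\<not> \<kappa> \<le> 2"
  then have "filterlim (\<lambda>n. K * real n powr (\<kappa> - 2)) at_top sequentially"
    using assms(1) by real_asymp
  then have "\<forall>\<^sub>F n in sequentially. K * real n powr (\<kappa> - 2) > 1"
    by (simp add: filterlim_at_top_dense)
  then have "\<forall>\<^sub>F n in sequentially. False"
    using assms(2) eventually_ge_at_top[of 1]
  proof eventually_elim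
    case (elim n)
    have "2 * real (card (discrete_intervals n)) = real n * (real n + 1)"
      using arg_cong[OF card_discrete_intervals[of n], of real] by (simp add: algebra_simps)
    also have "\<dots> \<le> 2 * (real n)\<^sup>2" using elim(3) by (simp add: power2_eq_square algebra_simps)
    finally have "K * real n powr \<kappa> \<le> (real n)\<^sup>2" using elim(2) by linarith
    then have "K * real n powr \<kappa> * real n powr (- 2) \<le> (real n)\<^sup>2 * real n powr (- 2)"
      by (intro mult_right_mono) auto
    also have "(real n)\<^sup>2 * real n powr (- 2) = 1"
      using elim(3) by (simp add: powr_minus)
    also have "K * real n powr \<kappa> * real n powr (- 2) = K * real n powr (\<kappa> - 2)"
      by (simp add: mult.assoc powr_add[symmetric])
    finally show False using elim(1) by simp
  qed
  then show False by simp
qed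

text \<open>The case n = 1 already forces the dimension bound \<open>D\<close> to be at least
  1.\<close>

lemma dim_singleton_piece_space: "vector_space.dim seq_scale (piece_space p 1 {1}) = 1"
proof -
  interpret vs: vector_space seq_scale by (rule vector_space_seq_scale)
  define e :: "nat \<Rightarrow> real" where "e = indicator {1}"
  have "e \<in> piece_space p 1 {1}"
  proof -
    have "poly 1 = (\<lambda>_. 1 :: real)" by (simp add: fun_eq_iff)
    then have "discretise 1 (poly 1) 1 = 1" by (simp only: discretise_const[of 1 1] order.refl)
    then have "e = (\<lambda>i. indicator {1} i * discretise 1 (poly 1) i)"
      by (auto simp: e_def fun_eq_iff indicator_def)
    then show ?thesis unfolding piece_space_def by (intro CollectI exI[of _ 1]) auto
  qed
  moreover have "piece_space p 1 {1} \<subseteq> vs.span {e}"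
  proof
    fix h assume "h \<in> piece_space p 1 {1}"
    then obtain q where "h = (\<lambda>i. indicator {1} i * discretise 1 (poly q) i)" by (auto simp: piece_space_def)
    then have "h = seq_scale (discretise 1 (poly q) 1) e"
      by (auto simp: e_def seq_scale_def fun_eq_iff indicator_def)
    then show "h \<in> vs.span {e}" by (simp add: vs.span_scale vs.span_base)
  qed
  moreover have "e \<noteq> 0" by (auto simp: e_def fun_eq_iff indicator_def)
  then have "\<not> vs.dependent {e}" by simp
  ultimately show ?thesis using vs.dim_unique[of "{e}"] by simp
qed

text \<open>A deterministic comparison on the event where the noise bound holds. The noise term 2 W
  costs exactly one penalty unit per block of \<open>Q\<close>, which cancels the penalty of the
  estimator, plus a fraction below 1 of its squared error, which is moved to the left.\<close>

lemma penalised_argmin_error: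
  fixes \<delta> \<xi> y g h :: "nat \<Rightarrow> real"
  assumes n: "n \<ge> 1" and c: "c \<ge> 0"
    and Q: "Q \<in> interval_partitions n" "g \<in> partition_space p n Q"
    and Q': "Q' \<in> interval_partitions n" "h \<in> partition_space p n Q'"
    and y: "\<And>s. s \<in> {1..n} \<Longrightarrow> y s = \<delta> s + \<xi> s"
    and le: "penalised_functional n c y (Q, g) \<le> penalised_functional n c y (Q', h)"
    and noise: "\<And>B u. B \<subseteq> {1..n} \<Longrightarrow> u \<in> jump_space p n B \<Longrightarrow>
      (\<Sum>s\<in>{1..n}. u s * \<xi> s)\<^sup>2 \<le> 2 * \<beta> * real (card B + 1) * ln (real n) * (\<Sum>s\<in>{1..n}. (u s)\<^sup>2)"
    and \<beta>: "\<beta> \<ge> 0" "9/4 * \<beta> * ln (real n) \<le> real n * c"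
  shows "(\<Sum>s\<in>{1..n}. (g s - \<delta> s)\<^sup>2) \<le> 306 * (\<Sum>s\<in>{1..n}. (h s - \<delta> s)\<^sup>2) + 54 * (real n * c * real (card Q'))"
proof -
  define A where "A = (\<Sum>s\<in>{1..n}. (g s - \<delta> s)\<^sup>2)"
  define B where "B = (\<Sum>s\<in>{1..n}. (h s - \<delta> s)\<^sup>2)"
  define u where "u s = g s + (-1) * h s" for s
  define W where "W = (\<Sum>s\<in>{1..n}. u s * \<xi> s)"
  define U where "U = (\<Sum>s\<in>{1..n}. (u s)\<^sup>2)"
  define S where "S = Min ` Q \<union> Min ` Q'"
  have finQ: "finite P" "Min ` P \<subseteq> {1..n}" "P \<noteq> {}" if "P \<in> interval_partitions n" for P
  proof -
    have part: "partition_on {1..n} P" "P \<subseteq> discrete_intervals n" using that by (auto simp: interval_partitions_def)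
    then show "finite P" by (auto intro: finite_elements)
    show "P \<noteq> {}" using part(1) n by (auto simp: partition_on_def)
    show "Min ` P \<subseteq> {1..n}"
    proof
      fix b assume "b \<in> Min ` P"
      then obtain I where I: "I \<in> P" "b = Min I" by blast
      then have "I \<in> discrete_intervals n" using part by blast
      then obtain i j where "I = {i..j}" "1 \<le> i" "i \<le> j" "j \<le> n" unfolding discrete_intervals_def by blast
      then show "b \<in> {1..n}" using I Min_eqI[of "{i..j}" i] by auto
    qed
  qed
  have uS: "u \<in> jump_space p n S"
    unfolding u_def S_def using Q Q' partition_space_subset_jump_space by (intro jump_space_combine) auto
  \<comment> \<open>The additive 1 is charged to the competitor, which has at least one block, so
    the coefficient of \<open>card Q\<close> remains exactly 1.\<close>
  have cS: "real (card S + 1) \<le> real (card Q) + 2 * real (card Q')"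
  proof -
    have "card S \<le> card (Min ` Q) + card (Min ` Q')" unfolding S_def by (rule card_Un_le)
    moreover have "card (Min ` Q) \<le> card Q" "card (Min ` Q') \<le> card Q'"
      using finQ(1)[OF Q(1)] finQ(1)[OF Q'(1)] by (auto intro: card_image_le)
    moreover have "card Q' \<ge> 1" using finQ[OF Q'(1)] by (simp add: Suc_le_eq card_gt_0_iff)
    ultimately show ?thesis by linarith
  qed
  have U0: "U \<ge> 0" and B0: "B \<ge> 0" by (auto simp: U_def B_def intro: sum_nonneg)
  have "W\<^sup>2 \<le> 2 * \<beta> * real (card S + 1) * ln (real n) * U"
    unfolding W_def U_def using noise[OF _ uS] finQ[OF Q(1)] finQ[OF Q'(1)] by (auto simp: S_def)
  \<comment> \<open>8/9 is the noise constant 2 divided by the penalty constant 9/4; the argument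
    rests on this ratio being below 1.\<close>
  also have "\<dots> = 8/9 * (9/4 * \<beta> * ln (real n)) * (real (card S + 1) * U)" by simp
  also have "\<dots> \<le> 8/9 * (real n * c) * ((real (card Q) + 2 * real (card Q')) * U)"
    by (rule mult_mono[OF mult_left_mono[OF \<beta>(2)] mult_right_mono[OF cS U0]]) (use U0 c in auto)
  finally have W2: "W\<^sup>2 \<le> 8/9 * U * (real n * c * (real (card Q) + 2 * real (card Q')))" by (simp add: mult_ac)
  have W: "2 * W \<le> real n * c * (real (card Q) + 2 * real (card Q')) + 8/9 * U"
  proof -
    define X where "X = real n * c * (real (card Q) + 2 * real (card Q'))"
    have X0: "X \<ge> 0" using c by (simp add: X_def)
    have "W\<^sup>2 \<le> 8/9 * U * X" using W2 by (simp only: X_def)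
    then have "(2 * W)\<^sup>2 \<le> 4 * (8/9 * U * X)" by (simp add: power_mult_distrib)
    \<comment> \<open>The arithmetic-geometric mean inequality, arranged to leave coefficient 1 on
      the penalty part \<open>X\<close>.\<close>
    also have "\<dots> \<le> (X + 8/9 * U)\<^sup>2"
      using zero_le_power2[of "X - 8/9 * U"] by (simp add: power2_eq_square algebra_simps)
    finally have "2 * W \<le> X + 8/9 * U" by (rule power2_le_imp_le) (use X0 U0 in simp)
    then show ?thesis by (simp add: X_def)
  qed
  \<comment> \<open>Young's inequality with weight 1/16: then 8/9 * 17/16 = 17/18 is still below
    1.\<close>
  have "U \<le> (\<Sum>s\<in>{1..n}. 17/16 * (g s - \<delta> s)\<^sup>2 + 17 * (h s - \<delta> s)\<^sup>2)"
    unfolding U_def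
  proof (rule sum_mono)
    fix s
    show "(u s)\<^sup>2 \<le> 17/16 * (g s - \<delta> s)\<^sup>2 + 17 * (h s - \<delta> s)\<^sup>2"
    proof -
      have "(a - b)\<^sup>2 \<le> 17/16 * a\<^sup>2 + 17 * b\<^sup>2" for a b :: real
        using zero_le_power2[of "a / 4 + 4 * b"] by (simp add: power2_eq_square field_simps)
      from this[of "g s - \<delta> s" "h s - \<delta> s"] show ?thesis by (simp add: u_def)
    qed
  qed
  then have UAB: "U \<le> 17/16 * A + 17 * B" by (simp add: A_def B_def sum.distrib sum_distrib_left)
  have sq: "(L2_set (\<lambda>s. v s - y s) {1..n})\<^sup>2 = (\<Sum>s\<in>{1..n}. (v s - \<delta> s)\<^sup>2) - 2 * (\<Sum>s\<in>{1..n}. (v s - \<delta> s) * \<xi> s) + (\<Sum>s\<in>{1..n}. (\<xi> s)\<^sup>2)" for v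
  proof -
    have "(L2_set (\<lambda>s. v s - y s) {1..n})\<^sup>2 = (\<Sum>s\<in>{1..n}. (v s - y s)\<^sup>2)"
      by (simp add: L2_set_def sum_nonneg)
    also have "\<dots> = (\<Sum>s\<in>{1..n}. (v s - \<delta> s)\<^sup>2 - 2 * ((v s - \<delta> s) * \<xi> s) + (\<xi> s)\<^sup>2)"
      using y by (intro sum.cong refl) (auto simp: power2_eq_square algebra_simps)
    finally show ?thesis by (simp add: sum.distrib sum_subtractf sum_distrib_left)
  qed
  have "W = (\<Sum>s\<in>{1..n}. (g s - \<delta> s) * \<xi> s) - (\<Sum>s\<in>{1..n}. (h s - \<delta> s) * \<xi> s)"
    unfolding W_def sum_subtractf[symmetric] by (intro sum.cong refl) (simp add: u_def algebra_simps)
  moreover have "real n * (c * real (card Q) + (L2_set (\<lambda>s. g s - y s) {1..n})\<^sup>2 / real n)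
      \<le> real n * (c * real (card Q') + (L2_set (\<lambda>s. h s - y s) {1..n})\<^sup>2 / real n)"
    using le by (intro mult_left_mono) (auto simp: penalised_functional_def)
  then have "real n * c * real (card Q) + (L2_set (\<lambda>s. g s - y s) {1..n})\<^sup>2
      \<le> real n * c * real (card Q') + (L2_set (\<lambda>s. h s - y s) {1..n})\<^sup>2"
    using n by (simp add: distrib_left mult.assoc)
  ultimately have "real n * c * real (card Q) + A \<le> real n * c * real (card Q') + B + 2 * W"
    unfolding sq A_def B_def by simp
  moreover have "real n * c * (real (card Q) + 2 * real (card Q')) = real n * c * real (card Q) + 2 * (real n * c * real (card Q'))"
    by (simp add: algebra_simps)
  \<comment> \<open>What remains is A/18 \<le> 3 n c |Q'| + (1 + 8/9 * 17) B. Multiplying by 18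
    gives 54 and 290, and 306 is a rounded-up value of the latter.\<close>
  ultimately have "A \<le> 306 * B + 54 * (real n * c * real (card Q'))" using W UAB B0 by linarith
  then show ?thesis by (simp add: A_def B_def)
qed

section \<open>From vectors back to functions\<close>

lemma step_embedding_on_cell:
  assumes "s \<in> {1..n}" "t \<in> cell n s"
  shows "step_embedding n z t = z s"
proof -
  have n: "n > 0" using assms by auto
  have "t \<notin> cell n i" if "i \<noteq> s" for i
  proof
    assume "t \<in> cell n i"
    then have "real i - 1 < real s" "real s - 1 < real i"
      using assms(2) n by (auto simp: cell_def field_simps)
    then show False using that by linarith
  qed
  then have "step_embedding n z t = (\<Sum>i\<in>{1..n}. if i = s then z i else 0)"
    unfolding step_embedding_def using assms(2) by (intro sum.cong) auto
  then show ?thesis using assms(1) by simp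
qed

text \<open>The first sum is the error of the vector, the second the error of replacing f by its
  cell means. Without integrability of the squared difference its integral is 0 by convention and
  the bound is trivial, so the cell decomposition may assume it.\<close>

lemma L2_norm_step_error:
  assumes f: "L2_on {0..<1} f" and n: "n \<ge> 1"
  shows "(L2_norm (\<lambda>t. step_embedding n z t - f t))\<^sup>2
    \<le> 2 * ((\<Sum>s\<in>{1..n}. (z s - discretise n f s)\<^sup>2) / real n)
      + 2 * (\<Sum>s\<in>{1..n}. LINT y|lebesgue_on (cell n s). (f y - discretise n f s)\<^sup>2)"
proof -
  let ?g = "\<lambda>t. (step_embedding n z t - f t)\<^sup>2"
  have sq: "(L2_norm (\<lambda>t. step_embedding n z t - f t))\<^sup>2 = integral\<^sup>L (lebesgue_on {0..<1}) ?g"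
    unfolding L2_norm_def by (intro real_sqrt_pow2 integral_nonneg_AE) simp
  show ?thesis
  proof (cases "integrable (lebesgue_on {0..<1}) ?g")
    case False
    then show ?thesis unfolding sq by (simp add: not_integrable_integral_eq sum_nonneg)
  next
    case True
    have "integral\<^sup>L (lebesgue_on {0..<1}) ?g = integral\<^sup>L (lebesgue_on {real 0 / real n<..<real n / real n}) ?g"
      using n by (simp add: integral_lebesgue_on_half_open)
    also have "\<dots> = (\<Sum>s\<in>{0+1..n}. integral\<^sup>L (lebesgue_on (cell n s)) ?g)"
      by (rule integral_cells[OF True]) auto
    also have "\<dots> \<le> (\<Sum>s\<in>{0+1..n}. 2 * ((z s - discretise n f s)\<^sup>2 / real n) + 2 * (LINT y|lebesgue_on (cell n s). (f y - discretise n f s)\<^sup>2))"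
    proof (rule sum_mono)
      fix s assume "s \<in> {0+1..n}"
      then have s: "1 \<le> s" "s \<le> n" "s \<in> {1..n}" by auto
      let ?L = "lebesgue_on (cell n s)"
      define d where "d = discretise n f s"
      have fd: "integrable ?L (\<lambda>y. (f y - d)\<^sup>2)"
        using L2_on_cell[OF L2_on_diff[OF f L2_on_unit_continuous[OF continuous_on_const]] s(1,2)] by (simp add: L2_on_def)
      have fz: "integrable ?L (\<lambda>y. (z s - f y)\<^sup>2)"
        using L2_on_cell[OF L2_on_diff[OF L2_on_unit_continuous[OF continuous_on_const] f] s(1,2)] by (simp add: L2_on_def)
      have ci: "integrable ?L (\<lambda>_. k)" for k :: real by (rule integrable_continuous_on_cell[OF continuous_on_const])
      have m: "measure ?L (space ?L) = 1 / real n"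
        using s by (simp add: measure_restrict_space measure_cell cell_def diff_divide_distrib divide_right_mono)
      have "integral\<^sup>L ?L ?g = (LINT y|?L. (z s - f y)\<^sup>2)"
        by (rule Bochner_Integration.integral_cong) (use step_embedding_on_cell[OF s(3)] in auto)
      also have "\<dots> \<le> (LINT y|?L. 2 * (z s - d)\<^sup>2 + 2 * (f y - d)\<^sup>2)"
      proof (rule integral_mono)
        show "(z s - f y)\<^sup>2 \<le> 2 * (z s - d)\<^sup>2 + 2 * (f y - d)\<^sup>2" for y
          using zero_le_power2[of "(z s - d) + (f y - d)"] by (simp add: power2_eq_square algebra_simps)
      qed (use fz fd ci in auto)
      also have "\<dots> = 2 * ((z s - d)\<^sup>2 / real n) + 2 * (LINT y|?L. (f y - d)\<^sup>2)"
        using fd ci m by simp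
      finally show "integral\<^sup>L ?L ?g \<le> 2 * ((z s - discretise n f s)\<^sup>2 / real n) + 2 * (LINT y|?L. (f y - discretise n f s)\<^sup>2)"
        by (simp add: d_def)
    qed
    also have "\<dots> = 2 * ((\<Sum>s\<in>{1..n}. (z s - discretise n f s)\<^sup>2) / real n)
      + 2 * (\<Sum>s\<in>{1..n}. LINT y|lebesgue_on (cell n s). (f y - discretise n f s)\<^sup>2)"
      by (simp add: sum.distrib sum_distrib_left sum_divide_distrib)
    finally show ?thesis unfolding sq .
  qed
qed

theorem theorem6:
  fixes \<Omega> :: "'w measure"
    and p J :: nat and \<alpha> \<beta> \<kappa> D :: real
    and x :: "nat \<Rightarrow> real" and f :: "real \<Rightarrow> real"
    and \<xi> Y :: "nat \<Rightarrow> nat \<Rightarrow> 'w \<Rightarrow> real"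
    and \<gamma> :: "nat \<Rightarrow> real"
    and Phat :: "nat \<Rightarrow> 'w \<Rightarrow> nat set set"
    and fhat :: "nat \<Rightarrow> 'w \<Rightarrow> nat \<Rightarrow> real"
  assumes "prob_space \<Omega>"
    and "0 < \<alpha>" and "\<alpha> < real p + 1"
    and "piecewise_sobolev \<alpha> J x f"
    and "\<And>n s. n \<ge> 1 \<Longrightarrow> s \<in> {1..n} \<Longrightarrow> \<xi> n s \<in> borel_measurable \<Omega>"
    and "\<And>n s \<omega>. n \<ge> 1 \<Longrightarrow> s \<in> {1..n} \<Longrightarrow> \<omega> \<in> space \<Omega> \<Longrightarrow>
           Y n s \<omega> = discretise n f s + \<xi> n s \<omega>"
    and "\<beta> > 0"
    and "\<And>n (\<mu> :: nat \<Rightarrow> real) c. n \<ge> 1 \<Longrightarrow> c \<ge> 0 \<Longrightarrow>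
           measure \<Omega> {\<omega> \<in> space \<Omega>. \<bar>\<Sum>s\<in>{1..n}. \<mu> s * \<xi> n s \<omega>\<bar> \<ge> c}
             \<le> 2 * exp (- (c\<^sup>2 / (\<beta> * (\<Sum>s\<in>{1..n}. (\<mu> s)\<^sup>2))))"
    and "\<kappa> > 0"
    and "\<exists>K>0. \<forall>\<^sub>F n in sequentially. real (card (discrete_intervals n)) \<ge> K * real n powr \<kappa>"
    and "\<And>n P. n \<ge> 1 \<Longrightarrow> P \<in> discrete_intervals n \<Longrightarrow>
           real (vector_space.dim seq_scale (piece_space p n P)) \<le> D"
    and "\<And>n. n \<ge> 1 \<Longrightarrow> \<gamma> n > 0"
    and "\<gamma> \<longlonglongrightarrow> 0"
    and "\<forall>\<^sub>F n in sequentially.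
           \<gamma> n > \<beta> * D * ((\<kappa> + 1) / \<kappa>) * (ln (real (card (discrete_intervals n))) / real n)"
    and "\<And>n \<omega>. n \<ge> 1 \<Longrightarrow> \<omega> \<in> space \<Omega> \<Longrightarrow>
           is_arg_min (penalised_functional n (\<gamma> n) (\<lambda>s. Y n s \<omega>))
             (\<lambda>u. u \<in> segmentations p n) (Phat n \<omega>, fhat n \<omega>)"
  shows "AE \<omega> in \<Omega>. (\<lambda>n. (L2_norm (\<lambda>t. step_embedding n (fhat n \<omega>) t - f t))\<^sup>2)
           \<in> O(\<lambda>n. \<gamma> n powr (2 * \<alpha> / (2 * \<alpha> + 1)))"
proof -
  define \<theta> where "\<theta> = 2 * \<alpha> / (2 * \<alpha> + 1)"
  define \<eta> where "\<eta> = 1 / (2 * \<alpha> + 1)"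
  have \<theta>: "0 < \<theta>" "\<theta> < 1" "0 < \<eta>" "\<eta> < 1" "1 - \<eta> = \<theta>" "2 * \<alpha> * \<eta> = \<theta>"
    using \<open>0 < \<alpha>\<close> by (auto simp: \<theta>_def \<eta>_def field_simps)
  have L2: "L2_on {0..<1} f" by (rule piecewise_sobolev_L2_on[OF assms(4)])
  obtain C1 where C1: "C1 \<ge> 0" "\<And>n. n \<ge> 1 \<Longrightarrow>
    (\<Sum>s\<in>{1..n}. LINT y|lebesgue_on (cell n s). (f y - discretise n f s)\<^sup>2) \<le> C1 * (1 / real n) powr \<theta>"
    using cell_average_error[OF assms(4,2)] unfolding \<theta>_def by blast
  obtain C2 where C2: "C2 \<ge> 0" "\<And>n k. 1 \<le> k \<Longrightarrow> k \<le> n \<Longrightarrow> \<exists>Q h. Q \<in> interval_partitions n \<and>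
    h \<in> partition_space p n Q \<and> card Q \<le> k + 2 * J \<and>
    (\<Sum>s\<in>{1..n}. (h s - discretise n f s)\<^sup>2) \<le> real n * (C2 * real k powr (- 2 * \<alpha>))"
    using partition_approx[OF assms(4,2,3)] by blast
  have D: "D \<ge> 1"
  proof -
    have "{1} \<in> discrete_intervals 1" by (auto simp: discrete_intervals_def intro!: exI[of _ 1])
    from assms(11)[OF order.refl this] show ?thesis by (simp only: dim_singleton_piece_space of_nat_1)
  qed
  have \<kappa>: "(\<kappa> + 1) / \<kappa> \<ge> 3/2"
    using assms(10) growth_exponent_le_2[of _ \<kappa>] \<open>\<kappa> > 0\<close> by (auto simp: field_simps)
  have penalty: "\<forall>\<^sub>F n in sequentially. 9/4 * \<beta> * ln (real n) \<le> real n * \<gamma> n"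
  proof -
    \<comment> \<open>The logarithm of the number of intervals grows like 2 ln n, so every factor
      below 2 is admissible eventually. With (\<kappa> + 1) / \<kappa> \<ge> 3/2 and D \<ge> 1 this
      gives 9/4.\<close>
    have "\<forall>\<^sub>F n in sequentially. 3/2 * ln (real n) \<le> ln (real n * (real n + 1) / 2)" by real_asymp
    then show ?thesis using assms(14) eventually_ge_at_top[of 1]
    proof eventually_elim
      case (elim n)
      have card_eq: "real (card (discrete_intervals n)) = real n * (real n + 1) / 2"
        using arg_cong[OF card_discrete_intervals[of n], of real] by (simp add: algebra_simps)
      have l: "3/2 * ln (real n) \<le> ln (real (card (discrete_intervals n)))"
        unfolding card_eq by (rule elim(1))
      have ln0: "ln (real n) \<ge> 0" using elim(3) by simp
      have "9/4 * \<beta> * ln (real n) = \<beta> * 1 * (3/2) * (3/2 * ln (real n))" by simp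
      also have "\<dots> \<le> \<beta> * D * ((\<kappa> + 1) / \<kappa>) * ln (real (card (discrete_intervals n)))"
        using \<open>\<beta> > 0\<close> \<open>\<kappa> > 0\<close> D \<kappa> l ln0 by (intro mult_mono mult_nonneg_nonneg) auto
      also have "\<dots> = real n * (\<beta> * D * ((\<kappa> + 1) / \<kappa>) * (ln (real (card (discrete_intervals n))) / real n))"
        using elim(3) by simp
      also have "\<dots> \<le> real n * \<gamma> n" using elim(2) by (intro mult_left_mono) auto
      finally show ?case .
    qed
  qed
  \<comment> \<open>Together with \<open>penalty\<close> this yields 1/n \<le> \<gamma>_n, used
    twice below: for k \<le> n and to absorb the error of the cell means.\<close>
  have large: "\<forall>\<^sub>F n in sequentially. 1 \<le> 9/4 * \<beta> * ln (real n)"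
    using \<open>\<beta> > 0\<close> by real_asymp
  have small: "\<forall>\<^sub>F n in sequentially. \<gamma> n < 1"
    using order_tendstoD(2)[OF assms(13), of 1] by simp
  \<comment> \<open>Twice the constants 306 and 54 of the vector estimate, and twice that of the
    cell means. In 2 + 2 J, the first 2 is the loss from rounding k up and 2 J counts the extra
    blocks at jumps, using \<gamma>_n \<le> \<gamma>_n powr \<theta>.\<close>
  define C where "C = 612 * C2 + 108 * (2 + 2 * real J) + 2 * C1"
  have "AE \<omega> in \<Omega>. \<forall>\<^sub>F n in sequentially. \<forall>B h. B \<subseteq> {1..n} \<longrightarrow> h \<in> jump_space p n B \<longrightarrow>
      (\<Sum>s\<in>{1..n}. h s * \<xi> n s \<omega>)\<^sup>2 \<le> 2 * \<beta> * real (card B + 1) * ln (real n) * (\<Sum>s\<in>{1..n}. (h s)\<^sup>2)"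
    by (rule prob_space.AE_jump_space_noise[OF assms(1)]) (use assms in auto)
  then show ?thesis using AE_space
  proof eventually_elim
    case (elim \<omega>)
    show ?case
    proof (rule bigoI[of _ C])
      show "\<forall>\<^sub>F n in sequentially. norm ((L2_norm (\<lambda>t. step_embedding n (fhat n \<omega>) t - f t))\<^sup>2)
          \<le> C * norm (\<gamma> n powr (2 * \<alpha> / (2 * \<alpha> + 1)))"
        using elim(1) penalty large small eventually_ge_at_top[of 1]
      proof eventually_elim
        case (elim n)
        have n: "n \<ge> 1" by (rule elim(5))
        have \<gamma>0: "\<gamma> n > 0" by (rule assms(12)[OF n])
        have n\<gamma>: "1 / real n \<le> \<gamma> n" using elim(2,3) n by (simp add: field_simps)
        define k where "k = nat \<lceil>\<gamma> n powr (- \<eta>)\<rceil>"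
        have g1: "1 \<le> \<gamma> n powr (- \<eta>)"
          using \<gamma>0 elim(4) \<theta> ge_one_powr_ge_zero[of "1 / \<gamma> n" \<eta>] by (simp add: powr_minus powr_divide field_simps)
        have k1: "\<gamma> n powr (- \<eta>) \<le> real k" unfolding k_def by (rule real_nat_ceiling_ge)
        have k2: "real k \<le> 2 * \<gamma> n powr (- \<eta>)"
          unfolding k_def using g1 by linarith
        have kge: "1 \<le> k" using g1 k1 by linarith
        have "\<gamma> n powr (- \<eta>) \<le> (1 / real n) powr (- \<eta>)"
          using n\<gamma> n \<theta> by (intro powr_mono2') auto
        also have "\<dots> = real n powr \<eta>" using n by (simp add: powr_minus powr_divide)
        also have "\<dots> \<le> real n powr 1" using n \<theta> by (intro powr_mono) auto
        finally have kle: "k \<le> n" unfolding k_def using n by (simp add: nat_le_iff ceiling_le_iff)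
        obtain Q h where Q: "Q \<in> interval_partitions n" "h \<in> partition_space p n Q" "card Q \<le> k + 2 * J"
          "(\<Sum>s\<in>{1..n}. (h s - discretise n f s)\<^sup>2) \<le> real n * (C2 * real k powr (- 2 * \<alpha>))"
          using C2(2)[OF kge kle] by blast
        have am: "(Phat n \<omega>, fhat n \<omega>) \<in> segmentations p n"
          "penalised_functional n (\<gamma> n) (\<lambda>s. Y n s \<omega>) (Phat n \<omega>, fhat n \<omega>) \<le> penalised_functional n (\<gamma> n) (\<lambda>s. Y n s \<omega>) (Q, h)"
          using assms(15)[OF n \<open>\<omega> \<in> space \<Omega>\<close>] Q(1,2) by (auto simp: is_arg_min_def segmentations_def not_less)
        have "(\<Sum>s\<in>{1..n}. (fhat n \<omega> s - discretise n f s)\<^sup>2)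
          \<le> 306 * (\<Sum>s\<in>{1..n}. (h s - discretise n f s)\<^sup>2) + 54 * (real n * \<gamma> n * real (card Q))"
        proof (rule penalised_argmin_error[OF n _ _ _ Q(1,2) _ am(2), where \<xi> = "\<lambda>s. \<xi> n s \<omega>" and \<beta> = \<beta>])
          show "Y n s \<omega> = discretise n f s + \<xi> n s \<omega>" if "s \<in> {1..n}" for s
            by (rule assms(6)[OF n that \<open>\<omega> \<in> space \<Omega>\<close>])
        qed (use am(1) \<gamma>0 \<open>\<beta> > 0\<close> elim(1,2) in \<open>auto simp: segmentations_def\<close>)
        also have "\<dots> \<le> 306 * (real n * (C2 * \<gamma> n powr \<theta>)) + 54 * (real n * ((2 + 2 * real J) * \<gamma> n powr \<theta>))"
        proof (intro add_mono mult_left_mono)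
          have "real k powr (- 2 * \<alpha>) \<le> (\<gamma> n powr (- \<eta>)) powr (- 2 * \<alpha>)"
            using k1 \<gamma>0 \<open>0 < \<alpha>\<close> by (intro powr_mono2') auto
          also have "\<dots> = \<gamma> n powr \<theta>" using \<theta>(6) by (simp add: powr_powr mult.commute)
          finally have "real n * (C2 * real k powr (- 2 * \<alpha>)) \<le> real n * (C2 * \<gamma> n powr \<theta>)"
            using C2(1) by (intro mult_left_mono) auto
          then show "(\<Sum>s\<in>{1..n}. (h s - discretise n f s)\<^sup>2) \<le> real n * (C2 * \<gamma> n powr \<theta>)" using Q(4) by linarith
          have "\<gamma> n * real k \<le> \<gamma> n * (2 * \<gamma> n powr (- \<eta>))" using k2 \<gamma>0 by (intro mult_left_mono) auto
          also have "\<dots> = 2 * (\<gamma> n powr 1 * \<gamma> n powr (- \<eta>))" using \<gamma>0 by simp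
          also have "\<dots> = 2 * \<gamma> n powr \<theta>" using \<theta>(5) by (simp only: powr_add[symmetric]) simp
          finally have a: "\<gamma> n * real k \<le> 2 * \<gamma> n powr \<theta>" .
          have "\<gamma> n powr 1 \<le> \<gamma> n powr \<theta>" using \<gamma>0 elim(4) \<theta> by (intro powr_mono') auto
          then have "\<gamma> n * (2 * real J) \<le> \<gamma> n powr \<theta> * (2 * real J)" using \<gamma>0 by (intro mult_right_mono) auto
          then have "\<gamma> n * (real k + 2 * real J) \<le> (2 + 2 * real J) * \<gamma> n powr \<theta>" using a by (simp add: algebra_simps)
          moreover have "\<gamma> n * real (card Q) \<le> \<gamma> n * (real k + 2 * real J)"
          proof (rule mult_left_mono)
            have "real (card Q) \<le> real (k + 2 * J)" using Q(3) by (simp only: of_nat_le_iff)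
            then show "real (card Q) \<le> real k + 2 * real J" by simp
          qed (use \<gamma>0 in simp)
          ultimately have "\<gamma> n * real (card Q) \<le> (2 + 2 * real J) * \<gamma> n powr \<theta>" by linarith
          then show "real n * \<gamma> n * real (card Q) \<le> real n * ((2 + 2 * real J) * \<gamma> n powr \<theta>)"
            by (simp add: mult.assoc mult_left_mono)
        qed auto
        also have "\<dots> = real n * ((306 * C2 + 54 * (2 + 2 * real J)) * \<gamma> n powr \<theta>)" by (simp add: algebra_simps)
        finally have main: "(\<Sum>s\<in>{1..n}. (fhat n \<omega> s - discretise n f s)\<^sup>2) / real n \<le> (306 * C2 + 54 * (2 + 2 * real J)) * \<gamma> n powr \<theta>"
          using n by (simp add: divide_le_eq mult.commute)
        have "(L2_norm (\<lambda>t. step_embedding n (fhat n \<omega>) t - f t))\<^sup>2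
          \<le> 2 * ((\<Sum>s\<in>{1..n}. (fhat n \<omega> s - discretise n f s)\<^sup>2) / real n)
            + 2 * (\<Sum>s\<in>{1..n}. LINT y|lebesgue_on (cell n s). (f y - discretise n f s)\<^sup>2)"
          by (rule L2_norm_step_error[OF L2 n])
        also have "\<dots> \<le> 2 * ((306 * C2 + 54 * (2 + 2 * real J)) * \<gamma> n powr \<theta>) + 2 * (C1 * \<gamma> n powr \<theta>)"
        proof (intro add_mono mult_left_mono main)
          have "(1 / real n) powr \<theta> \<le> \<gamma> n powr \<theta>" using n\<gamma> \<theta> by (intro powr_mono2) auto
          then have "C1 * (1 / real n) powr \<theta> \<le> C1 * \<gamma> n powr \<theta>" using C1(1) by (intro mult_left_mono)
          then show "(\<Sum>s\<in>{1..n}. LINT y|lebesgue_on (cell n s). (f y - discretise n f s)\<^sup>2) \<le> C1 * \<gamma> n powr \<theta>"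
            using C1(2)[OF n] by linarith
        qed auto
        also have "\<dots> = C * \<gamma> n powr \<theta>" by (simp add: C_def algebra_simps)
        finally show ?case by (simp add: \<theta>_def)
      qed
    qed
  qed
qed

end
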